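(* Let $X=(X_t)_{t\ge 0}$ be a one-dimensional time-homogeneous diffusion process starting from zero which is a (weak) solution of $dX_t=b(X_t)\,dt+\sigma(X_t)\,dB_t$, $X_0=0$, where $b:\mathbb{R}\to\mathbb{R}$ is Borel measurable, $\sigma:\mathbb{R}\to[0,\infty)$ is locally bounded, and $B$ is a standard Brownian motion on a filtered probability space $(\Omega,\mathcal{F},\{\mathcal{F}_t\},\mathbb{P})$ satisfying the usual conditions. Let $X^*_t=\sup_{0\le s\le t}|X_s|$ and let $\mathcal{L}=b(x)\frac{d}{dx}+\frac12\sigma^2(x)\frac{d^2}{dx^2}$ be the generator of $X$. Let $g:\mathbb{R}_+\to\mathbb{R}_+$ be a strictly increasing continuous function with $g(0)=0$, and let $f:\mathbb{R}\to\mathbb{R}$ be a $C^2$ function satisfying $\mathcal{L}f=1$ on $\mathbb{R}$ and $f(0)=0$. Suppose that there exists $\beta>1$ such that $$\lim_{\delta\downarrow 0}\ \sup_{\lambda>0,\ |x|<\delta\lambda,\ |y|<\delta\lambda}\ \frac{f(y)-f(x)}{g^{-1}(\beta\lambda)-g^{-1}(\lambda)}=0.$$ Then for every moderate function $F$ there exists a constant $c_F>0$ such that for every stopping time $\tau$ with respect to $\{\mathcal{F}_t\}$, $$\mathbb{E}F(X^*_\tau)\ge c_F\,\mathbb{E}F(g(\tau)).$$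
   Context: $\mathbb{R}_+=[0,\infty)$. A function $F:\mathbb{R}_+\to\mathbb{R}_+$ is called moderate if (a) it is continuous, increasing (in the weak sense) and $F(0)=0$, and (b) there exists $\beta>1$ such that $\sup_{x>0}F(\beta x)/F(x)<\infty$, with the conventions $0/0=1$ and $x/0=\infty$ for $x>0$. $X$ is a time-homogeneous diffusion, so it has continuous paths and is a time-homogeneous Markov process with respect to $\{\mathcal{F}_t\}$, the diffusion with the same coefficients $b,\sigma$ being available from every starting point $x\in\mathbb{R}$. The limit hypothesis presupposes that $g^{-1}$ is defined on all of $\mathbb{R}_+$, i.e. that $g$ maps $\mathbb{R}_+$ onto $\mathbb{R}_+$. *)

theory Defs
  imports "HOL-Probability.Probability"
begin

text \<open>
  Conventions. Processes are indexed by real times, of which only the times \<open>t \<ge> 0\<close> matter.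
  Filtrations are indexed by \<^typ>\<open>ennreal\<close>, so that \<^const>\<open>stopping_time\<close> from the library covers
  stopping times with values in \<open>[0, \<infinity>]\<close>. The sigma-algebra with index \<open>\<infinity>\<close> is only required
  to contain the earlier ones; the stopping time condition at \<open>\<infinity>\<close> holds trivially.
\<close>

section \<open>Moderate functions and the values at infinity\<close>

definition moderate_ratio :: "real \<Rightarrow> real \<Rightarrow> ennreal" where
  "moderate_ratio a b = (if b = 0 then (if a = 0 then 1 else \<infinity>) else ennreal (a / b))"

definition moderate :: "(real \<Rightarrow> real) \<Rightarrow> bool" where
  "moderate F \<longleftrightarrow> F \<in> {0..} \<rightarrow> {0..} \<and> continuous_on {0..} F \<and> mono_on {0..} F \<and> F 0 = 0 \<and>
     (\<exists>\<beta>>1. (SUP x\<in>{0<..}. moderate_ratio (F (\<beta> * x)) (F x)) < \<infinity>)"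

text \<open>Extension of a nonnegative increasing function on \<open>[0, \<infinity>)\<close> to \<open>[0, \<infinity>]\<close>, where
  the value at \<open>\<infinity>\<close> is the limit, that is, the supremum.\<close>

definition extend_infty :: "(real \<Rightarrow> real) \<Rightarrow> ennreal \<Rightarrow> ennreal" where
  "extend_infty h t =
     (if t = \<infinity> then (SUP s\<in>{0..}. ennreal (h s)) else ennreal (h (enn2real t)))"

text \<open>The running maximum \<open>sup {|X s| | 0 \<le> s \<le> t}\<close>; for \<open>t = \<infinity>\<close> the supremum is over all times.\<close>

definition running_max :: "(real \<Rightarrow> 'a \<Rightarrow> real) \<Rightarrow> ennreal \<Rightarrow> 'a \<Rightarrow> ennreal" where
  "running_max X t \<omega> = (SUP s\<in>{s. 0 \<le> s \<and> ennreal s \<le> t}. ennreal \<bar>X s \<omega>\<bar>)"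

section \<open>Filtered probability spaces and Brownian motion\<close>

definition usual_filtered_space :: "'a measure \<Rightarrow> (ennreal \<Rightarrow> 'a measure) \<Rightarrow> bool" where
  "usual_filtered_space M F \<longleftrightarrow>
     prob_space M \<and> filtration (space M) F \<and> (\<forall>t. subalgebra M (F t)) \<and>
     complete_measure M \<and> null_sets M \<subseteq> sets (F 0) \<and>
     (\<forall>t<\<infinity>. sets (F t) = (\<Inter>u\<in>{t<..}. sets (F u)))"

definition adapted_process ::
    "(ennreal \<Rightarrow> 'a measure) \<Rightarrow> (real \<Rightarrow> 'a \<Rightarrow> real) \<Rightarrow> bool" where
  "adapted_process F X \<longleftrightarrow> (\<forall>t\<ge>0. X t \<in> borel_measurable (F (ennreal t)))"

definition continuous_paths :: "'a measure \<Rightarrow> (real \<Rightarrow> 'a \<Rightarrow> real) \<Rightarrow> bool" where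
  "continuous_paths M X \<longleftrightarrow> (\<forall>\<omega>\<in>space M. continuous_on {0..} (\<lambda>t. X t \<omega>))"

definition progressive_process ::
    "(ennreal \<Rightarrow> 'a measure) \<Rightarrow> (real \<Rightarrow> 'a \<Rightarrow> real) \<Rightarrow> bool" where
  "progressive_process F H \<longleftrightarrow>
     (\<forall>t\<ge>0. (\<lambda>(s, \<omega>). H s \<omega>) \<in>
        borel_measurable (restrict_space borel {0..t} \<Otimes>\<^sub>M F (ennreal t)))"

definition brownian_motion ::
    "'a measure \<Rightarrow> (ennreal \<Rightarrow> 'a measure) \<Rightarrow> (real \<Rightarrow> 'a \<Rightarrow> real) \<Rightarrow> bool" where
  "brownian_motion M F B \<longleftrightarrow>
     adapted_process F B \<and> continuous_paths M B \<and> (AE \<omega> in M. B 0 \<omega> = 0) \<and>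
     (\<forall>s t. 0 \<le> s \<and> s < t \<longrightarrow>
        distributed M lborel (\<lambda>\<omega>. B t \<omega> - B s \<omega>)
          (\<lambda>x. ennreal (normal_density 0 (sqrt (t - s)) x)) \<and>
        prob_space.indep_set M (sets (F (ennreal s)))
          {(\<lambda>\<omega>. B t \<omega> - B s \<omega>) -` A \<inter> space M | A. A \<in> sets borel})"

section \<open>The Ito integral\<close>

text \<open>A simple integrand is \<open>\<Sum>i<n. \<xi> i * 1_(p i, p (i + 1)]\<close> with \<open>\<xi> i\<close> bounded and measurable
  with respect to the sigma-algebra at time \<open>p i\<close>.\<close>

definition simple_integrand ::
    "'a measure \<Rightarrow> (ennreal \<Rightarrow> 'a measure) \<Rightarrow> nat \<Rightarrow> (nat \<Rightarrow> real) \<Rightarrow> (nat \<Rightarrow> 'a \<Rightarrow> real) \<Rightarrow> bool" where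
  "simple_integrand M F n p \<xi> \<longleftrightarrow>
     0 \<le> p 0 \<and>
     (\<forall>i<n. p i \<le> p (Suc i) \<and> \<xi> i \<in> borel_measurable (F (ennreal (p i))) \<and>
            (\<exists>C. \<forall>\<omega>\<in>space M. \<bar>\<xi> i \<omega>\<bar> \<le> C))"

definition simple_process ::
    "nat \<Rightarrow> (nat \<Rightarrow> real) \<Rightarrow> (nat \<Rightarrow> 'a \<Rightarrow> real) \<Rightarrow> real \<Rightarrow> 'a \<Rightarrow> real" where
  "simple_process n p \<xi> s \<omega> = (\<Sum>i<n. \<xi> i \<omega> * indicator {p i<..p (Suc i)} s)"

definition simple_integral ::
    "(real \<Rightarrow> 'a \<Rightarrow> real) \<Rightarrow> nat \<Rightarrow> (nat \<Rightarrow> real) \<Rightarrow> (nat \<Rightarrow> 'a \<Rightarrow> real) \<Rightarrow> real \<Rightarrow> 'a \<Rightarrow> real" where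
  "simple_integral B n p \<xi> t \<omega> =
     (\<Sum>i<n. \<xi> i \<omega> * (B (min (p (Suc i)) t) \<omega> - B (min (p i) t) \<omega>))"

definition tendsto_zero_in_prob :: "'a measure \<Rightarrow> (nat \<Rightarrow> 'a \<Rightarrow> ennreal) \<Rightarrow> bool" where
  "tendsto_zero_in_prob M Y \<longleftrightarrow>
     (\<forall>\<epsilon>>0. (\<lambda>k. measure M {\<omega> \<in> space M. ennreal \<epsilon> < Y k \<omega>}) \<longlonglongrightarrow> 0)"

text \<open>\<open>ito_integral M F B H I\<close> states that \<open>I\<close> is a continuous version of \<open>\<integral> H dB\<close>, where
  the progressively measurable \<open>H\<close> is almost surely locally square integrable in time. The integral is
  the limit, locally uniformly in time in probability, of the integrals of simple
  integrands approximating \<open>H\<close>; this determines \<open>I\<close> up to indistinguishability.\<close>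

definition ito_integral ::
    "'a measure \<Rightarrow> (ennreal \<Rightarrow> 'a measure) \<Rightarrow> (real \<Rightarrow> 'a \<Rightarrow> real) \<Rightarrow>
     (real \<Rightarrow> 'a \<Rightarrow> real) \<Rightarrow> (real \<Rightarrow> 'a \<Rightarrow> real) \<Rightarrow> bool" where
  "ito_integral M F B H I \<longleftrightarrow>
     progressive_process F H \<and>
     (AE \<omega> in M. \<forall>t\<ge>0. (\<integral>\<^sup>+s\<in>{0..t}. ennreal ((H s \<omega>)\<^sup>2) \<partial>lborel) < \<infinity>) \<and>
     adapted_process F I \<and> continuous_paths M I \<and>
     (\<exists>n p \<xi>.
        (\<forall>k. simple_integrand M F (n k) (p k) (\<xi> k)) \<and>
        (\<forall>t\<ge>0.
           tendsto_zero_in_prob M (\<lambda>k \<omega>.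
             \<integral>\<^sup>+s\<in>{0..t}. ennreal ((simple_process (n k) (p k) (\<xi> k) s \<omega> - H s \<omega>)\<^sup>2) \<partial>lborel) \<and>
           tendsto_zero_in_prob M (\<lambda>k \<omega>.
             SUP s\<in>{0..t}. ennreal \<bar>simple_integral B (n k) (p k) (\<xi> k) s \<omega> - I s \<omega>\<bar>)))"

section \<open>Diffusions\<close>

text \<open>\<open>X\<close> solves \<open>dX = b(X) dt + \<sigma>(X) dB\<close> with \<open>X 0 = x\<close>, on the given filtered space.\<close>

definition sde_solution ::
    "'a measure \<Rightarrow> (ennreal \<Rightarrow> 'a measure) \<Rightarrow> (real \<Rightarrow> 'a \<Rightarrow> real) \<Rightarrow>
     (real \<Rightarrow> real) \<Rightarrow> (real \<Rightarrow> real) \<Rightarrow> real \<Rightarrow> (real \<Rightarrow> 'a \<Rightarrow> real) \<Rightarrow> bool" where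
  "sde_solution M F B b \<sigma> x X \<longleftrightarrow>
     adapted_process F X \<and> continuous_paths M X \<and>
     (AE \<omega> in M. X 0 \<omega> = x) \<and>
     (AE \<omega> in M. \<forall>t\<ge>0. set_integrable lborel {0..t} (\<lambda>s. b (X s \<omega>))) \<and>
     (\<exists>I. ito_integral M F B (\<lambda>s \<omega>. \<sigma> (X s \<omega>)) I \<and>
        (AE \<omega> in M. \<forall>t\<ge>0. X t \<omega> = x + (LINT s:{0..t}|lborel. b (X s \<omega>)) + I t \<omega>))"

definition transition_semigroup :: "(real \<Rightarrow> real \<Rightarrow> real measure) \<Rightarrow> bool" where
  "transition_semigroup P \<longleftrightarrow>
     (\<forall>t\<ge>0. P t \<in> borel \<rightarrow>\<^sub>M prob_algebra borel) \<and>
     (\<forall>x. P 0 x = return borel x) \<and>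
     (\<forall>s\<ge>0. \<forall>t\<ge>0. \<forall>x. P (s + t) x = bind (P s x) (P t))"

definition markov_process ::
    "'a measure \<Rightarrow> (ennreal \<Rightarrow> 'a measure) \<Rightarrow> (real \<Rightarrow> real \<Rightarrow> real measure) \<Rightarrow>
     (real \<Rightarrow> 'a \<Rightarrow> real) \<Rightarrow> bool" where
  "markov_process M F P X \<longleftrightarrow>
     adapted_process F X \<and>
     (\<forall>s\<ge>0. \<forall>t\<ge>0. \<forall>A\<in>sets borel. AE \<omega> in M.
        real_cond_exp M (F (ennreal s)) (\<lambda>\<omega>. indicator A (X (s + t) \<omega>)) \<omega> =
        measure (P t (X s \<omega>)) A)"

definition diffusion ::
    "'a measure \<Rightarrow> (ennreal \<Rightarrow> 'a measure) \<Rightarrow> (real \<Rightarrow> 'a \<Rightarrow> real) \<Rightarrow>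
     (real \<Rightarrow> real) \<Rightarrow> (real \<Rightarrow> real) \<Rightarrow> (real \<Rightarrow> real \<Rightarrow> real measure) \<Rightarrow>
     real \<Rightarrow> (real \<Rightarrow> 'a \<Rightarrow> real) \<Rightarrow> bool" where
  "diffusion M F B b \<sigma> P x X \<longleftrightarrow>
     usual_filtered_space M F \<and> brownian_motion M F B \<and>
     sde_solution M F B b \<sigma> x X \<and> markov_process M F P X"

definition generator :: "(real \<Rightarrow> real) \<Rightarrow> (real \<Rightarrow> real) \<Rightarrow> (real \<Rightarrow> real) \<Rightarrow> real \<Rightarrow> real" where
  "generator b \<sigma> f x = b x * deriv f x + 1 / 2 * (\<sigma> x)\<^sup>2 * deriv (deriv f) x"

definition C2 :: "(real \<Rightarrow> real) \<Rightarrow> bool" where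
  "C2 f \<longleftrightarrow> (\<forall>x. f differentiable at x) \<and> (\<forall>x. deriv f differentiable at x) \<and>
     continuous_on UNIV (deriv (deriv f))"

end

theory Submission
  imports Defs
begin

text \<open>Since \<open>\<L> f = 1\<close>, the process \<open>f (X t) - t\<close> is a local martingale: as long as \<open>X\<close> stays in
  \<open>[-K, K]\<close>, the function \<open>f\<close> grows along the path at average speed one. If \<open>f\<close> varies by at most \<open>S\<close>
  on \<open>[-2K, 2K]\<close>, then \<open>X\<close> can hardly stay for a time much longer than \<open>S\<close>. More precisely, for \<open>0 \<le> a < c\<close>,
  \<open>(c - a) P(\<tau> \<ge> c and |X| \<le> K on [0, c]) \<le> S P(\<tau> > a)\<close>,
  because \<open>{\<tau> > a}\<close> is known at time \<open>a\<close> (lemma \<open>exit_inequality\<close>). Take \<open>a = g\<^sup>-\<^sup>1(\<lambda>)\<close>,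
  \<open>c = g\<^sup>-\<^sup>1(\<beta>\<lambda>)\<close> and \<open>K\<close> a small multiple of \<open>\<lambda>\<close>. The limit hypothesis says that
  \<open>S \<le> \<eta> (c - a)\<close> with \<open>\<eta>\<close> as small as desired, and this is a good-lambda inequality
  \<open>P(g(\<tau>) \<ge> \<beta>\<lambda> and X* < \<delta>\<lambda>) \<le> \<eta> P(g(\<tau>) \<ge> \<lambda>)\<close>, where \<open>X*\<close> is the running maximum up to \<open>\<tau>\<close>.
  Integrating it against \<open>dF(\<lambda>)\<close> bounds \<open>E F(g(\<tau>)/\<beta>)\<close> by \<open>\<eta> E F(g(\<tau>)) + E F(X*/\<delta>)\<close>. As \<open>F\<close> is
  moderate, dilations change \<open>F\<close> by bounded factors only, so the first term is absorbed on the left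
  when \<open>\<eta>\<close> is small (lemma \<open>good_lambda_moderate\<close>). The absorption needs a finite left side, hence
  \<open>\<tau>\<close> is first replaced by \<open>min \<tau> n\<close>.

  The work is in the first step. The integral \<open>\<integral> \<sigma>(X) dB\<close> is given as a limit in probability of
  integrals of simple integrands \<open>\<xi>\<close>, and of Ito's formula only an inequality between expectations
  is used. For a fixed simple integrand it follows from Taylor's formula along a fine partition, as the
  increments are then \<open>\<xi> (B v - B u)\<close> with \<open>B v - B u\<close> Gaussian and independent of the past
  (lemma \<open>ito_inequality_simple\<close>). Two devices avoid stopped stochastic integrals:

  \<^item> The function \<open>f\<close> is replaced by \<open>\<phi> = f \<circ> \<psi>\<close>, where \<open>\<psi>\<close> is the identity on \<open>[-K, K]\<close> and maps the
    line into \<open>[-2K, 2K]\<close>. Then \<open>\<phi>(y) - \<phi>(x) \<le> S\<close> for all \<open>x\<close>, \<open>y\<close>, and it does no harm that a discretely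
    observed process overshoots the interval before it is stopped.

  \<^item> Stopping is expressed by a decreasing family of events \<open>G s\<close>, known at time \<open>s\<close>, of the form
    \<open>\<integral> w \<le> n\<close> with the integral over \<open>[0, s]\<close>. The nonnegative weight \<open>w\<close> charges \<open>|b(X)|\<close>, any time
    that \<open>X\<close> spends outside \<open>[-K, K]\<close>, and \<open>(\<xi> - \<sigma>(X))\<^sup>2\<close>. On \<open>G s\<close> everything is bounded up to time \<open>s\<close>,
    so that dominated convergence applies when \<open>\<xi>\<close> tends to \<open>\<sigma>(X)\<close>.\<close>

section \<open>Bounded extension of a twice differentiable function\<close>

text \<open>Derivatives of functions that are defined by cases: near the point, the function may switch
  between two candidates, as long as these agree there to first order.\<close>

lemma DERIV_glue:
  fixes u v w :: "real \<Rightarrow> real"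
  assumes u: "(u has_real_derivative d) (at x)" and v: "(v has_real_derivative d) (at x)"
    and eq: "w x = u x" "w x = v x"
    and ev: "\<forall>\<^sub>F y in nhds x. w y = u y \<or> w y = v y"
  shows "(w has_real_derivative d) (at x)"
  unfolding has_field_derivative_iff
proof (rule tendstoI)
  fix e :: real assume "0 < e"
  have "\<forall>\<^sub>F y in at x. dist ((u y - u x) / (y - x)) d < e"
    using u \<open>0 < e\<close> unfolding has_field_derivative_iff by (rule tendstoD)
  moreover have "\<forall>\<^sub>F y in at x. dist ((v y - v x) / (y - x)) d < e"
    using v \<open>0 < e\<close> unfolding has_field_derivative_iff by (rule tendstoD)
  moreover have "\<forall>\<^sub>F y in at x. w y = u y \<or> w y = v y"
    using ev by (simp add: eventually_at_filter eventually_mono)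
  ultimately show "\<forall>\<^sub>F y in at x. dist ((w y - w x) / (y - x)) d < e"
    by eventually_elim (metis eq)
qed

definition clamp_to :: "real \<Rightarrow> real \<Rightarrow> real" where
  "clamp_to K x = max (- K) (min K x)"

text \<open>The identity on \<open>[-K, K]\<close>, continued on both sides by a scaled sine. The sine has value \<open>0\<close>,
  slope \<open>1\<close> and second derivative \<open>0\<close> at the origin, so the continuation is twice continuously
  differentiable, and it stays within distance \<open>K\<close> of the interval.\<close>

definition fold_in :: "real \<Rightarrow> real \<Rightarrow> real" where
  "fold_in K x = clamp_to K x + K * sin ((x - clamp_to K x) / K)"

lemma clamp_to_cases:
  assumes "0 < K"
  shows "\<forall>\<^sub>F y in nhds x. (clamp_to K y = (if x < - K then - K else if x \<le> K then y else K)) \<or>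
      (clamp_to K y = (if x \<le> - K then - K else if x < K then y else K))"
proof -
  consider "x < - K" | "x = - K" | "- K < x" "x < K" | "x = K" | "K < x" by linarith
  then show ?thesis
  proof cases
    case 1
    have "\<forall>\<^sub>F y in nhds x. y < - K" using 1 by (rule order_tendstoD[OF filterlim_ident])
    then show ?thesis by eventually_elim (use 1 assms in \<open>auto simp: clamp_to_def\<close>)
  next
    case 2
    have "\<forall>\<^sub>F y in nhds x. y < K" by (rule order_tendstoD[OF filterlim_ident]) (use 2 assms in auto)
    then show ?thesis by eventually_elim (use 2 assms in \<open>auto simp: clamp_to_def\<close>)
  next
    case 3
    have "\<forall>\<^sub>F y in nhds x. y < K" using 3(2) by (rule order_tendstoD[OF filterlim_ident])
    moreover have "\<forall>\<^sub>F y in nhds x. - K < y" using 3(1) by (rule order_tendstoD[OF filterlim_ident])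
    ultimately show ?thesis by eventually_elim (use 3 assms in \<open>auto simp: clamp_to_def\<close>)
  next
    case 4
    have "\<forall>\<^sub>F y in nhds x. - K < y" by (rule order_tendstoD[OF filterlim_ident]) (use 4 assms in auto)
    then show ?thesis by eventually_elim (use 4 assms in \<open>auto simp: clamp_to_def\<close>)
  next
    case 5
    have "\<forall>\<^sub>F y in nhds x. K < y" using 5 by (rule order_tendstoD[OF filterlim_ident])
    then show ?thesis by eventually_elim (use 5 assms in \<open>auto simp: clamp_to_def\<close>)
  qed
qed

lemma DERIV_clamp_compose:
  fixes h :: "real \<Rightarrow> real \<Rightarrow> real"
  assumes K: "0 < K"
    and lo: "\<And>x. ((\<lambda>y. h (- K) y) has_real_derivative d (- K) x) (at x)"
    and mid: "\<And>x. ((\<lambda>y. h y y) has_real_derivative d x x) (at x)"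
    and hi: "\<And>x. ((\<lambda>y. h K y) has_real_derivative d K x) (at x)"
  shows "((\<lambda>y. h (clamp_to K y) y) has_real_derivative d (clamp_to K x) x) (at x)"
proof -
  define u where "u = (\<lambda>y. h (if x < - K then - K else if x \<le> K then y else K) y)"
  define v where "v = (\<lambda>y. h (if x \<le> - K then - K else if x < K then y else K) y)"
  have c: "clamp_to K x = (if x < - K then - K else if x \<le> K then x else K)"
    "clamp_to K x = (if x \<le> - K then - K else if x < K then x else K)"
    using K by (auto simp: clamp_to_def)
  have u': "(u has_real_derivative d (clamp_to K x) x) (at x)"
    unfolding u_def c(1) using lo[of x] mid[of x] hi[of x] by auto
  have v': "(v has_real_derivative d (clamp_to K x) x) (at x)"
    unfolding v_def c(2) using lo[of x] mid[of x] hi[of x] by auto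
  show ?thesis
  proof (rule DERIV_glue[OF u' v'])
    show "h (clamp_to K x) x = u x" unfolding u_def c(1) by simp
    show "h (clamp_to K x) x = v x" unfolding v_def c(2) by simp
    show "\<forall>\<^sub>F y in nhds x. h (clamp_to K y) y = u y \<or> h (clamp_to K y) y = v y"
      using clamp_to_cases[OF K, of x] by eventually_elim (auto simp: u_def v_def)
  qed
qed

lemma fold_in_derivs:
  assumes "0 < K"
  shows "(fold_in K has_real_derivative cos ((x - clamp_to K x) / K)) (at x)"
    and "((\<lambda>y. cos ((y - clamp_to K y) / K)) has_real_derivative
           - sin ((x - clamp_to K x) / K) / K) (at x)"
proof -
  have "((\<lambda>y. clamp_to K y + K * sin ((y - clamp_to K y) / K)) has_real_derivative
          (\<lambda>r x. cos ((x - r) / K)) (clamp_to K x) x) (at x)"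
    by (rule DERIV_clamp_compose[OF assms, where h = "\<lambda>r y. r + K * sin ((y - r) / K)"])
       (use assms in \<open>auto intro!: derivative_eq_intros\<close>)
  then show "(fold_in K has_real_derivative cos ((x - clamp_to K x) / K)) (at x)"
    unfolding fold_in_def[abs_def] by simp
  show "((\<lambda>y. cos ((y - clamp_to K y) / K)) has_real_derivative
           - sin ((x - clamp_to K x) / K) / K) (at x)"
    by (rule DERIV_clamp_compose[OF assms, where h = "\<lambda>r y. cos ((y - r) / K)"
          and d = "\<lambda>r x. - sin ((x - r) / K) / K"])
       (use assms in \<open>auto intro!: derivative_eq_intros\<close>)
qed

lemma abs_fold_in_le: "0 < K \<Longrightarrow> \<bar>fold_in K x\<bar> \<le> 2 * K"
proof -
  assume K: "0 < K"
  have "\<bar>fold_in K x\<bar> \<le> \<bar>clamp_to K x\<bar> + K * \<bar>sin ((x - clamp_to K x) / K)\<bar>"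
    unfolding fold_in_def using K by (metis abs_mult abs_of_pos abs_triangle_ineq)
  also have "\<dots> \<le> K + K * 1"
    by (intro add_mono mult_left_mono) (use K in \<open>auto simp: clamp_to_def\<close>)
  finally show ?thesis by simp
qed

lemma uniformly_continuous_on_mult_bounded:
  fixes u v :: "real \<Rightarrow> real"
  assumes u: "uniformly_continuous_on UNIV u" and v: "uniformly_continuous_on UNIV v"
    and ub: "\<And>x. \<bar>u x\<bar> \<le> Cu" and vb: "\<And>x. \<bar>v x\<bar> \<le> Cv"
  shows "uniformly_continuous_on UNIV (\<lambda>x. u x * v x)"
unfolding uniformly_continuous_on_def
proof (intro allI impI)
  fix e :: real assume e: "0 < e"
  have C: "0 \<le> Cu" "0 \<le> Cv" using ub[of 0] vb[of 0] by linarith+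
  obtain d1 where d1: "0 < d1" "\<And>x y. dist x y < d1 \<Longrightarrow> dist (u x) (u y) < e / (2 * (Cv + 1))"
    using u e C unfolding uniformly_continuous_on_def
    by (metis UNIV_I add_nonneg_pos divide_pos_pos mult_pos_pos zero_less_numeral zero_less_one dist_commute)
  obtain d2 where d2: "0 < d2" "\<And>x y. dist x y < d2 \<Longrightarrow> dist (v x) (v y) < e / (2 * (Cu + 1))"
    using v e C unfolding uniformly_continuous_on_def
    by (metis UNIV_I add_nonneg_pos divide_pos_pos mult_pos_pos zero_less_numeral zero_less_one dist_commute)
  show "\<exists>d>0. \<forall>x\<in>UNIV. \<forall>x'\<in>UNIV. dist x' x < d \<longrightarrow> dist (u x' * v x') (u x * v x) < e"
  proof (intro exI[of _ "min d1 d2"] conjI ballI impI)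
    show "0 < min d1 d2" using d1 d2 by simp
    fix x x' :: real assume d: "dist x' x < min d1 d2"
    have 1: "\<bar>u x' - u x\<bar> < e / (2 * (Cv + 1))" and 2: "\<bar>v x' - v x\<bar> < e / (2 * (Cu + 1))"
      using d1(2)[of x' x] d2(2)[of x' x] d by (auto simp: dist_real_def)
    have "\<bar>u x' * v x' - u x * v x\<bar> = \<bar>(u x' - u x) * v x' + u x * (v x' - v x)\<bar>"
      by (simp add: algebra_simps)
    also have "\<dots> \<le> \<bar>u x' - u x\<bar> * \<bar>v x'\<bar> + \<bar>u x\<bar> * \<bar>v x' - v x\<bar>"
      by (metis abs_mult abs_triangle_ineq)
    also have "\<dots> \<le> \<bar>u x' - u x\<bar> * (Cv + 1) + (Cu + 1) * \<bar>v x' - v x\<bar>"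
      by (intro add_mono mult_left_mono mult_right_mono) (use ub[of x] vb[of x'] in auto)
    also have "\<dots> < e / (2 * (Cv + 1)) * (Cv + 1) + (Cu + 1) * (e / (2 * (Cu + 1)))"
      by (intro add_strict_mono mult_strict_right_mono mult_strict_left_mono 1 2) (use C in auto)
    also have "\<dots> = e"
    proof -
      have "Cv + 1 \<noteq> 0" "Cu + 1 \<noteq> 0" using C by auto
      then have "e / (2 * (Cv + 1)) * (Cv + 1) = e / 2" "(Cu + 1) * (e / (2 * (Cu + 1))) = e / 2"
        by (simp_all add: divide_simps)
      then show ?thesis by (simp only: field_sum_of_halves)
    qed
    finally show "dist (u x' * v x') (u x * v x) < e" by (simp add: dist_real_def)
  qed
qed

lemma uniformly_continuous_on_lipschitz_UNIV:
  fixes u :: "real \<Rightarrow> real"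
  assumes "\<And>x y. \<bar>u x - u y\<bar> \<le> L * \<bar>x - y\<bar>"
  shows "uniformly_continuous_on UNIV u"
proof -
  have "L-lipschitz_on UNIV u"
  proof (rule lipschitz_onI)
    show "dist (u x) (u y) \<le> L * dist x y" for x y using assms by (simp add: dist_real_def)
    show "0 \<le> L" using assms[of 0 1] by simp
  qed
  then show ?thesis by (rule lipschitz_on_uniformly_continuous)
qed

text \<open>Compose \<open>f\<close> with \<^const>\<open>fold_in\<close>. The new function only takes values that \<open>f\<close> takes on \<open>[-2K, 2K]\<close>,
  so the oscillation of \<open>f\<close> on that interval bounds its increments on the whole line; its first
  two derivatives are bounded, and they agree with those of \<open>f\<close> on \<open>[-K, K]\<close>.\<close>

lemma C2_bounded_extension:
  fixes f :: "real \<Rightarrow> real"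
  assumes f: "C2 f" and K: "0 < K"
  obtains \<phi> \<phi>1 \<phi>2 C where
    "\<And>x. (\<phi> has_real_derivative \<phi>1 x) (at x)" "\<And>x. (\<phi>1 has_real_derivative \<phi>2 x) (at x)"
    "uniformly_continuous_on UNIV \<phi>2" "\<And>x. \<bar>\<phi>1 x\<bar> \<le> C" "\<And>x. \<bar>\<phi>2 x\<bar> \<le> C"
    "\<And>x. \<exists>u. \<bar>u\<bar> \<le> 2 * K \<and> \<phi> x = f u"
    "\<And>x. \<bar>x\<bar> \<le> K \<Longrightarrow> \<phi>1 x = deriv f x \<and> \<phi>2 x = deriv (deriv f) x"
proof -
  let ?f1 = "deriv f" and ?f2 = "deriv (deriv f)"
  define s where "s x = fold_in K x" for x
  define s1 where "s1 x = cos ((x - clamp_to K x) / K)" for x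
  define s2 where "s2 x = - sin ((x - clamp_to K x) / K) / K" for x
  have f1: "(f has_real_derivative ?f1 x) (at x)" for x
    using f by (simp add: C2_def DERIV_deriv_iff_real_differentiable)
  have f2: "(?f1 has_real_derivative ?f2 x) (at x)" for x
    using f by (simp add: C2_def DERIV_deriv_iff_real_differentiable)
  have s: "(s has_real_derivative s1 x) (at x)" for x
    using fold_in_derivs(1)[OF K] unfolding s_def[abs_def] s1_def by simp
  have s1: "(s1 has_real_derivative s2 x) (at x)" for x
    using fold_in_derivs(2)[OF K] unfolding s1_def[abs_def] s2_def by simp
  have sb: "s x \<in> cball 0 (2 * K)" for x using abs_fold_in_le[OF K] by (simp add: s_def)
  have s1b: "\<bar>s1 x\<bar> \<le> 1" for x by (simp add: s1_def)
  have s2b: "\<bar>s2 x\<bar> \<le> 1 / K" for x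
    using K by (simp add: s2_def divide_right_mono)
  have c1: "continuous_on UNIV ?f1" using f2 by (meson DERIV_continuous_on has_field_derivative_at_within)
  have c2: "continuous_on UNIV ?f2" using f by (simp add: C2_def)
  have uc: "uniformly_continuous_on (cball 0 (2 * K)) ?f1" "uniformly_continuous_on (cball 0 (2 * K)) ?f2"
    by (auto intro!: compact_uniformly_continuous continuous_on_subset[OF c1] continuous_on_subset[OF c2])
  have "bounded (?f1 ` cball 0 (2 * K))" "bounded (?f2 ` cball 0 (2 * K))"
    by (auto intro!: compact_imp_bounded compact_continuous_image continuous_on_subset[OF c1] continuous_on_subset[OF c2])
  then obtain C1 C2 where C: "\<And>x. x \<in> cball 0 (2 * K) \<Longrightarrow> \<bar>?f1 x\<bar> \<le> C1"
    "\<And>x. x \<in> cball 0 (2 * K) \<Longrightarrow> \<bar>?f2 x\<bar> \<le> C2"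
    unfolding bounded_iff by (metis imageI real_norm_def)
  have lip: "\<bar>s x - s y\<bar> \<le> 1 * \<bar>x - y\<bar>" for x y
    using field_differentiable_bound[of UNIV s s1 1 x y] s s1b by (auto simp: has_field_derivative_at_within)
  have us: "uniformly_continuous_on UNIV s"
    by (rule uniformly_continuous_on_lipschitz_UNIV[OF lip])
  have lip1: "\<bar>s1 x - s1 y\<bar> \<le> (1 / K) * \<bar>x - y\<bar>" for x y
    using field_differentiable_bound[of UNIV s1 s2 "1 / K" x y] s1 s2b by (auto simp: has_field_derivative_at_within)
  have us1: "uniformly_continuous_on UNIV s1"
    by (rule uniformly_continuous_on_lipschitz_UNIV[OF lip1])
  have lip2: "\<bar>s2 x - s2 y\<bar> \<le> (2 / K\<^sup>2) * \<bar>x - y\<bar>" for x y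
  proof -
    define p q where "p = (x - clamp_to K x) / K" and "q = (y - clamp_to K y) / K"
    have "\<bar>sin p - sin q\<bar> \<le> 1 * \<bar>p - q\<bar>"
      using field_differentiable_bound[of UNIV sin cos 1 p q] by (auto intro!: derivative_eq_intros)
    moreover have "\<bar>p - q\<bar> \<le> 2 * \<bar>x - y\<bar> / K"
    proof -
      have "\<bar>(x - clamp_to K x) - (y - clamp_to K y)\<bar> \<le> 2 * \<bar>x - y\<bar>"
        unfolding clamp_to_def using K by (simp add: max_def min_def)
      then show ?thesis using K unfolding p_def q_def
        by (simp add: diff_divide_distrib[symmetric] abs_divide divide_right_mono)
    qed
    ultimately have "\<bar>sin q - sin p\<bar> \<le> 2 * \<bar>x - y\<bar> / K"
      by (metis abs_minus_commute mult_1 order_trans)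
    then have "\<bar>sin q - sin p\<bar> / K \<le> 2 * \<bar>x - y\<bar> / K / K" using K by (intro divide_right_mono) auto
    moreover have "s2 x - s2 y = (sin q - sin p) / K"
      by (simp add: s2_def p_def q_def diff_divide_distrib)
    ultimately show ?thesis using K by (simp add: power2_eq_square abs_divide)
  qed
  have us2: "uniformly_continuous_on UNIV s2"
    by (rule uniformly_continuous_on_lipschitz_UNIV[OF lip2])
  have uf: "uniformly_continuous_on UNIV (\<lambda>x. ?f1 (s x))" "uniformly_continuous_on UNIV (\<lambda>x. ?f2 (s x))"
  proof -
    have "range s \<subseteq> cball 0 (2 * K)" using sb by auto
    then have "uniformly_continuous_on (range s) ?f1" "uniformly_continuous_on (range s) ?f2"
      using uc unfolding uniformly_continuous_on_def by (meson subsetD)+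
    then show "uniformly_continuous_on UNIV (\<lambda>x. ?f1 (s x))" "uniformly_continuous_on UNIV (\<lambda>x. ?f2 (s x))"
      using uniformly_continuous_on_compose[OF us, of ?f1] uniformly_continuous_on_compose[OF us, of ?f2] by auto
  qed
  have us11: "uniformly_continuous_on UNIV (\<lambda>x. s1 x * s1 x)"
    by (rule uniformly_continuous_on_mult_bounded[OF us1 us1 s1b s1b])
  have s11b: "\<bar>s1 x * s1 x\<bar> \<le> 1" for x
    unfolding abs_mult using s1b[of x] by (intro mult_le_one) auto
  show thesis
  proof (rule that[of "\<lambda>x. f (s x)" "\<lambda>x. ?f1 (s x) * s1 x"
        "\<lambda>x. ?f2 (s x) * (s1 x * s1 x) + ?f1 (s x) * s2 x" "max C1 (C2 + C1 / K)"])
    show "((\<lambda>x. f (s x)) has_real_derivative ?f1 (s x) * s1 x) (at x)" for x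
      by (rule DERIV_chain2[OF f1 s])
    show "((\<lambda>x. ?f1 (s x) * s1 x) has_real_derivative
        ?f2 (s x) * (s1 x * s1 x) + ?f1 (s x) * s2 x) (at x)" for x
      using DERIV_mult[OF DERIV_chain2[OF f2 s] s1, of x] by (simp add: algebra_simps)
    show "uniformly_continuous_on UNIV (\<lambda>x. ?f2 (s x) * (s1 x * s1 x) + ?f1 (s x) * s2 x)"
      by (intro uniformly_continuous_on_add
          uniformly_continuous_on_mult_bounded[OF uf(2) us11 C(2)[OF sb] s11b]
          uniformly_continuous_on_mult_bounded[OF uf(1) us2 C(1)[OF sb] s2b])
    show "\<bar>?f1 (s x) * s1 x\<bar> \<le> max C1 (C2 + C1 / K)" for x
    proof -
      have "\<bar>?f1 (s x)\<bar> * \<bar>s1 x\<bar> \<le> C1 * 1"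
        using C(1)[OF sb, of x] by (intro mult_mono s1b) auto
      then show ?thesis by (simp add: abs_mult)
    qed
    show "\<bar>?f2 (s x) * (s1 x * s1 x) + ?f1 (s x) * s2 x\<bar> \<le> max C1 (C2 + C1 / K)" for x
    proof -
      have "\<bar>?f2 (s x)\<bar> * \<bar>s1 x * s1 x\<bar> \<le> C2 * 1"
        using C(2)[OF sb, of x] by (intro mult_mono s11b) auto
      moreover have "\<bar>?f1 (s x)\<bar> * \<bar>s2 x\<bar> \<le> C1 * (1 / K)"
        using C(1)[OF sb, of x] by (intro mult_mono s2b) auto
      ultimately show ?thesis
        using abs_triangle_ineq[of "?f2 (s x) * (s1 x * s1 x)" "?f1 (s x) * s2 x"]
        by (simp add: abs_mult)
    qed
    show "\<exists>u. \<bar>u\<bar> \<le> 2 * K \<and> f (s x) = f u" for x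
      using sb[of x] by (intro exI[of _ "s x"]) auto
    show "?f1 (s x) * s1 x = ?f1 x \<and> ?f2 (s x) * (s1 x * s1 x) + ?f1 (s x) * s2 x = ?f2 x"
      if "\<bar>x\<bar> \<le> K" for x
    proof -
      have "clamp_to K x = x" using that by (auto simp: clamp_to_def)
      then show ?thesis by (simp add: s_def s1_def s2_def fold_in_def)
    qed
  qed
qed

section \<open>Taylor bounds and partitions\<close>

text \<open>The increment is split into a drift part \<open>D\<close> and a noise part \<open>y\<close>. Over a short time step the
  noise is of the order of the square root of its length, so its square must be kept with a
  coefficient \<open>e\<close> that can be made small, while \<open>y ^ 4\<close> and \<open>D\<^sup>2\<close> are of smaller order and may
  have a large coefficient. A remainder \<open>y ^ 4\<close> instead of \<open>|y| ^ 3\<close> is possible because a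
  displacement \<open>h\<close> with \<open>|h| \<ge> d\<close> satisfies \<open>h\<^sup>2 \<le> h ^ 4 / d\<^sup>2\<close>; for smaller ones the modulus of
  continuity of \<open>\<phi>2\<close> is used.\<close>

lemma Taylor_second_order_lower_bound:
  fixes \<phi> \<phi>1 \<phi>2 :: "real \<Rightarrow> real"
  assumes d1: "\<And>x. (\<phi> has_real_derivative \<phi>1 x) (at x)"
    and d2: "\<And>x. (\<phi>1 has_real_derivative \<phi>2 x) (at x)"
    and uc: "uniformly_continuous_on UNIV \<phi>2" and bd: "\<And>x. \<bar>\<phi>2 x\<bar> \<le> C"
    and e: "0 < e" and n: "0 \<le> n"
  shows "\<exists>K\<ge>0. \<forall>z D y. \<bar>D\<bar> \<le> n \<longrightarrow>
    \<phi> z + \<phi>1 z * (D + y) + \<phi>2 z * y\<^sup>2 / 2 - e * y\<^sup>2 - K * y ^ 4 - K * D\<^sup>2 \<le> \<phi> (z + (D + y))"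
proof -
  have C: "0 \<le> C" using bd[of 0] by linarith
  have Tay: "\<exists>t. \<bar>t - z\<bar> \<le> \<bar>h\<bar> \<and> \<phi> (z + h) = \<phi> z + \<phi>1 z * h + \<phi>2 t * h\<^sup>2 / 2" for z h
  proof (cases "h = 0")
    case False
    define df where "df m = (if m = 0 then \<phi> else if m = Suc 0 then \<phi>1 else \<phi>2)" for m :: nat
    have "\<exists>t. (if z + h < z then z + h < t \<and> t < z else z < t \<and> t < z + h) \<and>
        \<phi> (z + h) = (\<Sum>m<2. (df m z / fact m) * (z + h - z)^m) + (df 2 t / fact 2) * (z + h - z)^2"
      by (rule Taylor[where a = "min z (z + h)" and b = "max z (z + h)"])
         (use False in \<open>auto simp: df_def d1 d2 less_Suc_eq numeral_2_eq_2\<close>)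
    then obtain t where t: "(if z + h < z then z + h < t \<and> t < z else z < t \<and> t < z + h)"
      "\<phi> (z + h) = (\<Sum>m<2. (df m z / fact m) * h^m) + (df 2 t / fact 2) * h^2"
      by auto
    show ?thesis
      by (rule exI[of _ t]) (use t in \<open>auto simp: df_def numeral_2_eq_2 split: if_splits\<close>)
  qed auto
  obtain d where d: "0 < d" "\<And>x y. \<bar>x - y\<bar> < d \<Longrightarrow> \<bar>\<phi>2 x - \<phi>2 y\<bar> < e / 2"
    using uc e unfolding uniformly_continuous_on_def dist_real_def
    by (metis UNIV_I half_gt_zero)
  define R where "R = C / d\<^sup>2"
  have R: "0 \<le> R" using C by (simp add: R_def)
  have rem: "\<phi> z + \<phi>1 z * h + \<phi>2 z * h\<^sup>2 / 2 - e / 4 * h\<^sup>2 - R * h ^ 4 \<le> \<phi> (z + h)" for z h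
  proof -
    obtain t where t: "\<bar>t - z\<bar> \<le> \<bar>h\<bar>" "\<phi> (z + h) = \<phi> z + \<phi>1 z * h + \<phi>2 t * h\<^sup>2 / 2"
      using Tay by blast
    have "(\<phi>2 z - \<phi>2 t) * h\<^sup>2 / 2 \<le> e / 4 * h\<^sup>2 + R * h ^ 4"
    proof (cases "\<bar>h\<bar> < d")
      case True
      then have "\<phi>2 z - \<phi>2 t \<le> e / 2" using d(2)[of z t] t(1) by linarith
      then have "(\<phi>2 z - \<phi>2 t) * h\<^sup>2 \<le> e / 2 * h\<^sup>2" by (rule mult_right_mono) simp
      moreover have "0 \<le> R * h ^ 4" using R by simp
      ultimately show ?thesis by linarith
    next
      case False
      then have "d\<^sup>2 \<le> h\<^sup>2" using d(1) by (simp add: abs_le_square_iff[symmetric])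
      then have "C * (d\<^sup>2 * h\<^sup>2) \<le> C * (h\<^sup>2 * h\<^sup>2)" using C by (intro mult_left_mono mult_right_mono) auto
      then have "C * h\<^sup>2 \<le> R * h ^ 4" unfolding R_def using d(1)
        by (simp add: field_simps power2_eq_square power4_eq_xxxx)
      moreover have "(\<phi>2 z - \<phi>2 t) * h\<^sup>2 \<le> (2 * C) * h\<^sup>2"
        using bd[of z] bd[of t] by (intro mult_right_mono) (auto simp: abs_le_iff)
      moreover have "0 \<le> e / 4 * h\<^sup>2" using e by simp
      ultimately show ?thesis by linarith
    qed
    then show ?thesis using t(2) by (simp add: algebra_simps)
  qed
  define K where "K = C / 2 + C\<^sup>2 / e + e / 2 + 8 * R * n\<^sup>2 + 8 * R"
  have K0: "0 \<le> K" using C R e by (simp add: K_def)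
  show ?thesis
  proof (intro exI[of _ K] conjI allI impI K0)
    fix z D y :: real assume D: "\<bar>D\<bar> \<le> n"
    have a: "e / 4 * (D + y)\<^sup>2 \<le> e / 2 * D\<^sup>2 + e / 2 * y\<^sup>2"
    proof -
      have "(D + y)\<^sup>2 \<le> 2 * D\<^sup>2 + 2 * y\<^sup>2" using sum_squares_ge_zero[of "D - y" 0] by (simp add: power2_eq_square algebra_simps)
      then have "e / 4 * (D + y)\<^sup>2 \<le> e / 4 * (2 * D\<^sup>2 + 2 * y\<^sup>2)" using e by (intro mult_left_mono) auto
      then show ?thesis by (simp add: algebra_simps)
    qed
    have b: "R * (D + y) ^ 4 \<le> (8 * R * n\<^sup>2) * D\<^sup>2 + 8 * R * y ^ 4"
    proof -
      have "(D + y)\<^sup>2 \<le> 2 * D\<^sup>2 + 2 * y\<^sup>2" using sum_squares_ge_zero[of "D - y" 0] by (simp add: power2_eq_square algebra_simps)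
      then have "((D + y)\<^sup>2)\<^sup>2 \<le> (2 * D\<^sup>2 + 2 * y\<^sup>2)\<^sup>2" by (rule power_mono) simp
      also have "\<dots> \<le> 8 * (D\<^sup>2)\<^sup>2 + 8 * (y\<^sup>2)\<^sup>2"
        using sum_squares_ge_zero[of "D\<^sup>2 - y\<^sup>2" 0] by (simp add: power2_eq_square algebra_simps)
      also have "(D\<^sup>2)\<^sup>2 \<le> n\<^sup>2 * D\<^sup>2"
        using mult_right_mono[of "D\<^sup>2" "n\<^sup>2" "D\<^sup>2"] D n
        by (simp add: power2_eq_square[of "D\<^sup>2"] abs_le_square_iff[symmetric])
      finally have "(D + y) ^ 4 \<le> 8 * (n\<^sup>2 * D\<^sup>2) + 8 * y ^ 4"
        by (simp add: power_mult[symmetric])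
      then have "R * (D + y) ^ 4 \<le> R * (8 * (n\<^sup>2 * D\<^sup>2) + 8 * y ^ 4)" using R by (rule mult_left_mono)
      then show ?thesis by (simp add: algebra_simps)
    qed
    have c: "- \<phi>2 z * (D + y)\<^sup>2 / 2 + \<phi>2 z * y\<^sup>2 / 2 \<le> C / 2 * D\<^sup>2 + C\<^sup>2 / e * D\<^sup>2 + e / 4 * y\<^sup>2"
    proof -
      have 1: "- \<phi>2 z * (D + y)\<^sup>2 / 2 + \<phi>2 z * y\<^sup>2 / 2 = - \<phi>2 z * D\<^sup>2 / 2 + (- \<phi>2 z * D) * y"
        by (simp add: power2_eq_square field_simps)
      have 2: "- \<phi>2 z * D\<^sup>2 / 2 \<le> C / 2 * D\<^sup>2"
        using mult_right_mono[of "- \<phi>2 z" C "D\<^sup>2"] bd[of z] by (simp add: abs_le_iff)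
      have "0 \<le> (- \<phi>2 z * D / sqrt e - sqrt e / 2 * y)\<^sup>2" by simp
      also have "\<dots> = (\<phi>2 z)\<^sup>2 * D\<^sup>2 / e + e / 4 * y\<^sup>2 - (- \<phi>2 z * D) * y"
        using e by (simp add: power2_diff power_mult_distrib power_divide)
      finally have 3: "(- \<phi>2 z * D) * y \<le> (\<phi>2 z)\<^sup>2 * D\<^sup>2 / e + e / 4 * y\<^sup>2" by simp
      have "(\<phi>2 z)\<^sup>2 \<le> C\<^sup>2" using bd[of z] C by (simp add: abs_le_square_iff[symmetric])
      then have "(\<phi>2 z)\<^sup>2 * D\<^sup>2 / e \<le> C\<^sup>2 * D\<^sup>2 / e" using e by (intro divide_right_mono mult_right_mono) auto
      then show ?thesis using 1 2 3 by simp
    qed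
    have "0 \<le> e / 4 * y\<^sup>2" using e by simp
    have "8 * R * y ^ 4 \<le> K * y ^ 4" unfolding K_def using C R e by (intro mult_right_mono) auto
    have "K * D\<^sup>2 = C / 2 * D\<^sup>2 + C\<^sup>2 / e * D\<^sup>2 + e / 2 * D\<^sup>2 + 8 * R * n\<^sup>2 * D\<^sup>2 + 8 * R * D\<^sup>2"
      unfolding K_def by (simp add: algebra_simps)
    moreover have "0 \<le> 8 * R * D\<^sup>2" using R by simp
    ultimately show "\<phi> z + \<phi>1 z * (D + y) + \<phi>2 z * y\<^sup>2 / 2 - e * y\<^sup>2 - K * y ^ 4 - K * D\<^sup>2 \<le> \<phi> (z + (D + y))"
      using rem[of z "D + y"] a b c \<open>0 \<le> e / 4 * y\<^sup>2\<close> \<open>8 * R * y ^ 4 \<le> K * y ^ 4\<close>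
      by linarith
  qed
qed

text \<open>The points of \<open>P\<close> are the jump times of a simple integrand; on each interval of the partition
  the integrand is then constant.\<close>

lemma aligned_grid_exists:
  fixes a c h :: real
  assumes P: "finite P" and ac: "a < c" and h: "0 < h"
  obtains N :: nat and t where "t 0 = a" "t N = c"
    "\<And>j. j < N \<Longrightarrow> t j < t (Suc j)" "\<And>j. j < N \<Longrightarrow> t (Suc j) \<le> t j + h"
    "\<And>j. j < N \<Longrightarrow> P \<inter> {t j<..<t (Suc j)} = {}"
proof -
  \<comment> \<open>The partition consists of the points of \<open>P\<close> and of an arithmetic progression of step \<open>h\<close>,
    listed in order.\<close>
  define S where "S = {a, c} \<union> (P \<inter> {a..c}) \<union> ((\<lambda>i::nat. a + real i * h) ` {..nat \<lceil>(c - a) / h\<rceil>} \<inter> {a..c})"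
  have fin: "finite S" using P by (auto simp: S_def)
  have sub: "S \<subseteq> {a..c}" using ac by (auto simp: S_def)
  have mem: "a \<in> S" "c \<in> S" by (auto simp: S_def)
  define xs where "xs = sorted_list_of_set S"
  have xs: "set xs = S" "sorted_wrt (<) xs" using fin by (auto simp: xs_def strict_sorted_iff)
  have mono: "xs ! i < xs ! j" if "i < j" "j < length xs" for i j
    using sorted_wrt_nth_less[OF xs(2)] that by blast
  have ne: "xs \<noteq> []" using xs(1) mem by auto
  define N where "N = length xs - 1"
  have lenN: "length xs = Suc N" using ne by (simp add: N_def)
  have t0: "xs ! 0 = a"
  proof -
    obtain i where "i < length xs" "xs ! i = a" using mem(1) xs(1) by (metis in_set_conv_nth)
    moreover have "xs ! 0 \<in> {a..c}" using ne sub xs(1) by (metis length_greater_0_conv nth_mem subsetD)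
    ultimately show ?thesis using mono[of 0 i] by (cases "i = 0") auto
  qed
  have tN: "xs ! N = c"
  proof -
    obtain i where i: "i < length xs" "xs ! i = c" using mem(2) xs(1) by (metis in_set_conv_nth)
    moreover have "xs ! N \<in> {a..c}" using lenN sub xs(1) by (metis lessI nth_mem subsetD)
    ultimately show ?thesis using mono[of i N] lenN by (cases "i = N") auto
  qed
  have gap: "S \<inter> {xs ! j<..<xs ! Suc j} = {}" if "j < N" for j
  proof -
    { fix p assume "p \<in> S" and p: "xs ! j < p" "p < xs ! Suc j"
      then obtain i where i: "i < length xs" "xs ! i = p" using xs(1) by (metis in_set_conv_nth)
      have "i \<le> j \<or> Suc j \<le> i" by linarith
      then have False
        using mono[of i j] mono[of "Suc j" i] i p that lenN by (cases "i = j"; cases "i = Suc j") auto }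
    then show ?thesis by auto
  qed
  have inS: "xs ! j \<in> {a..c}" if "j \<le> N" for j
    using that lenN sub xs(1) by (metis le_imp_less_Suc nth_mem subsetD)
  show thesis
  proof (rule that[of "(!) xs" N, OF t0 tN])
    show "xs ! j < xs ! Suc j" if "j < N" for j using mono[of j "Suc j"] that lenN by simp
    show "P \<inter> {xs ! j<..<xs ! Suc j} = {}" if "j < N" for j
      using gap[OF that] inS[of j] inS[of "Suc j"] that by (auto simp: S_def)
    show "xs ! Suc j \<le> xs ! j + h" if j: "j < N" for j
    proof (rule ccontr)
      assume "\<not> xs ! Suc j \<le> xs ! j + h"
      then have big: "xs ! j + h < xs ! Suc j" by simp
      define i where "i = nat (\<lfloor>(xs ! j - a) / h\<rfloor> + 1)"
      have nn: "0 \<le> (xs ! j - a) / h" using inS[of j] j h by simp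
      have i: "real i = of_int \<lfloor>(xs ! j - a) / h\<rfloor> + 1"
        using nn by (simp add: i_def)
      have "(xs ! j - a) / h < real i" "real i \<le> (xs ! j - a) / h + 1"
        unfolding i by linarith+
      then have lu: "xs ! j < a + real i * h" "a + real i * h \<le> xs ! j + h"
        using h by (simp_all add: field_simps)
      have "a + real i * h \<le> c" using lu big inS[of "Suc j"] j by auto
      then have "real i \<le> (c - a) / h" using h by (simp add: field_simps)
      then have "i \<le> nat \<lceil>(c - a) / h\<rceil>" by linarith
      then have "a + real i * h \<in> S" using \<open>a + real i * h \<le> c\<close> h by (auto simp: S_def)
      then show False using gap[OF j] lu big by auto
    qed
  qed
qed

text \<open>The weights are \<open>1\<close> up to some index and \<open>0\<close> from there on, so the sum telescopes to a single
  difference \<open>x k - x 0\<close>. This plays the role of stopping.\<close>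

lemma antimono_weighted_telescope_le:
  fixes x :: "nat \<Rightarrow> real"
  assumes S: "\<And>i j. x i - x j \<le> S" and dec: "\<And>j. j < N \<Longrightarrow> G (Suc j) \<Longrightarrow> G j"
  shows "(\<Sum>j<N. of_bool (G j) * (x (Suc j) - x j)) \<le> S"
proof -
  have "\<exists>k. (\<Sum>j<N. of_bool (G j) * (x (Suc j) - x j)) = x k - x 0 \<and> (k = N \<or> (k \<le> N \<and> \<not> G k))"
    using dec
  proof (induction N)
    case (Suc N)
    then obtain k where k: "(\<Sum>j<N. of_bool (G j) * (x (Suc j) - x j)) = x k - x 0"
      "k = N \<or> (k \<le> N \<and> \<not> G k)" by auto
    have no: "\<not> G N" if "k \<le> N" "\<not> G k"
      using that(1)
    proof (induction N rule: dec_induct)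
      case base show ?case by fact
    next
      case (step m) 
      then show ?case using Suc.prems[of m] by auto
    qed
    show ?case
    proof (cases "G N")
      case True
      then have "k = N" using k(2) no by blast
      then show ?thesis using k(1) True by (intro exI[of _ "Suc N"]) simp
    next
      case False
      then show ?thesis using k by (intro exI[of _ k]) auto
    qed
  qed auto
  then show ?thesis using S by metis
qed

section \<open>Progressively measurable processes\<close>

text \<open>Values in an arbitrary topological space, so that it covers extended nonnegative densities.\<close>

definition prog_measurable ::
    "(ennreal \<Rightarrow> 'a measure) \<Rightarrow> (real \<Rightarrow> 'a \<Rightarrow> 'b::topological_space) \<Rightarrow> bool" where
  "prog_measurable F H \<longleftrightarrow>
     (\<forall>t\<ge>0. (\<lambda>(s, \<omega>). H s \<omega>) \<in> borel_measurable (restrict_space borel {0..t} \<Otimes>\<^sub>M F (ennreal t)))"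

lemma progressive_process_iff: "progressive_process F H \<longleftrightarrow> prog_measurable F H"
  by (simp add: progressive_process_def prog_measurable_def)

lemma prog_measurableD:
  "prog_measurable F H \<Longrightarrow> 0 \<le> t \<Longrightarrow>
     (\<lambda>(s, \<omega>). H s \<omega>) \<in> borel_measurable (restrict_space borel {0..t} \<Otimes>\<^sub>M F (ennreal t))"
  by (simp add: prog_measurable_def)

lemma prog_measurable_compose:
  assumes "prog_measurable F H" "g \<in> borel_measurable borel"
  shows "prog_measurable F (\<lambda>s \<omega>. g (H s \<omega>))"
  unfolding prog_measurable_def
proof (intro allI impI)
  fix t :: real assume "0 \<le> t"
  from measurable_compose[OF prog_measurableD[OF assms(1) this] assms(2)]
  show "(\<lambda>(s, \<omega>). g (H s \<omega>)) \<in> borel_measurable (restrict_space borel {0..t} \<Otimes>\<^sub>M F (ennreal t))"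
    by (simp add: case_prod_beta')
qed

lemma prog_measurable_at:
  assumes "prog_measurable F H" "0 \<le> t"
  shows "H t \<in> borel_measurable (F (ennreal t))"
proof -
  have "(\<lambda>\<omega>. (t, \<omega>)) \<in> F (ennreal t) \<rightarrow>\<^sub>M restrict_space borel {0..t} \<Otimes>\<^sub>M F (ennreal t)"
    using assms(2) by (intro measurable_Pair1') (auto simp: space_restrict_space)
  from measurable_compose[OF this prog_measurableD[OF assms]] show ?thesis by simp
qed

lemma prog_measurable_section:
  assumes "prog_measurable F H" "0 \<le> t" "\<omega> \<in> space (F (ennreal t))"
  shows "(\<lambda>s. H s \<omega>) \<in> borel_measurable (restrict_space borel {0..t})"
  using measurable_compose[OF measurable_Pair2'[OF assms(3)] prog_measurableD[OF assms(1,2)]] by simp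

text \<open>Fubini: the running integral of a progressively measurable density is again progressively
  measurable. It is this closure property that makes events such as \<open>\<integral> w \<le> n\<close> observable in
  time.\<close>

lemma prog_measurable_nn_integral:
  fixes h :: "real \<Rightarrow> 'a \<Rightarrow> ennreal"
  assumes h: "prog_measurable F h"
  shows "prog_measurable F (\<lambda>t \<omega>. \<integral>\<^sup>+s\<in>{0..t}. h s \<omega> \<partial>lborel)"
  unfolding prog_measurable_def
proof (intro allI impI)
  fix T :: real assume T: "0 \<le> T"
  let ?R = "restrict_space borel {0..T}" and ?L = "restrict_space lborel {0..T}"
  have sf: "sigma_finite_measure ?L"
    by (intro sigma_finite_measure_restrict_space sigma_finite_lborel) auto
  note h' = prog_measurableD[OF h T]
  have c: "sets ?L = sets ?R" by (rule sets_restrict_space_cong) simp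
  have m1: "(\<lambda>((t, \<omega>), s). (s, \<omega>)) \<in> (?R \<Otimes>\<^sub>M F (ennreal T)) \<Otimes>\<^sub>M ?L \<rightarrow>\<^sub>M ?R \<Otimes>\<^sub>M F (ennreal T)"
    unfolding case_prod_beta'
    by (intro measurable_Pair measurable_compose[OF measurable_fst measurable_snd])
       (use measurable_snd[of "?R \<Otimes>\<^sub>M F (ennreal T)" ?L] in \<open>simp add: measurable_cong_sets[OF refl c]\<close>)
  have hm: "(\<lambda>((t, \<omega>), s). h s \<omega>) \<in> borel_measurable ((?R \<Otimes>\<^sub>M F (ennreal T)) \<Otimes>\<^sub>M ?L)"
    using measurable_compose[OF m1 h'] by (simp add: case_prod_beta')
  have tm: "(\<lambda>x. fst (fst x)) \<in> borel_measurable ((?R \<Otimes>\<^sub>M F (ennreal T)) \<Otimes>\<^sub>M ?L)"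
    by (intro measurable_compose[OF measurable_fst measurable_compose[OF measurable_fst]])
       (simp add: measurable_restrict_space1)
  have sm: "(\<lambda>x. snd x) \<in> borel_measurable ((?R \<Otimes>\<^sub>M F (ennreal T)) \<Otimes>\<^sub>M ?L)"
    by (intro measurable_compose[OF measurable_snd]) (simp add: measurable_restrict_space1)
  have im: "(\<lambda>((t, \<omega>), s). indicator {..t} s :: ennreal) \<in> borel_measurable ((?R \<Otimes>\<^sub>M F (ennreal T)) \<Otimes>\<^sub>M ?L)"
  proof -
    have "{x \<in> space ((?R \<Otimes>\<^sub>M F (ennreal T)) \<Otimes>\<^sub>M ?L). snd x \<le> fst (fst x)} \<in> sets ((?R \<Otimes>\<^sub>M F (ennreal T)) \<Otimes>\<^sub>M ?L)"
      using sm tm by (rule borel_measurable_le)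
    from borel_measurable_indicator[OF this]
    have "indicator {x \<in> space ((?R \<Otimes>\<^sub>M F (ennreal T)) \<Otimes>\<^sub>M ?L). snd x \<le> fst (fst x)}
       \<in> borel_measurable ((?R \<Otimes>\<^sub>M F (ennreal T)) \<Otimes>\<^sub>M ?L)" .
    then show ?thesis
      by (rule measurable_cong[THEN iffD1, rotated]) (auto simp: indicator_def)
  qed
  have "(\<lambda>x. \<integral>\<^sup>+s. h s (snd x) * indicator {..fst x} s \<partial>?L) \<in> borel_measurable (?R \<Otimes>\<^sub>M F (ennreal T))"
    by (rule sigma_finite_measure.borel_measurable_nn_integral[OF sf])
       (use borel_measurable_times_ennreal[OF hm im] in \<open>simp add: case_prod_beta'\<close>)
  then show "(\<lambda>(t, \<omega>). \<integral>\<^sup>+s\<in>{0..t}. h s \<omega> \<partial>lborel) \<in> borel_measurable (?R \<Otimes>\<^sub>M F (ennreal T))"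
  proof (rule measurable_cong[THEN iffD1, rotated])
    fix x assume "x \<in> space (?R \<Otimes>\<^sub>M F (ennreal T))"
    then have "fst x \<in> {0..T}" by (auto simp: space_pair_measure space_restrict_space)
    then show "(\<integral>\<^sup>+s. h s (snd x) * indicator {..fst x} s \<partial>?L) = (case x of (t, \<omega>) \<Rightarrow> \<integral>\<^sup>+s\<in>{0..t}. h s \<omega> \<partial>lborel)"
      by (subst nn_integral_restrict_space)
         (auto simp: case_prod_beta' split: split_indicator intro!: nn_integral_cong)
  qed
qed

text \<open>Approximation by fractions \<open>i / (m + 1)\<close>, a countable set of times that does not depend on \<open>s\<close>.\<close>

lemma fraction_approx_tendsto:
  fixes s c :: real
  assumes "0 \<le> s" "s \<le> c"
  shows "(\<lambda>m. min c (real (nat \<lceil>s * real (Suc m)\<rceil>) / real (Suc m))) \<longlonglongrightarrow> s"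
proof (rule LIM_zero_cancel, rule Lim_null_comparison)
  have "\<bar>min c (real (nat \<lceil>s * real (Suc m)\<rceil>) / real (Suc m)) - s\<bar> \<le> 1 / real (Suc m)" for m
  proof -
    have "s * real (Suc m) \<le> real (nat \<lceil>s * real (Suc m)\<rceil>)" "real (nat \<lceil>s * real (Suc m)\<rceil>) \<le> s * real (Suc m) + 1"
      using assms(1) by (auto simp: of_nat_ceiling)
    then have "s \<le> real (nat \<lceil>s * real (Suc m)\<rceil>) / real (Suc m)" "real (nat \<lceil>s * real (Suc m)\<rceil>) / real (Suc m) \<le> s + 1 / real (Suc m)"
      using divide_right_mono[of "real (nat \<lceil>s * real (Suc m)\<rceil>)" "s * real (Suc m) + 1" "real (Suc m)"]
      by (auto simp: pos_le_divide_eq add_divide_distrib)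
    then show ?thesis using assms(2) by (auto simp: min_def abs_le_iff)
  qed
  then show "\<forall>\<^sub>F m in sequentially. norm (min c (real (nat \<lceil>s * real (Suc m)\<rceil>) / real (Suc m)) - s) \<le> 1 / real (Suc m)" by simp
  show "(\<lambda>m. 1 / real (Suc m)) \<longlonglongrightarrow> 0" using LIMSEQ_inverse_real_of_nat by (simp add: inverse_eq_divide)
qed

text \<open>A continuous adapted path is the limit of its values at the fractions just after the current
  time, cut off at the horizon \<open>T\<close> so that no later sigma-algebra is used.\<close>

lemma prog_measurable_continuous_adapted:
  fixes X :: "real \<Rightarrow> 'a \<Rightarrow> real"
  assumes mono: "\<And>s t. s \<le> t \<Longrightarrow> sets (F s) \<subseteq> sets (F t)" and sp: "\<And>t. space (F t) = \<Omega>"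
    and X: "\<And>t. 0 \<le> t \<Longrightarrow> X t \<in> borel_measurable (F (ennreal t))"
    and cont: "\<And>\<omega>. \<omega> \<in> \<Omega> \<Longrightarrow> continuous_on {0..} (\<lambda>t. X t \<omega>)"
  shows "prog_measurable F X"
  unfolding prog_measurable_def
proof (intro allI impI)
  fix T :: real assume T: "0 \<le> T"
  let ?N = "restrict_space borel {0..T} \<Otimes>\<^sub>M F (ennreal T)"
  define k where "k m s = nat \<lceil>s * real (Suc m)\<rceil>" for m and s :: real
  define q where "q m i = min T (real i / real (Suc m))" for m i :: nat
  have fm: "(\<lambda>x. fst x) \<in> borel_measurable ?N"
    by (intro measurable_compose[OF measurable_fst]) (simp add: measurable_restrict_space1)
  show "(\<lambda>(s, \<omega>). X s \<omega>) \<in> borel_measurable ?N"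
  proof (rule borel_measurable_LIMSEQ_real)
    show "(\<lambda>x. X (q m (k m (fst x))) (snd x)) \<in> borel_measurable ?N" for m
    proof (rule measurable_compose_countable)
      show "(\<lambda>x. X (q m i) (snd x)) \<in> borel_measurable ?N" for i
      proof (rule measurable_compose[OF measurable_snd])
        have "0 \<le> q m i" "q m i \<le> T" using T by (auto simp: q_def)
        then show "X (q m i) \<in> borel_measurable (F (ennreal T))"
          using X[of "q m i"] mono[of "ennreal (q m i)" "ennreal T"] sp
          by (auto simp: measurable_def ennreal_leI)
      qed
      show "(\<lambda>x. k m (fst x)) \<in> ?N \<rightarrow>\<^sub>M count_space UNIV"
        unfolding k_def using fm by measurable
    qed
    fix x assume "x \<in> space ?N"
    then have s: "0 \<le> fst x" "fst x \<le> T" and w: "snd x \<in> \<Omega>"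
      by (auto simp: space_pair_measure space_restrict_space sp)
    have lim: "(\<lambda>m. q m (k m (fst x))) \<longlonglongrightarrow> fst x"
      unfolding q_def k_def by (rule fraction_approx_tendsto[OF s])
    have "((\<lambda>m. X (q m (k m (fst x))) (snd x)) \<longlongrightarrow> X (fst x) (snd x)) sequentially"
      by (rule continuous_on_tendsto_compose[OF cont[OF w] lim]) (use s T in \<open>auto simp: q_def\<close>)
    then show "(\<lambda>m. X (q m (k m (fst x))) (snd x)) \<longlonglongrightarrow> (case x of (s, \<omega>) \<Rightarrow> X s \<omega>)"
      by (simp add: case_prod_beta')
  qed
qed

lemma nn_integral_atLeastAtMost_left_limit_le:
  fixes w :: "real \<Rightarrow> ennreal"
  assumes w: "w \<in> borel_measurable (restrict_space borel {0..c})" and s: "0 < s" "s \<le> c"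
    and bd: "\<And>r. 0 \<le> r \<Longrightarrow> r < s \<Longrightarrow> (\<integral>\<^sup>+u\<in>{0..r}. w u \<partial>lborel) \<le> C"
  shows "(\<integral>\<^sup>+u\<in>{0..s}. w u \<partial>lborel) \<le> C"
proof -
  define r where "r k = s - s / real (Suc k)" for k :: nat
  have r: "0 \<le> r k" "r k < s" for k using s by (auto simp: r_def field_simps)
  have wm: "(\<lambda>u. w u * indicator {0..c} u) \<in> borel_measurable lborel"
    using w by (subst (asm) borel_measurable_restrict_space_iff_ennreal) auto
  have m: "(\<lambda>u. w u * indicator {0..t} u) \<in> borel_measurable lborel" if "t \<le> c" for t
  proof -
    have "(\<lambda>u. w u * indicator {0..t} u) = (\<lambda>u. w u * indicator {0..c} u * indicator {0..t} u)"
      using that by (auto simp: fun_eq_iff split: split_indicator)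
    then show ?thesis using wm by simp
  qed
  have "(\<integral>\<^sup>+u\<in>{0..s}. w u \<partial>lborel) = (\<integral>\<^sup>+u. (SUP k. w u * indicator {0..r k} u) \<partial>lborel)"
  proof (rule nn_integral_cong_AE)
    show "AE u in lborel. w u * indicator {0..s} u = (SUP k. w u * indicator {0..r k} u)"
      using AE_lborel_singleton[of s]
    proof eventually_elim
      case (elim u)
      show ?case
      proof (cases "u \<in> {0..s}")
        case True
        then have "u < s" using elim by simp
        obtain k where "s / (s - u) < real k" using reals_Archimedean2 by blast
        then have "s / real (Suc k) < s - u" using s(1) \<open>u < s\<close>
          by (simp add: field_simps)
        then have "u \<in> {0..r k}" using True by (auto simp: r_def)
        then have "w u * indicator {0..s} u \<le> (SUP k. w u * indicator {0..r k} u)"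
          using True by (intro SUP_upper2[of k]) auto
        moreover have "(SUP k. w u * indicator {0..r k} u) \<le> w u * indicator {0..s} u"
          using True by (intro SUP_least) (auto split: split_indicator)
        ultimately show ?thesis by (rule antisym)
      next
        case False
        then have "u \<notin> {0..r k}" for k using r(2)[of k] by auto
        then show ?thesis using False by simp
      qed
    qed
  qed
  also have "\<dots> = (SUP k. \<integral>\<^sup>+u. w u * indicator {0..r k} u \<partial>lborel)"
  proof (rule nn_integral_monotone_convergence_SUP)
    have "r i \<le> r j" if "i \<le> j" for i j
      using that s unfolding r_def by (auto intro!: divide_left_mono)
    then show "incseq (\<lambda>k u. w u * indicator {0..r k} u)"
      by (intro incseq_SucI le_funI mult_left_mono) (auto split: split_indicator intro: order_trans)
    show "(\<lambda>u. w u * indicator {0..r k} u) \<in> borel_measurable lborel" for k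
      using r(2)[of k] s(2) by (intro m) auto
  qed
  also have "\<dots> \<le> C" by (intro SUP_least bd r)
  finally show ?thesis .
qed

lemma nn_integral_atLeastAtMost_mono:
  fixes w :: "real \<Rightarrow> ennreal"
  shows "r \<le> s \<Longrightarrow> (\<integral>\<^sup>+u\<in>{0..r}. w u \<partial>lborel) \<le> (\<integral>\<^sup>+u\<in>{0..s}. w u \<partial>lborel)"
  by (intro nn_integral_mono) (auto split: split_indicator)

text \<open>Stopping the integral of \<open>w\<close> when it exceeds \<open>C\<close>: the set \<open>{u. \<integral> w \<le> C}\<close> is a closed interval
  \<open>[0, \<rho>]\<close> by monotone convergence from the left, even where \<open>w\<close> is infinite, so the left side
  is at most the running integral at \<open>\<rho>\<close>.\<close>

lemma nn_integral_stopped_le: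
  fixes w :: "real \<Rightarrow> ennreal"
  assumes w: "w \<in> borel_measurable (restrict_space borel {0..c})" and c: "0 \<le> c"
  shows "(\<integral>\<^sup>+u\<in>{0..c}. w u * indicator {u. (\<integral>\<^sup>+r\<in>{0..u}. w r \<partial>lborel) \<le> C} u \<partial>lborel) \<le> C"
proof -
  define W where "W u = (\<integral>\<^sup>+r\<in>{0..u}. w r \<partial>lborel)" for u
  have W_mono: "r \<le> s \<Longrightarrow> W r \<le> W s" for r s
    unfolding W_def by (rule nn_integral_atLeastAtMost_mono)
  have "(\<integral>\<^sup>+r\<in>{0::real}. w r \<partial>lborel) = 0"
    by (rule nn_integral_null_set) (simp add: finite_imp_null_set_lborel)
  then have W0: "W 0 = 0" by (simp add: W_def)
  define R where "R = {r \<in> {0..c}. W r \<le> C}"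
  have R: "0 \<in> R" "bdd_above R" using c W0 by (auto simp: R_def)
  define \<rho> where "\<rho> = Sup R"
  have \<rho>: "0 \<le> \<rho>" "\<rho> \<le> c" "\<And>r. r \<in> R \<Longrightarrow> r \<le> \<rho>"
    using R by (auto simp: \<rho>_def intro!: cSup_upper cSup_least) (auto simp: R_def)
  have "W \<rho> \<le> C"
  proof (cases "\<rho> = 0")
    case True then show ?thesis using W0 by simp
  next
    case False
    show ?thesis unfolding W_def
    proof (rule nn_integral_atLeastAtMost_left_limit_le[OF w])
      show "0 < \<rho>" "\<rho> \<le> c" using False \<rho> by auto
      fix r assume "0 \<le> r" "r < \<rho>"
      then obtain r' where "r' \<in> R" "r < r'" using R less_cSup_iff[of R r] unfolding \<rho>_def by blast
      then show "(\<integral>\<^sup>+u\<in>{0..r}. w u \<partial>lborel) \<le> C"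
        using W_mono[of r r'] by (auto simp: R_def W_def)
    qed
  qed
  have "(\<integral>\<^sup>+u\<in>{0..c}. w u * indicator {u. W u \<le> C} u \<partial>lborel) \<le> W \<rho>"
    unfolding W_def[of \<rho>] using \<rho>(3) by (intro nn_integral_mono) (auto split: split_indicator simp: R_def)
  also note \<open>W \<rho> \<le> C\<close>
  finally show ?thesis by (simp add: W_def)
qed

section \<open>Brownian increments and integrals of simple integrands\<close>

locale filtered_prob_space =
  fixes M :: "'a measure" and F :: "ennreal \<Rightarrow> 'a measure"
  assumes usual: "usual_filtered_space M F"
begin

sublocale prob_space M
  using usual by (simp add: usual_filtered_space_def)

lemma space_filtration: "space (F t) = space M"
  using usual by (simp add: usual_filtered_space_def subalgebra_def)

lemma sets_filtration_subset: "sets (F t) \<subseteq> sets M"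
  using usual by (simp add: usual_filtered_space_def subalgebra_def)

lemma sets_filtration_mono: "s \<le> t \<Longrightarrow> sets (F s) \<subseteq> sets (F t)"
  using usual filtration.sets_F_mono[of "space M" F s t] by (simp add: usual_filtered_space_def)

lemma measurable_filtration_mono: "h \<in> F s \<rightarrow>\<^sub>M N \<Longrightarrow> s \<le> t \<Longrightarrow> h \<in> F t \<rightarrow>\<^sub>M N"
  using sets_filtration_mono[of s t] by (auto simp: measurable_def space_filtration)

lemma measurable_filtration: "h \<in> F s \<rightarrow>\<^sub>M N \<Longrightarrow> h \<in> M \<rightarrow>\<^sub>M N"
  using sets_filtration_subset[of s] by (auto simp: measurable_def space_filtration)

end

locale brownian_space = filtered_prob_space +
  fixes B :: "real \<Rightarrow> 'a \<Rightarrow> real"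
  assumes bm: "brownian_motion M F B"
begin

lemma B_measurable: "0 \<le> t \<Longrightarrow> B t \<in> borel_measurable (F (ennreal t))"
  using bm by (simp add: brownian_motion_def adapted_process_def)

lemma B_measurable_le: "0 \<le> s \<Longrightarrow> s \<le> t \<Longrightarrow> B s \<in> borel_measurable (F (ennreal t))"
  by (rule measurable_filtration_mono[OF B_measurable]) (auto simp: ennreal_leI)

lemma B_continuous: "\<omega> \<in> space M \<Longrightarrow> continuous_on {0..} (\<lambda>t. B t \<omega>)"
  using bm by (simp add: brownian_motion_def continuous_paths_def)

lemma increment_distributed:
  "0 \<le> s \<Longrightarrow> s < t \<Longrightarrow> distributed M lborel (\<lambda>\<omega>. B t \<omega> - B s \<omega>)
     (\<lambda>x. ennreal (normal_density 0 (sqrt (t - s)) x))"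
  using bm by (simp add: brownian_motion_def)

lemma increment_moments:
  assumes "0 \<le> s" "s < t"
  shows "integrable M (\<lambda>\<omega>. B t \<omega> - B s \<omega>)" "(\<integral>\<omega>. (B t \<omega> - B s \<omega>) \<partial>M) = 0"
    and "integrable M (\<lambda>\<omega>. (B t \<omega> - B s \<omega>)\<^sup>2)" "(\<integral>\<omega>. (B t \<omega> - B s \<omega>)\<^sup>2 \<partial>M) = t - s"
    and "integrable M (\<lambda>\<omega>. (B t \<omega> - B s \<omega>) ^ 4)" "(\<integral>\<omega>. (B t \<omega> - B s \<omega>) ^ 4 \<partial>M) = 3 * (t - s)\<^sup>2"
proof -
  have s: "0 < sqrt (t - s)" using assms by simp
  note D = increment_distributed[OF assms]
  have nn: "\<And>x. x \<in> space lborel \<Longrightarrow> 0 \<le> normal_density 0 (sqrt (t - s)) x" by simp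
  note I = distributed_integrable[OF D _ nn] and E = distributed_integral[OF D _ nn]
  note m1 = normal_moment_nz_1[OF s, of 0] and m2 = normal_moment_even[OF s, of 0 1]
    and m4 = normal_moment_even[OF s, of 0 2]
  show "integrable M (\<lambda>\<omega>. B t \<omega> - B s \<omega>)" "(\<integral>\<omega>. (B t \<omega> - B s \<omega>) \<partial>M) = 0"
    using I[of "\<lambda>x. x"] E[of "\<lambda>x. x"] m1 by (auto simp: has_bochner_integral_iff)
  show "integrable M (\<lambda>\<omega>. (B t \<omega> - B s \<omega>)\<^sup>2)" "(\<integral>\<omega>. (B t \<omega> - B s \<omega>)\<^sup>2 \<partial>M) = t - s"
    using I[of "\<lambda>x. x\<^sup>2"] E[of "\<lambda>x. x\<^sup>2"] m2 assms by (auto simp: has_bochner_integral_iff)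
  have "fact 4 / ((2 / (sqrt (t - s))\<^sup>2)\<^sup>2 * fact 2) = 3 * (t - s)\<^sup>2"
    using assms by (simp add: fact_numeral field_simps)
  then show "integrable M (\<lambda>\<omega>. (B t \<omega> - B s \<omega>) ^ 4)" "(\<integral>\<omega>. (B t \<omega> - B s \<omega>) ^ 4 \<partial>M) = 3 * (t - s)\<^sup>2"
    using I[of "\<lambda>x. x ^ 4"] E[of "\<lambda>x. x ^ 4"] m4 by (auto simp: has_bochner_integral_iff)
qed

text \<open>Independence is given for the sigma-algebra of the past and the preimages under the increment;
  both contain the sigma-algebras generated by the two random variables.\<close>

lemma increment_indep:
  assumes st: "0 \<le> s" "s < t" and Y: "Y \<in> borel_measurable (F (ennreal s))"
  shows "indep_var borel Y borel (\<lambda>\<omega>. B t \<omega> - B s \<omega>)"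
proof -
  define D where "D = (\<lambda>\<omega>. B t \<omega> - B s \<omega>)"
  have Dm: "D \<in> borel_measurable M"
    using increment_distributed[OF st] by (simp add: D_def distributed_def)
  have ind: "indep_set (sets (F (ennreal s))) {D -` A \<inter> space M | A. A \<in> sets borel}"
    using bm st by (simp add: brownian_motion_def D_def)
  have 1: "sigma_sets (space M) {Y -` A \<inter> space M | A. A \<in> sets borel} \<subseteq> sets (F (ennreal s))"
  proof -
    have "{Y -` A \<inter> space M | A. A \<in> sets borel} \<subseteq> sets (F (ennreal s))"
      using measurable_sets[OF Y] by (auto simp: space_filtration)
    from sets.sigma_sets_subset[OF this] show ?thesis by (simp add: space_filtration)
  qed
  have 2: "sigma_sets (space M) {D -` A \<inter> space M | A. A \<in> sets borel} = {D -` A \<inter> space M | A. A \<in> sets borel}"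
  proof -
    have "sigma_sets (space M) {D -` A \<inter> space M | A. A \<in> sets borel} = sets (vimage_algebra (space M) D borel)"
      by (rule sets_vimage_algebra[symmetric])
    also have "\<dots> = {D -` A \<inter> space M | A. A \<in> sets borel}"
      using sets_vimage_algebra2[of D "space M" borel] by auto
    finally show ?thesis .
  qed
  have "indep_set (sigma_sets (space M) {Y -` A \<inter> space M | A. A \<in> sets borel})
      (sigma_sets (space M) {D -` A \<inter> space M | A. A \<in> sets borel})"
    using ind unfolding indep_set_def 2
    by (rule indep_sets_mono_sets) (use 1 in \<open>auto split: bool.split\<close>)
  then show ?thesis
    unfolding indep_var_eq D_def[symmetric] using measurable_filtration[OF Y] Dm by simp
qed

text \<open>The moments of order 1, 2 and 4 are those that occur in the second order Taylor bound.\<close>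

lemma weighted_increment_moments:
  assumes st: "0 \<le> s" "s < t" and Y: "Y \<in> borel_measurable (F (ennreal s))"
    and bd: "\<And>\<omega>. \<omega> \<in> space M \<Longrightarrow> \<bar>Y \<omega>\<bar> \<le> C"
  shows "integrable M (\<lambda>\<omega>. Y \<omega> * (B t \<omega> - B s \<omega>))"
    "(\<integral>\<omega>. Y \<omega> * (B t \<omega> - B s \<omega>) \<partial>M) = 0"
    and "integrable M (\<lambda>\<omega>. Y \<omega> * (B t \<omega> - B s \<omega>)\<^sup>2)"
    "(\<integral>\<omega>. Y \<omega> * (B t \<omega> - B s \<omega>)\<^sup>2 \<partial>M) = (\<integral>\<omega>. Y \<omega> \<partial>M) * (t - s)"
    and "integrable M (\<lambda>\<omega>. Y \<omega> * (B t \<omega> - B s \<omega>) ^ 4)"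
    "(\<integral>\<omega>. Y \<omega> * (B t \<omega> - B s \<omega>) ^ 4 \<partial>M) = (\<integral>\<omega>. Y \<omega> \<partial>M) * (3 * (t - s)\<^sup>2)"
proof -
  have Yi: "integrable M Y"
    using bd measurable_filtration[OF Y] by (intro integrable_const_bound[where B = C]) auto
  note I = increment_indep[OF st Y]
  have I': "indep_var borel Y borel (\<lambda>\<omega>. p (B t \<omega> - B s \<omega>))" if "p \<in> borel_measurable borel" for p :: "real \<Rightarrow> real"
    using indep_var_compose[OF I measurable_ident that] by (simp add: o_def)
  note I2 = I'[of "\<lambda>x. x\<^sup>2"] and I4 = I'[of "\<lambda>x. x ^ 4"]
  note m = increment_moments[OF st]
  show "integrable M (\<lambda>\<omega>. Y \<omega> * (B t \<omega> - B s \<omega>))"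
    "(\<integral>\<omega>. Y \<omega> * (B t \<omega> - B s \<omega>) \<partial>M) = 0"
    using indep_var_integrable[OF I Yi m(1)] indep_var_lebesgue_integral[OF I Yi m(1)] m(2) by auto
  show "integrable M (\<lambda>\<omega>. Y \<omega> * (B t \<omega> - B s \<omega>)\<^sup>2)"
    "(\<integral>\<omega>. Y \<omega> * (B t \<omega> - B s \<omega>)\<^sup>2 \<partial>M) = (\<integral>\<omega>. Y \<omega> \<partial>M) * (t - s)"
    using indep_var_integrable[OF I2 Yi m(3)] indep_var_lebesgue_integral[OF I2 Yi m(3)] m(4) by auto
  show "integrable M (\<lambda>\<omega>. Y \<omega> * (B t \<omega> - B s \<omega>) ^ 4)"
    "(\<integral>\<omega>. Y \<omega> * (B t \<omega> - B s \<omega>) ^ 4 \<partial>M) = (\<integral>\<omega>. Y \<omega> \<partial>M) * (3 * (t - s)\<^sup>2)"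
    using indep_var_integrable[OF I4 Yi m(5)] indep_var_lebesgue_integral[OF I4 Yi m(5)] m(6) by auto
qed

lemma simple_integrand_points_nonneg:
  assumes "simple_integrand M F n p \<xi>" "i \<le> n"
  shows "0 \<le> p i"
  using assms(2)
proof (induction i)
  case 0 then show ?case using assms(1) by (simp add: simple_integrand_def)
next
  case (Suc i)
  then have "p i \<le> p (Suc i)" using assms(1) by (auto simp: simple_integrand_def)
  then show ?case using Suc by simp
qed

lemma simple_integral_measurable:
  assumes si: "simple_integrand M F n p \<xi>" and t: "0 \<le> t"
  shows "simple_integral B n p \<xi> t \<in> borel_measurable (F (ennreal t))"
proof -
  have "(\<lambda>\<omega>. \<xi> i \<omega> * (B (min (p (Suc i)) t) \<omega> - B (min (p i) t) \<omega>)) \<in> borel_measurable (F (ennreal t))"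
    if i: "i < n" for i
  proof (cases "p i \<le> t")
    case True
    have p: "0 \<le> p i" "0 \<le> p (Suc i)" using simple_integrand_points_nonneg[OF si] i by auto
    have "\<xi> i \<in> borel_measurable (F (ennreal (p i)))" using si i by (simp add: simple_integrand_def)
    then have "\<xi> i \<in> borel_measurable (F (ennreal t))"
      by (rule measurable_filtration_mono) (use True in \<open>simp add: ennreal_leI\<close>)
    then show ?thesis
      using B_measurable_le[of "min (p (Suc i)) t" t] B_measurable_le[of "min (p i) t" t] p t by auto
  next
    case False
    then have "min (p (Suc i)) t = t" "min (p i) t = t"
      using si i by (auto simp: simple_integrand_def min_def dest: spec[of _ i])
    then show ?thesis by simp
  qed
  then show ?thesis unfolding simple_integral_def[abs_def] by (intro borel_measurable_sum) auto
qed

lemma simple_integral_continuous: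
  assumes si: "simple_integrand M F n p \<xi>" and w: "\<omega> \<in> space M"
  shows "continuous_on {0..} (\<lambda>t. simple_integral B n p \<xi> t \<omega>)"
proof -
  have c: "continuous_on {0..} (\<lambda>t. B (min q t) \<omega>)" if "0 \<le> q" for q
    by (rule continuous_on_compose2[OF B_continuous[OF w]]) (use that in \<open>auto intro!: continuous_intros\<close>)
  then show ?thesis
    unfolding simple_integral_def
    by (intro continuous_on_sum continuous_on_mult continuous_on_const continuous_on_diff c
          simple_integrand_points_nonneg[OF si]) auto
qed

lemma simple_process_bounded:
  assumes si: "simple_integrand M F n p \<xi>"
  shows "\<exists>C\<ge>0. \<forall>\<omega>\<in>space M. \<forall>s. \<bar>simple_process n p \<xi> s \<omega>\<bar> \<le> C"
proof -
  have "\<forall>i. \<exists>C. i < n \<longrightarrow> (\<forall>\<omega>\<in>space M. \<bar>\<xi> i \<omega>\<bar> \<le> C)"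
    using si by (auto simp: simple_integrand_def)
  then obtain C where C: "\<And>i \<omega>. i < n \<Longrightarrow> \<omega> \<in> space M \<Longrightarrow> \<bar>\<xi> i \<omega>\<bar> \<le> C i" by metis
  show ?thesis
  proof (intro exI[of _ "\<Sum>i<n. \<bar>C i\<bar>"] conjI ballI allI)
    fix \<omega> s assume w: "\<omega> \<in> space M"
    have "\<bar>simple_process n p \<xi> s \<omega>\<bar> \<le> (\<Sum>i<n. \<bar>\<xi> i \<omega> * indicator {p i<..p (Suc i)} s\<bar>)"
      unfolding simple_process_def by (rule sum_abs)
    also have "\<dots> \<le> (\<Sum>i<n. \<bar>C i\<bar>)"
      by (rule sum_mono) (use C[OF _ w] in \<open>fastforce split: split_indicator intro: order_trans[OF _ abs_ge_self]\<close>)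
    finally show "\<bar>simple_process n p \<xi> s \<omega>\<bar> \<le> (\<Sum>i<n. \<bar>C i\<bar>)" .
  qed (simp add: sum_nonneg)
qed

lemma simple_process_measurable_left:
  assumes si: "simple_integrand M F n p \<xi>" and u: "0 \<le> u" "u < v"
    and no: "p ` {..n} \<inter> {u<..<v} = {}"
  shows "simple_process n p \<xi> v \<in> borel_measurable (F (ennreal u))"
proof -
  have "(\<lambda>\<omega>. \<xi> i \<omega> * indicator {p i<..p (Suc i)} v) \<in> borel_measurable (F (ennreal u))" if i: "i < n" for i
  proof (cases "p i \<le> u")
    case True
    have "\<xi> i \<in> borel_measurable (F (ennreal (p i)))" using si i by (simp add: simple_integrand_def)
    then have "\<xi> i \<in> borel_measurable (F (ennreal u))"
      by (rule measurable_filtration_mono) (use True in \<open>simp add: ennreal_leI\<close>)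
    then show ?thesis by simp
  next
    case False
    have "p i \<in> p ` {..n}" using i by simp
    then have "v \<le> p i" using no False by (meson disjoint_iff greaterThanLessThan_iff not_le)
    then show ?thesis by simp
  qed
  then show ?thesis unfolding simple_process_def[abs_def] by (intro borel_measurable_sum) auto
qed

lemma simple_process_const_between:
  assumes si: "simple_integrand M F n p \<xi>" and s: "u < s" "s \<le> v"
    and no: "p ` {..n} \<inter> {u<..<v} = {}"
  shows "simple_process n p \<xi> s \<omega> = simple_process n p \<xi> v \<omega>"
proof -
  have c: "p i \<le> u \<or> v \<le> p i" if "i \<le> n" for i using no that by (force simp: disjoint_iff)
  have "indicator {p i<..p (Suc i)} s = (indicator {p i<..p (Suc i)} v :: real)" if "i < n" for i
    using that s c[of i] c[of "Suc i"]
    by (auto split: split_indicator)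
  then show ?thesis unfolding simple_process_def by (intro sum.cong) auto
qed

lemma simple_integral_increment:
  assumes si: "simple_integrand M F n p \<xi>" and u: "u < v"
    and no: "p ` {..n} \<inter> {u<..<v} = {}"
  shows "simple_integral B n p \<xi> v \<omega> - simple_integral B n p \<xi> u \<omega> =
    simple_process n p \<xi> v \<omega> * (B v \<omega> - B u \<omega>)"
proof -
  have c: "p i \<le> u \<or> v \<le> p i" if "i \<le> n" for i using no that by (force simp: disjoint_iff)
  have "\<xi> i \<omega> * (B (min (p (Suc i)) v) \<omega> - B (min (p i) v) \<omega>) - \<xi> i \<omega> * (B (min (p (Suc i)) u) \<omega> - B (min (p i) u) \<omega>)
      = \<xi> i \<omega> * indicator {p i<..p (Suc i)} v * (B v \<omega> - B u \<omega>)" if i: "i < n" for i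
  proof -
    have "p i \<le> p (Suc i)" using si i by (simp add: simple_integrand_def)
    then consider "p i \<le> u" "p (Suc i) \<le> u" | "p i \<le> u" "v \<le> p (Suc i)" | "v \<le> p i" "v \<le> p (Suc i)"
      using c[of i] c[of "Suc i"] i u by force
    then show ?thesis
      by cases (use u in \<open>auto simp: min_def algebra_simps split: split_indicator\<close>)
  qed
  then show ?thesis
    unfolding simple_integral_def simple_process_def sum_subtractf[symmetric] sum_distrib_right
    by (intro sum.cong) auto
qed

end

section \<open>Sums along partitions of an interval\<close>

definition grid :: "real \<Rightarrow> real \<Rightarrow> nat \<Rightarrow> (nat \<Rightarrow> real) \<Rightarrow> bool" where
  "grid a c N t \<longleftrightarrow> t 0 = a \<and> t N = c \<and> (\<forall>j<N. t j < t (Suc j))"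

lemma grid_mono:
  assumes "grid a c N t" "i \<le> j" "j \<le> N" shows "t i \<le> t j"
  using assms(2,3)
proof (induction j rule: dec_induct)
  case (step m)
  then have "t m < t (Suc m)" using assms(1) by (simp add: grid_def)
  then show ?case using step by simp
qed simp

lemma grid_range: "grid a c N t \<Longrightarrow> j \<le> N \<Longrightarrow> a \<le> t j \<and> t j \<le> c"
  using grid_mono[of a c N t 0 j] grid_mono[of a c N t j N] by (auto simp: grid_def)

lemma grid_pick:
  assumes g: "grid a c N t" and s: "a < s" "s \<le> c"
  shows "\<exists>j<N. t j < s \<and> s \<le> t (Suc j) \<and>
    (\<forall>f :: nat \<Rightarrow> real. (\<Sum>i<N. indicator {t i<..t (Suc i)} s * f i) = f j)"
proof -
  define k where "k = (LEAST k. s \<le> t k)"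
  have "s \<le> t N" using g s by (simp add: grid_def)
  then have k: "s \<le> t k" "k \<le> N" "\<And>i. i < k \<Longrightarrow> \<not> s \<le> t i"
    unfolding k_def by (auto intro: LeastI Least_le dest: not_less_Least)
  have "k \<noteq> 0" using k(1) g s by (auto simp: grid_def intro: ccontr)
  then obtain j where j: "k = Suc j" by (cases k) auto
  have 1: "j < N" "t j < s" "s \<le> t (Suc j)" using k j by (auto simp: not_le)
  show ?thesis
  proof (intro exI[of _ j] conjI allI 1)
    fix f :: "nat \<Rightarrow> real"
    have "indicator {t i<..t (Suc i)} s * f i = (if i = j then f j else 0)" if i: "i < N" for i
    proof -
      have "i < j \<or> i = j \<or> j < i" by linarith
      then show ?thesis
        using grid_mono[OF g, of "Suc i" j] grid_mono[OF g, of "Suc j" i] i 1 by (auto split: split_indicator)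
    qed
    then have "(\<Sum>i<N. indicator {t i<..t (Suc i)} s * f i) = (\<Sum>i<N. if i = j then f j else 0)"
      by (intro sum.cong) auto
    then show "(\<Sum>i<N. indicator {t i<..t (Suc i)} s * f i) = f j" using 1 by simp
  qed
qed

lemma grid_sum_lengths: "grid a c N t \<Longrightarrow> (\<Sum>j<N. t (Suc j) - t j) = c - a"
  by (simp add: sum_lessThan_telescope grid_def)

lemma grid_integral_abs_sum_le:
  fixes b :: "real \<Rightarrow> real"
  assumes g: "grid a c N t" and b: "integrable lborel b"
  shows "(\<Sum>j<N. LINT s:{t j<..t (Suc j)}|lborel. \<bar>b s\<bar>) \<le> (\<integral>s. \<bar>b s\<bar> \<partial>lborel)"
proof -
  have i: "integrable lborel (\<lambda>s. indicator {t j<..t (Suc j)} s * \<bar>b s\<bar>)" for j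
    using integrable_mult_indicator[OF _ integrable_abs[OF b], of "{t j<..t (Suc j)}"] by simp
  have "(\<Sum>j<N. LINT s:{t j<..t (Suc j)}|lborel. \<bar>b s\<bar>)
      = (\<integral>s. (\<Sum>j<N. indicator {t j<..t (Suc j)} s * \<bar>b s\<bar>) \<partial>lborel)"
    using i by (subst Bochner_Integration.integral_sum) (auto simp: set_lebesgue_integral_def)
  also have "\<dots> \<le> (\<integral>s. \<bar>b s\<bar> \<partial>lborel)"
  proof (rule integral_mono)
    show "integrable lborel (\<lambda>s. \<Sum>j<N. indicator {t j<..t (Suc j)} s * \<bar>b s\<bar>)"
      using i by (rule Bochner_Integration.integrable_sum)
    show "integrable lborel (\<lambda>s. \<bar>b s\<bar>)" using b by simp
    fix s
    show "(\<Sum>j<N. indicator {t j<..t (Suc j)} s * \<bar>b s\<bar>) \<le> \<bar>b s\<bar>"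
    proof (cases "a < s \<and> s \<le> c")
      case True
      then obtain j where "\<forall>f :: nat \<Rightarrow> real. (\<Sum>i<N. indicator {t i<..t (Suc i)} s * f i) = f j"
        using grid_pick[OF g, of s] by blast
      then have "(\<Sum>i<N. indicator {t i<..t (Suc i)} s * (\<lambda>_. \<bar>b s\<bar>) i) = (\<lambda>_. \<bar>b s\<bar>) j" by (rule spec)
      then show ?thesis by (simp only: order_refl)
    next
      case False
      have "indicator {t i<..t (Suc i)} s = (0::real)" if "i < N" for i
        using grid_range[OF g, of i] grid_range[OF g, of "Suc i"] that False by (auto split: split_indicator)
      then show ?thesis by simp
    qed
  qed
  finally show ?thesis .
qed

text \<open>The sum is the integral over \<open>(a, c]\<close> of a step-wise frozen integrand, where \<open>G\<close> and \<open>z\<close> are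
  taken at the left end point of the current interval. These left end points lie strictly before
  \<open>s\<close> and tend to \<open>s\<close>; as \<open>G\<close> is decreasing and left-continuous, its frozen value is eventually
  that at \<open>s\<close>. Conclude by dominated convergence.\<close>

lemma grid_riemann_sum_tendsto:
  fixes b e z \<phi>1 \<phi>2 :: "real \<Rightarrow> real" and G :: "real \<Rightarrow> bool"
  assumes a: "0 \<le> a" "a < c"
    and g: "\<And>m. grid a c (N m) (t m)"
    and mesh: "\<And>m j. j < N m \<Longrightarrow> t m (Suc j) \<le> t m j + 1 / real (Suc m)"
    and b: "integrable lborel b"
    and em: "e \<in> borel_measurable borel" and eb: "\<And>s. \<bar>e s\<bar> \<le> E"
    and ec: "\<And>m j s. j < N m \<Longrightarrow> t m j < s \<Longrightarrow> s \<le> t m (Suc j) \<Longrightarrow> e s = e (t m (Suc j))"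
    and z: "continuous_on {0..c} z"
    and Gdec: "\<And>r s. r \<le> s \<Longrightarrow> G s \<Longrightarrow> G r"
    and Gleft: "\<And>s. 0 < s \<Longrightarrow> s \<le> c \<Longrightarrow> (\<And>r. 0 \<le> r \<Longrightarrow> r < s \<Longrightarrow> G r) \<Longrightarrow> G s"
    and c1: "continuous_on UNIV \<phi>1" and c2: "continuous_on UNIV \<phi>2"
    and b1: "\<And>x. \<bar>\<phi>1 x\<bar> \<le> C" and b2: "\<And>x. \<bar>\<phi>2 x\<bar> \<le> C"
  defines "R m \<equiv> (\<Sum>j<N m. of_bool (G (t m j)) *
      (\<phi>1 (z (t m j)) * (LINT s:{t m j<..t m (Suc j)}|lborel. b s)
        + \<phi>2 (z (t m j)) * (e (t m (Suc j)))\<^sup>2 * (t m (Suc j) - t m j) / 2))"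
  shows "R \<longlonglongrightarrow> (LINT s:{a<..c}|lborel. of_bool (G s) * (\<phi>1 (z s) * b s + \<phi>2 (z s) * (e s)\<^sup>2 / 2))"
    and "\<bar>R m\<bar> \<le> C * (\<integral>s. \<bar>b s\<bar> \<partial>lborel) + C * E\<^sup>2 / 2 * (c - a)"
proof -
  define h where "h j s m = of_bool (G (t m j)) * (\<phi>1 (z (t m j)) * b s + \<phi>2 (z (t m j)) * (e s)\<^sup>2 / 2)" for j s m
  define \<Psi> where "\<Psi> m s = (\<Sum>j<N m. indicator {t m j<..t m (Suc j)} s * h j s m)" for m s
  define D where "D s = C * \<bar>b s\<bar> + C * E\<^sup>2 / 2 * indicator {a<..c} s" for s
  have C: "0 \<le> C" using b1[of 0] by linarith
  have bm[measurable]: "b \<in> borel_measurable borel" using b by (simp add: borel_measurable_integrable)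
  note em[measurable]
  have \<Psi>m[measurable]: "\<Psi> m \<in> borel_measurable lborel" for m
    unfolding \<Psi>_def[abs_def] h_def[abs_def] by measurable
  have e2: "(e s)\<^sup>2 \<le> E\<^sup>2" for s using eb[of s] by (simp add: abs_le_square_iff[symmetric])
  have hb: "\<bar>h j s m\<bar> \<le> C * \<bar>b s\<bar> + C * E\<^sup>2 / 2" for j s m
  proof -
    have "\<bar>\<phi>1 (z (t m j)) * b s\<bar> \<le> C * \<bar>b s\<bar>" unfolding abs_mult by (intro mult_right_mono b1) auto
    moreover have "\<bar>\<phi>2 (z (t m j)) * (e s)\<^sup>2\<bar> \<le> C * E\<^sup>2"
      unfolding abs_mult by (intro mult_mono b2 C) (use e2 in auto)
    moreover have "0 \<le> C * \<bar>b s\<bar> + C * E\<^sup>2 / 2" using C by simp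
    ultimately show ?thesis unfolding h_def by (cases "G (t m j)") auto
  qed
  have \<Psi>0: "\<Psi> m s = 0" if "\<not> (a < s \<and> s \<le> c)" for m s
  proof -
    have "indicator {t m i<..t m (Suc i)} s = (0::real)" if i: "i < N m" for i
      using grid_range[OF g, of i m] grid_range[OF g, of "Suc i" m] i \<open>\<not> (a < s \<and> s \<le> c)\<close> by (auto split: split_indicator)
    then show ?thesis unfolding \<Psi>_def by simp
  qed
  have \<Psi>b: "\<bar>\<Psi> m s\<bar> \<le> D s" for m s
  proof (cases "a < s \<and> s \<le> c")
    case True
    then obtain j where "\<forall>f :: nat \<Rightarrow> real. (\<Sum>i<N m. indicator {t m i<..t m (Suc i)} s * f i) = f j"
      using grid_pick[OF g[of m], of s] by blast
    then have "\<Psi> m s = h j s m" unfolding \<Psi>_def by (rule spec)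
    then show ?thesis using hb[of j s m] True by (simp add: D_def)
  next
    case False
    then show ?thesis using \<Psi>0[of s m] C by (simp add: D_def)
  qed
  have Ii: "integrable lborel (indicator {a<..c} :: real \<Rightarrow> real)"
    using integrable_real_indicator[of "{a<..c}" lborel] a by simp
  have Di: "integrable lborel D"
    unfolding D_def[abs_def]
    by (intro Bochner_Integration.integrable_add integrable_mult_right integrable_abs b Ii)
  have RI: "R m = (\<integral>s. \<Psi> m s \<partial>lborel)" for m
  proof -
    have ib: "integrable lborel (\<lambda>s. indicator {t m j<..t m (Suc j)} s * b s)" for j
      using integrable_mult_indicator[OF _ b, of "{t m j<..t m (Suc j)}"] by simp
    have hi: "has_bochner_integral lborel (\<lambda>s. indicator {t m j<..t m (Suc j)} s * h j s m)
        (of_bool (G (t m j)) * (\<phi>1 (z (t m j)) * (LINT s:{t m j<..t m (Suc j)}|lborel. b s)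
        + \<phi>2 (z (t m j)) * (e (t m (Suc j)))\<^sup>2 * (t m (Suc j) - t m j) / 2))" if j: "j < N m" for j
    proof -
      have lt: "t m j < t m (Suc j)" using g[of m] j by (simp add: grid_def)
      have eq: "indicator {t m j<..t m (Suc j)} s * h j s m = of_bool (G (t m j)) * (\<phi>1 (z (t m j)) * (indicator {t m j<..t m (Suc j)} s * b s)
          + (\<phi>2 (z (t m j)) * (e (t m (Suc j)))\<^sup>2 / 2) * indicator {t m j<..t m (Suc j)} s)" for s
        using ec[OF j, of s] by (auto simp: h_def split: split_indicator)
      have "has_bochner_integral lborel (\<lambda>s. indicator {t m j<..t m (Suc j)} s :: real) (t m (Suc j) - t m j)"
        using has_bochner_integral_real_indicator[of "{t m j<..t m (Suc j)}" lborel] lt by (simp add: has_bochner_integral_real_indicator)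
      moreover have "has_bochner_integral lborel (\<lambda>s. indicator {t m j<..t m (Suc j)} s * b s) (LINT s:{t m j<..t m (Suc j)}|lborel. b s)"
        using has_bochner_integral_integrable[OF ib] by (simp add: set_lebesgue_integral_def)
      ultimately have "has_bochner_integral lborel (\<lambda>s. of_bool (G (t m j)) * (\<phi>1 (z (t m j)) * (indicator {t m j<..t m (Suc j)} s * b s)
          + (\<phi>2 (z (t m j)) * (e (t m (Suc j)))\<^sup>2 / 2) * indicator {t m j<..t m (Suc j)} s))
          (of_bool (G (t m j)) * (\<phi>1 (z (t m j)) * (LINT s:{t m j<..t m (Suc j)}|lborel. b s)
        + (\<phi>2 (z (t m j)) * (e (t m (Suc j)))\<^sup>2 / 2) * (t m (Suc j) - t m j)))"
        by (intro has_bochner_integral_mult_right has_bochner_integral_add) auto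
      then show ?thesis unfolding eq by simp
    qed
    have "has_bochner_integral lborel (\<Psi> m) (R m)"
      unfolding \<Psi>_def[abs_def] R_def by (rule has_bochner_integral_sum) (use hi in auto)
    then show ?thesis by (simp add: has_bochner_integral_integral_eq)
  qed
  show "\<bar>R m\<bar> \<le> C * (\<integral>s. \<bar>b s\<bar> \<partial>lborel) + C * E\<^sup>2 / 2 * (c - a)"
  proof -
    have "integrable lborel (\<Psi> m)"
      by (rule Bochner_Integration.integrable_bound[OF Di \<Psi>m])
         (use \<Psi>b in \<open>auto intro!: AE_I2 intro: order_trans[OF _ abs_ge_self]\<close>)
    then have "\<bar>R m\<bar> \<le> (\<integral>s. D s \<partial>lborel)"
      unfolding RI using Bochner_Integration.integral_norm_bound_integral[OF _ Di, of "\<Psi> m"] \<Psi>b by simp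
    also have "\<dots> = C * (\<integral>s. \<bar>b s\<bar> \<partial>lborel) + C * E\<^sup>2 / 2 * (c - a)"
      unfolding D_def using b a
      by (subst Bochner_Integration.integral_add) (auto intro!: integrable_mult_right Ii)
    finally show ?thesis .
  qed
  define \<Psi>l where "\<Psi>l s = indicator {a<..c} s * (of_bool (G s) * (\<phi>1 (z s) * b s + \<phi>2 (z s) * (e s)\<^sup>2 / 2))" for s
  have lim: "(\<lambda>m. \<Psi> m s) \<longlonglongrightarrow> \<Psi>l s" for s
  proof (cases "a < s \<and> s \<le> c")
    case False then show ?thesis using \<Psi>0 by (simp add: \<Psi>l_def)
  next
    case True
    have "\<forall>m. \<exists>j<N m. t m j < s \<and> s \<le> t m (Suc j) \<and> \<Psi> m s = h j s m"
    proof
      fix m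
      obtain j where j: "j < N m" "t m j < s" "s \<le> t m (Suc j)"
        "\<forall>f :: nat \<Rightarrow> real. (\<Sum>i<N m. indicator {t m i<..t m (Suc i)} s * f i) = f j"
        using grid_pick[OF g[of m], of s] True by blast
      have "\<Psi> m s = h j s m" unfolding \<Psi>_def using j(4) by (rule spec)
      with j show "\<exists>j<N m. t m j < s \<and> s \<le> t m (Suc j) \<and> \<Psi> m s = h j s m" by blast
    qed
    then obtain k where k: "\<And>m. k m < N m" "\<And>m. t m (k m) < s" "\<And>m. s \<le> t m (Suc (k m))" "\<And>m. \<Psi> m s = h (k m) s m"
      by metis
    define \<kappa> where "\<kappa> m = t m (k m)" for m
    have \<kappa>: "\<kappa> m < s" "a \<le> \<kappa> m" "s - 1 / real (Suc m) \<le> \<kappa> m" for m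
      using k(2,3)[of m] grid_range[OF g, of "k m" m] mesh[of "k m" m] k(1)[of m] by (auto simp: \<kappa>_def)
    have l0: "(\<lambda>m. 1 / real (Suc m)) \<longlonglongrightarrow> 0"
      using LIMSEQ_inverse_real_of_nat by (simp add: inverse_eq_divide)
    have \<kappa>l: "\<kappa> \<longlonglongrightarrow> s"
    proof (rule tendsto_sandwich)
      show "(\<lambda>m. s - 1 / real (Suc m)) \<longlonglongrightarrow> s" using tendsto_diff[OF tendsto_const l0, of s] by simp
    qed (use \<kappa> in \<open>auto intro!: always_eventually less_imp_le\<close>)
    have \<kappa>c: "\<kappa> m \<in> {0..c}" for m using \<kappa>(1,2)[of m] True a by auto
    have zl: "(\<lambda>m. z (\<kappa> m)) \<longlonglongrightarrow> z s"
      by (rule continuous_on_tendsto_compose[OF z \<kappa>l]) (use True a \<kappa>c in auto)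
    have gl: "(\<lambda>m. of_bool (G (\<kappa> m)) :: real) \<longlonglongrightarrow> of_bool (G s)"
    proof (rule tendsto_eventually)
      show "\<forall>\<^sub>F m in sequentially. of_bool (G (\<kappa> m)) = (of_bool (G s) :: real)"
      proof (cases "G s")
        case True
        then have "G (\<kappa> m)" for m using Gdec[of "\<kappa> m" s] \<kappa>(1)[of m] by simp
        then show ?thesis using True by simp
      next
        case False
        then obtain r where r: "0 \<le> r" "r < s" "\<not> G r"
          using Gleft[of s] True a by fastforce
        have "\<forall>\<^sub>F m in sequentially. r < \<kappa> m" using \<kappa>l r(2) by (rule order_tendstoD)
        then show ?thesis
          by eventually_elim (use False r Gdec in \<open>auto intro: less_imp_le\<close>)
      qed
    qed
    have p1: "(\<lambda>m. \<phi>1 (z (\<kappa> m))) \<longlonglongrightarrow> \<phi>1 (z s)" and p2: "(\<lambda>m. \<phi>2 (z (\<kappa> m))) \<longlonglongrightarrow> \<phi>2 (z s)"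
      using continuous_on_tendsto_compose[OF c1 zl] continuous_on_tendsto_compose[OF c2 zl] by auto
    have "(\<lambda>m. of_bool (G (\<kappa> m)) * (\<phi>1 (z (\<kappa> m)) * b s + \<phi>2 (z (\<kappa> m)) * (e s)\<^sup>2 / 2)) \<longlonglongrightarrow>
        of_bool (G s) * (\<phi>1 (z s) * b s + \<phi>2 (z s) * (e s)\<^sup>2 / 2)"
      by (intro tendsto_intros gl p1 p2) auto
    then show ?thesis using True by (simp add: k(4) h_def \<kappa>_def \<Psi>l_def)
  qed
  have "\<Psi>l \<in> borel_measurable lborel"
    by (rule borel_measurable_LIMSEQ_real[where u = \<Psi>]) (use lim in auto)
  then have "(\<lambda>m. \<integral>s. \<Psi> m s \<partial>lborel) \<longlonglongrightarrow> (\<integral>s. \<Psi>l s \<partial>lborel)"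
    by (rule integral_dominated_convergence[where w = D]) (use Di lim \<Psi>b in auto)
  then show "R \<longlonglongrightarrow> (LINT s:{a<..c}|lborel. of_bool (G s) * (\<phi>1 (z s) * b s + \<phi>2 (z s) * (e s)\<^sup>2 / 2))"
    unfolding RI[abs_def] by (simp add: \<Psi>l_def set_lebesgue_integral_def)
qed

lemma integrable_indefinite_continuous_on:
  fixes b :: "real \<Rightarrow> real"
  assumes b: "integrable lborel b"
  shows "continuous_on {0..c} (\<lambda>t. LINT s:{0..t}|lborel. b s)"
proof -
  have si: "set_integrable lborel S b" if "S \<in> sets borel" for S
    unfolding set_integrable_def using integrable_mult_indicator[OF _ b, of S] that by simp
  have "b integrable_on {0..c}" using set_borel_integral_eq_integral(1)[OF si[of "{0..c}"]] by simp
  then have "continuous_on {0..c} (\<lambda>t. integral {0..t} b)" by (rule indefinite_integral_continuous_1)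
  then show ?thesis
    using set_borel_integral_eq_integral(2)[OF si] by simp
qed

lemma indefinite_integral_increment:
  fixes b :: "real \<Rightarrow> real"
  assumes b: "integrable lborel b" and uv: "0 \<le> u" "u \<le> v"
  shows "(LINT s:{0..v}|lborel. b s) - (LINT s:{0..u}|lborel. b s) = (LINT s:{u<..v}|lborel. b s)"
proof -
  have i: "integrable lborel (\<lambda>s. indicator S s *\<^sub>R b s)" if "S \<in> sets borel" for S
    using integrable_mult_indicator[OF _ b, of S] that by simp
  show ?thesis
    unfolding set_lebesgue_integral_def
    by (subst Bochner_Integration.integral_diff[OF i i, symmetric])
       (use uv in \<open>auto intro!: Bochner_Integration.integral_cong split: split_indicator\<close>)
qed

text \<open>The drift has finite variation, hence no quadratic variation: the sum of squares is at most the
  largest increment times the total variation, and the largest increment tends to \<open>0\<close> by uniform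
  continuity of the primitive.\<close>

lemma grid_sum_squares_tendsto_0:
  fixes b :: "real \<Rightarrow> real"
  assumes a: "0 \<le> a" and g: "\<And>m. grid a c (N m) (t m)"
    and mesh: "\<And>m j. j < N m \<Longrightarrow> t m (Suc j) \<le> t m j + 1 / real (Suc m)"
    and b: "integrable lborel b"
  defines "Q m \<equiv> (\<Sum>j<N m. (LINT s:{t m j<..t m (Suc j)}|lborel. b s)\<^sup>2)"
  shows "Q \<longlonglongrightarrow> 0" and "0 \<le> Q m" and "Q m \<le> (\<integral>s. \<bar>b s\<bar> \<partial>lborel)\<^sup>2"
proof -
  let ?V = "\<integral>s. \<bar>b s\<bar> \<partial>lborel"
  let ?d = "\<lambda>m j. LINT s:{t m j<..t m (Suc j)}|lborel. b s"
  have V: "0 \<le> ?V" by simp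
  have ab: "\<bar>?d m j\<bar> \<le> (LINT s:{t m j<..t m (Suc j)}|lborel. \<bar>b s\<bar>)" for m j
    unfolding set_lebesgue_integral_def
    using integral_abs_bound[of lborel "\<lambda>s. indicator {t m j<..t m (Suc j)} s *\<^sub>R b s"]
    by (simp add: abs_mult)
  have tot: "(\<Sum>j<N m. \<bar>?d m j\<bar>) \<le> ?V" for m
    by (rule order_trans[OF sum_mono grid_integral_abs_sum_le[OF g b]]) (rule ab)
  have Qle: "Q m \<le> r * ?V" if r: "0 \<le> r" "\<And>j. j < N m \<Longrightarrow> \<bar>?d m j\<bar> \<le> r" for m r
  proof -
    have "Q m \<le> (\<Sum>j<N m. r * \<bar>?d m j\<bar>)"
      unfolding Q_def 
    proof (rule sum_mono)
      fix j assume "j \<in> {..<N m}"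
      then have "\<bar>?d m j\<bar> * \<bar>?d m j\<bar> \<le> r * \<bar>?d m j\<bar>" using r(2) by (intro mult_right_mono) auto
      then show "(?d m j)\<^sup>2 \<le> r * \<bar>?d m j\<bar>" by (simp add: power2_eq_square)
    qed
    also have "\<dots> = r * (\<Sum>j<N m. \<bar>?d m j\<bar>)" by (simp add: sum_distrib_left)
    also have "\<dots> \<le> r * ?V" by (rule mult_left_mono[OF tot r(1)])
    finally show ?thesis .
  qed
  have Q0: "0 \<le> Q m" for m unfolding Q_def by (intro sum_nonneg) auto
  then show "0 \<le> Q m" .
  have "\<bar>?d m j\<bar> \<le> ?V" if "j < N m" for j
    using tot[of m] member_le_sum[of j "{..<N m}" "\<lambda>j. \<bar>?d m j\<bar>"] that by auto
  from Qle[OF V this] show "Q m \<le> ?V\<^sup>2" by (simp add: power2_eq_square)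
  show "Q \<longlonglongrightarrow> 0"
  proof (rule LIMSEQ_I)
    fix r :: real assume r: "0 < r"
    define e where "e = r / 2 / (?V + 1)"
    have e: "0 < e" unfolding e_def using r by (intro divide_pos_pos add_nonneg_pos V) simp_all
    have "uniformly_continuous_on {0..c} (\<lambda>t. LINT s:{0..t}|lborel. b s)"
      by (rule compact_uniformly_continuous[OF integrable_indefinite_continuous_on[OF b]]) simp
    then obtain d where d: "0 < d" "\<And>x y. x \<in> {0..c} \<Longrightarrow> y \<in> {0..c} \<Longrightarrow> dist y x < d \<Longrightarrow>
        dist (LINT s:{0..y}|lborel. b s) (LINT s:{0..x}|lborel. b s) < e"
      using e unfolding uniformly_continuous_on_def by meson
    obtain m0 where m0: "1 / real (Suc m0) < d" using d(1) nat_approx_posE by blast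
    have "norm (Q m - 0) < r" if "m0 \<le> m" for m
    proof -
      have hm: "1 / real (Suc m) < d" using m0 that by (smt (verit) frac_le of_nat_0_less_iff of_nat_mono Suc_le_mono zero_less_Suc)
      have "\<bar>?d m j\<bar> \<le> e" if j: "j < N m" for j
      proof -
        have "t m j < t m (Suc j)" using g[of m] j by (simp add: grid_def)
        moreover have "0 \<le> t m j" "t m j \<le> c" "t m (Suc j) \<le> c"
          using grid_range[OF g, of j m] grid_range[OF g, of "Suc j" m] j a by auto
        ultimately show ?thesis
          using d(2)[of "t m j" "t m (Suc j)"] mesh[OF j] hm indefinite_integral_increment[OF b, of "t m j" "t m (Suc j)"]
          by (auto simp: dist_real_def)
      qed
      from Qle[OF less_imp_le[OF e] this] have "Q m \<le> e * ?V" .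
      also have "\<dots> \<le> e * (?V + 1)" using e by simp
      also have "\<dots> = r / 2"
      proof -
        have "?V + 1 \<noteq> 0" using V by linarith
        then show ?thesis unfolding e_def by (rule nonzero_eq_divide_eq[THEN iffD1, OF _ refl])
      qed
      also have "\<dots> < r" using r by simp
      finally show ?thesis using Q0[of m] by simp
    qed
    then show "\<exists>no. \<forall>m\<ge>no. norm (Q m - 0) < r" by blast
  qed
qed

context brownian_space
begin

section \<open>Ito's formula as an inequality for simple integrands\<close>

text \<open>One step of Ito's formula. The term linear in the Brownian increment has mean zero, its square
  has mean \<open>v - u\<close>, and its fourth power, with mean \<open>3 (v - u)\<^sup>2\<close>, disappears in the limit even
  after summation.\<close>

lemma taylor_step_expectation:
  fixes \<phi> \<phi>1 \<phi>2 :: "real \<Rightarrow> real"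
  assumes uv: "0 \<le> u" "u < v"
    and \<eta>: "\<eta> \<in> borel_measurable (F (ennreal u))" "\<And>\<omega>. \<omega> \<in> space M \<Longrightarrow> \<bar>\<eta> \<omega>\<bar> \<le> E"
    and g: "g \<in> borel_measurable (F (ennreal u))" "\<And>\<omega>. \<omega> \<in> space M \<Longrightarrow> 0 \<le> g \<omega> \<and> g \<omega> \<le> 1"
    and z: "z \<in> borel_measurable (F (ennreal u))"
    and D: "D \<in> borel_measurable M" "\<And>\<omega>. \<omega> \<in> space M \<Longrightarrow> \<bar>D \<omega>\<bar> \<le> n"
    and z': "\<And>\<omega>. \<omega> \<in> space M \<Longrightarrow> z' \<omega> = z \<omega> + (D \<omega> + \<eta> \<omega> * (B v \<omega> - B u \<omega>))"
    and m: "\<phi> \<in> borel_measurable borel" "\<phi>1 \<in> borel_measurable borel" "\<phi>2 \<in> borel_measurable borel"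
    and bd: "\<And>x. \<bar>\<phi> x\<bar> \<le> C0" "\<And>x. \<bar>\<phi>1 x\<bar> \<le> C" "\<And>x. \<bar>\<phi>2 x\<bar> \<le> C"
    and eK: "0 \<le> e" "0 \<le> K"
    and taylor: "\<And>x D y. \<bar>D\<bar> \<le> n \<Longrightarrow>
      \<phi> x + \<phi>1 x * (D + y) + \<phi>2 x * y\<^sup>2 / 2 - e * y\<^sup>2 - K * y ^ 4 - K * D\<^sup>2 \<le> \<phi> (x + (D + y))"
  shows "(\<integral>\<omega>. g \<omega> * (\<phi>1 (z \<omega>) * D \<omega> + \<phi>2 (z \<omega>) * (\<eta> \<omega>)\<^sup>2 * (v - u) / 2) \<partial>M)
      - e * E\<^sup>2 * (v - u) - 3 * K * E ^ 4 * (v - u)\<^sup>2 - K * (\<integral>\<omega>. (D \<omega>)\<^sup>2 \<partial>M)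
    \<le> (\<integral>\<omega>. g \<omega> * (\<phi> (z' \<omega>) - \<phi> (z \<omega>)) \<partial>M)"
proof -
  define b where "b \<omega> = B v \<omega> - B u \<omega>" for \<omega>
  note m[measurable] D(1)[measurable]
  note [measurable] = measurable_filtration[OF \<eta>(1)] measurable_filtration[OF g(1)] measurable_filtration[OF z]
  have "B u \<in> borel_measurable M" "B v \<in> borel_measurable M"
    using uv measurable_filtration[OF B_measurable] by auto
  then have [measurable]: "b \<in> borel_measurable M" unfolding b_def[abs_def] by simp
  define Y1 where "Y1 \<omega> = g \<omega> * \<phi>1 (z \<omega>) * \<eta> \<omega>" for \<omega>
  define Y2 where "Y2 \<omega> = g \<omega> * (\<phi>2 (z \<omega>) / 2 - e) * (\<eta> \<omega>)\<^sup>2" for \<omega>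
  define Y4 where "Y4 \<omega> = g \<omega> * K * (\<eta> \<omega>) ^ 4" for \<omega>
  have C: "0 \<le> C" using bd(2)[of 0] by linarith
  have Ym: "Y1 \<in> borel_measurable (F (ennreal u))" "Y2 \<in> borel_measurable (F (ennreal u))" "Y4 \<in> borel_measurable (F (ennreal u))"
  proof -
    note [measurable] = \<eta>(1) g(1) z
    show "Y1 \<in> borel_measurable (F (ennreal u))" "Y2 \<in> borel_measurable (F (ennreal u))" "Y4 \<in> borel_measurable (F (ennreal u))"
      unfolding Y1_def[abs_def] Y2_def[abs_def] Y4_def[abs_def] by measurable
  qed
  have E: "0 \<le> E" using \<eta>(2) not_empty by (metis abs_ge_zero all_not_in_conv order_trans)
  have \<eta>2: "(\<eta> \<omega>)\<^sup>2 \<le> E\<^sup>2" if "\<omega> \<in> space M" for \<omega>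
    using \<eta>(2)[OF that] by (simp add: abs_le_square_iff[symmetric] E)
  have \<eta>4: "(\<eta> \<omega>) ^ 4 \<le> E ^ 4" if "\<omega> \<in> space M" for \<omega>
    using power_mono[OF \<eta>2[OF that], of 2] by (simp add: power_mult[symmetric])
  have Yb: "\<bar>Y1 \<omega>\<bar> \<le> 1 * C * E" "\<bar>Y2 \<omega>\<bar> \<le> 1 * (C / 2 + e) * E\<^sup>2" "\<bar>Y4 \<omega>\<bar> \<le> 1 * K * E ^ 4"
    if w: "\<omega> \<in> space M" for \<omega>
  proof -
    show "\<bar>Y1 \<omega>\<bar> \<le> 1 * C * E" unfolding Y1_def abs_mult
      by (intro mult_mono bd \<eta>(2) w) (use g(2)[OF w] C E in auto)
    have "\<bar>\<phi>2 (z \<omega>) / 2 - e\<bar> \<le> C / 2 + e" using bd(3)[of "z \<omega>"] eK(1) by (auto simp: abs_le_iff)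
    then show "\<bar>Y2 \<omega>\<bar> \<le> 1 * (C / 2 + e) * E\<^sup>2" unfolding Y2_def abs_mult
      by (intro mult_mono) (use g(2)[OF w] \<eta>2[OF w] C E eK in auto)
    show "\<bar>Y4 \<omega>\<bar> \<le> 1 * K * E ^ 4" unfolding Y4_def abs_mult
      by (intro mult_mono) (use g(2)[OF w] \<eta>4[OF w] C E eK in \<open>auto simp: power_abs[symmetric]\<close>)
  qed
  note M1 = weighted_increment_moments(1,2)[OF uv Ym(1) Yb(1), folded b_def]
    and M2 = weighted_increment_moments(3,4)[OF uv Ym(2) Yb(2), folded b_def]
    and M4 = weighted_increment_moments(5,6)[OF uv Ym(3) Yb(3), folded b_def]
  define T where "T \<omega> = g \<omega> * (\<phi>1 (z \<omega>) * D \<omega> + \<phi>2 (z \<omega>) * (\<eta> \<omega>)\<^sup>2 * (v - u) / 2)" for \<omega>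
  define P where "P \<omega> = g \<omega> * \<phi>1 (z \<omega>) * D \<omega>" for \<omega>
  have iD: "integrable M (\<lambda>\<omega>. K * (D \<omega>)\<^sup>2)"
  proof (intro integrable_mult_right integrable_const_bound[where B = "n\<^sup>2"] AE_I2)
    fix \<omega> assume "\<omega> \<in> space M"
    from D(2)[OF this] show "norm ((D \<omega>)\<^sup>2) \<le> n\<^sup>2" by (simp add: abs_le_square_iff[symmetric])
  qed measurable
  have iP: "integrable M P"
  proof (intro integrable_const_bound[where B = "1 * C * n"] AE_I2)
    fix \<omega> assume "\<omega> \<in> space M"
    then show "norm (P \<omega>) \<le> 1 * C * n" unfolding P_def real_norm_def abs_mult
      by (intro mult_mono bd D) (use g(2) C in auto)
  qed (unfold P_def[abs_def], measurable)
  have iY2: "integrable M Y2"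
    by (rule integrable_const_bound[OF _ measurable_filtration[OF Ym(2)]]) (use Yb(2) in auto)
  have iL: "integrable M (\<lambda>\<omega>. g \<omega> * (\<phi> (z' \<omega>) - \<phi> (z \<omega>)))"
  proof (intro integrable_const_bound[where B = "1 * (C0 + C0)"] AE_I2)
    fix \<omega> assume w: "\<omega> \<in> space M"
    have "\<bar>\<phi> (z' \<omega>) - \<phi> (z \<omega>)\<bar> \<le> C0 + C0"
      using bd(1)[of "z' \<omega>"] bd(1)[of "z \<omega>"] by (auto simp: abs_le_iff)
    then show "norm (g \<omega> * (\<phi> (z' \<omega>) - \<phi> (z \<omega>))) \<le> 1 * (C0 + C0)" unfolding real_norm_def abs_mult
      using g(2)[OF w] by (intro mult_mono) auto
  next
    have "z' \<in> borel_measurable M"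
      by (rule measurable_cong[THEN iffD2, OF z']) (auto simp: b_def[symmetric])
    then show "(\<lambda>\<omega>. g \<omega> * (\<phi> (z' \<omega>) - \<phi> (z \<omega>))) \<in> borel_measurable M" by measurable
  qed
  have "(\<integral>\<omega>. P \<omega> + Y1 \<omega> * b \<omega> + Y2 \<omega> * (b \<omega>)\<^sup>2 - Y4 \<omega> * (b \<omega>) ^ 4 - K * (D \<omega>)\<^sup>2 \<partial>M)
      \<le> (\<integral>\<omega>. g \<omega> * (\<phi> (z' \<omega>) - \<phi> (z \<omega>)) \<partial>M)"
  proof (rule integral_mono[OF _ iL])
    show "integrable M (\<lambda>\<omega>. P \<omega> + Y1 \<omega> * b \<omega> + Y2 \<omega> * (b \<omega>)\<^sup>2 - Y4 \<omega> * (b \<omega>) ^ 4 - K * (D \<omega>)\<^sup>2)"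
      by (intro Bochner_Integration.integrable_diff Bochner_Integration.integrable_add iP M1 M2 M4 iD)
    fix \<omega> assume w: "\<omega> \<in> space M"
    have "g \<omega> * (\<phi>1 (z \<omega>) * (D \<omega> + \<eta> \<omega> * b \<omega>) + \<phi>2 (z \<omega>) * (\<eta> \<omega> * b \<omega>)\<^sup>2 / 2 - e * (\<eta> \<omega> * b \<omega>)\<^sup>2
          - K * (\<eta> \<omega> * b \<omega>) ^ 4 - K * (D \<omega>)\<^sup>2) \<le> g \<omega> * (\<phi> (z' \<omega>) - \<phi> (z \<omega>))"
      using taylor[OF D(2)[OF w], of "z \<omega>" "\<eta> \<omega> * b \<omega>"] z'[OF w] g(2)[OF w]
      by (intro mult_left_mono) (auto simp: b_def)
    moreover have "g \<omega> * (K * (D \<omega>)\<^sup>2) \<le> 1 * (K * (D \<omega>)\<^sup>2)"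
      using g(2)[OF w] eK by (intro mult_right_mono) auto
    moreover have "g \<omega> * (\<phi>1 (z \<omega>) * (D \<omega> + \<eta> \<omega> * b \<omega>) + \<phi>2 (z \<omega>) * (\<eta> \<omega> * b \<omega>)\<^sup>2 / 2 - e * (\<eta> \<omega> * b \<omega>)\<^sup>2
          - K * (\<eta> \<omega> * b \<omega>) ^ 4 - K * (D \<omega>)\<^sup>2)
        = P \<omega> + Y1 \<omega> * b \<omega> + Y2 \<omega> * (b \<omega>)\<^sup>2 - Y4 \<omega> * (b \<omega>) ^ 4 - g \<omega> * (K * (D \<omega>)\<^sup>2)"
      by (simp add: P_def Y1_def Y2_def Y4_def algebra_simps power_mult_distrib)
    ultimately show "P \<omega> + Y1 \<omega> * b \<omega> + Y2 \<omega> * (b \<omega>)\<^sup>2 - Y4 \<omega> * (b \<omega>) ^ 4 - K * (D \<omega>)\<^sup>2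
        \<le> g \<omega> * (\<phi> (z' \<omega>) - \<phi> (z \<omega>))" by linarith
  qed
  also have "(\<integral>\<omega>. P \<omega> + Y1 \<omega> * b \<omega> + Y2 \<omega> * (b \<omega>)\<^sup>2 - Y4 \<omega> * (b \<omega>) ^ 4 - K * (D \<omega>)\<^sup>2 \<partial>M)
      = (\<integral>\<omega>. P \<omega> \<partial>M) + (\<integral>\<omega>. Y2 \<omega> \<partial>M) * (v - u) - (\<integral>\<omega>. Y4 \<omega> \<partial>M) * (3 * (v - u)\<^sup>2) - K * (\<integral>\<omega>. (D \<omega>)\<^sup>2 \<partial>M)"
    using iP M1 M2 M4 iD by simp
  finally have main: "(\<integral>\<omega>. P \<omega> \<partial>M) + (\<integral>\<omega>. Y2 \<omega> \<partial>M) * (v - u) - (\<integral>\<omega>. Y4 \<omega> \<partial>M) * (3 * (v - u)\<^sup>2) - K * (\<integral>\<omega>. (D \<omega>)\<^sup>2 \<partial>M)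
      \<le> (\<integral>\<omega>. g \<omega> * (\<phi> (z' \<omega>) - \<phi> (z \<omega>)) \<partial>M)" .
  have "(\<integral>\<omega>. Y4 \<omega> \<partial>M) \<le> (\<integral>\<omega>. K * E ^ 4 \<partial>M)"
    using Yb(3) by (intro integral_mono integrable_const integrable_const_bound[OF _ measurable_filtration[OF Ym(3)], of "K * E ^ 4"]) (auto simp: abs_le_iff)
  then have 4: "(\<integral>\<omega>. Y4 \<omega> \<partial>M) * (3 * (v - u)\<^sup>2) \<le> K * E ^ 4 * (3 * (v - u)\<^sup>2)"
    by (intro mult_right_mono) (auto simp: prob_space)
  have 2: "(\<integral>\<omega>. T \<omega> \<partial>M) - e * E\<^sup>2 * (v - u) \<le> (\<integral>\<omega>. P \<omega> \<partial>M) + (\<integral>\<omega>. Y2 \<omega> \<partial>M) * (v - u)"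
  proof -
    have eq: "T \<omega> = P \<omega> + (Y2 \<omega> + e * g \<omega> * (\<eta> \<omega>)\<^sup>2) * (v - u)" for \<omega>
      by (simp add: T_def P_def Y2_def algebra_simps)
    have ile: "integrable M (\<lambda>\<omega>. e * g \<omega> * (\<eta> \<omega>)\<^sup>2)"
      and ble: "\<And>\<omega>. \<omega> \<in> space M \<Longrightarrow> e * g \<omega> * (\<eta> \<omega>)\<^sup>2 \<le> e * E\<^sup>2"
    proof -
      show b: "e * g \<omega> * (\<eta> \<omega>)\<^sup>2 \<le> e * E\<^sup>2" if w: "\<omega> \<in> space M" for \<omega>
        using mult_mono[OF mult_left_mono[of "g \<omega>" 1 e] \<eta>2[OF w]] g(2)[OF w] eK by auto
      show "integrable M (\<lambda>\<omega>. e * g \<omega> * (\<eta> \<omega>)\<^sup>2)"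
        by (rule integrable_const_bound[where B = "e * E\<^sup>2"]) (use b g(2) eK in auto)
    qed
    have "(\<integral>\<omega>. e * g \<omega> * (\<eta> \<omega>)\<^sup>2 \<partial>M) \<le> (\<integral>\<omega>. e * E\<^sup>2 \<partial>M)"
      by (intro integral_mono ile integrable_const ble)
    then have "(\<integral>\<omega>. e * g \<omega> * (\<eta> \<omega>)\<^sup>2 \<partial>M) * (v - u) \<le> e * E\<^sup>2 * (v - u)"
      using uv by (intro mult_right_mono) (auto simp: prob_space)
    moreover have "(\<integral>\<omega>. T \<omega> \<partial>M) = (\<integral>\<omega>. P \<omega> \<partial>M) + ((\<integral>\<omega>. Y2 \<omega> \<partial>M) + (\<integral>\<omega>. e * g \<omega> * (\<eta> \<omega>)\<^sup>2 \<partial>M)) * (v - u)"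
      unfolding eq[abs_def] using iP iY2 ile
      by (subst Bochner_Integration.integral_add) (auto simp del: integral_mult_left_zero integral_mult_right_zero)
    ultimately show ?thesis by (simp add: algebra_simps)
  qed
  show ?thesis using main 2 4 unfolding T_def by (simp add: algebra_simps)
qed

text \<open>Here \<open>Z\<close> is a drift plus the integral of a simple integrand, and the integrand of \<open>I\<close> is the
  generator of \<open>Z\<close> applied to \<open>\<phi>\<close>, switched off outside \<open>G s\<close>. Summing the one-step inequalities
  over a partition gives \<open>E (1_A I)\<close> up to an error; on the other side the increments of \<open>\<phi>(Z)\<close>
  telescope to a number that is at most \<open>S\<close> on \<open>A\<close>.\<close>

lemma ito_inequality_simple:
  fixes \<phi> \<phi>1 \<phi>2 :: "real \<Rightarrow> real" and \<beta> :: "real \<Rightarrow> 'a \<Rightarrow> real" and G :: "real \<Rightarrow> 'a set"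
  assumes si: "simple_integrand M F n p \<xi>"
    and ac: "0 \<le> a" "a < c"
    and A: "A \<in> sets (F (ennreal a))"
    and \<beta>i: "\<And>\<omega>. \<omega> \<in> space M \<Longrightarrow> set_integrable lborel {0..c} (\<lambda>s. \<beta> s \<omega>)"
    and \<beta>b: "\<And>\<omega>. \<omega> \<in> space M \<Longrightarrow> (LINT s:{0..c}|lborel. \<bar>\<beta> s \<omega>\<bar>) \<le> V"
    and \<beta>m: "\<And>t. 0 \<le> t \<Longrightarrow> t \<le> c \<Longrightarrow> (\<lambda>\<omega>. LINT s:{0..t}|lborel. \<beta> s \<omega>) \<in> borel_measurable (F (ennreal t))"
    and G: "\<And>t. 0 \<le> t \<Longrightarrow> t \<le> c \<Longrightarrow> G t \<in> sets (F (ennreal t))"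
    and Gdec: "\<And>r s. r \<le> s \<Longrightarrow> G s \<subseteq> G r"
    and Gleft: "\<And>s \<omega>. \<omega> \<in> space M \<Longrightarrow> 0 < s \<Longrightarrow> s \<le> c \<Longrightarrow> (\<And>r. 0 \<le> r \<Longrightarrow> r < s \<Longrightarrow> \<omega> \<in> G r) \<Longrightarrow> \<omega> \<in> G s"
    and d1: "\<And>x. (\<phi> has_real_derivative \<phi>1 x) (at x)"
    and d2: "\<And>x. (\<phi>1 has_real_derivative \<phi>2 x) (at x)"
    and uc: "uniformly_continuous_on UNIV \<phi>2"
    and bd: "\<And>x. \<bar>\<phi>1 x\<bar> \<le> C" "\<And>x. \<bar>\<phi>2 x\<bar> \<le> C"
    and S: "\<And>x y. \<phi> y - \<phi> x \<le> S"
  defines "Z s \<omega> \<equiv> (LINT r:{0..s}|lborel. \<beta> r \<omega>) + simple_integral B n p \<xi> s \<omega>"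
  defines "I \<omega> \<equiv> (LINT s:{a<..c}|lborel. indicator (G s) \<omega> *
      (\<phi>1 (Z s \<omega>) * \<beta> s \<omega> + \<phi>2 (Z s \<omega>) * (simple_process n p \<xi> s \<omega>)\<^sup>2 / 2))"
  shows "I \<in> borel_measurable M"
    and "(\<integral>\<omega>. indicator A \<omega> * I \<omega> \<partial>M) \<le> S * measure M A"
proof -
  define e where "e s \<omega> = simple_process n p \<xi> s \<omega>" for s \<omega>
  obtain E where E: "0 \<le> E" "\<And>\<omega> s. \<omega> \<in> space M \<Longrightarrow> \<bar>e s \<omega>\<bar> \<le> E"
    using simple_process_bounded[OF si] unfolding e_def by metis
  define b where "b \<omega> s = indicator {0..c} s * \<beta> s \<omega>" for \<omega> s
  have bi: "integrable lborel (b \<omega>)" if "\<omega> \<in> space M" for \<omega>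
    using \<beta>i[OF that] by (simp add: set_integrable_def b_def[abs_def])
  have bV: "(\<integral>s. \<bar>b \<omega> s\<bar> \<partial>lborel) \<le> V" if "\<omega> \<in> space M" for \<omega>
    using \<beta>b[OF that] by (simp add: set_lebesgue_integral_def b_def abs_mult)
  have b_eq: "(LINT s:T|lborel. b \<omega> s) = (LINT s:T|lborel. \<beta> s \<omega>)" if "T \<subseteq> {0..c}" for T \<omega>
    unfolding set_lebesgue_integral_def b_def using that
    by (intro Bochner_Integration.integral_cong) (auto split: split_indicator)
  have V: "0 \<le> V"
    using bV not_empty by (metis Bochner_Integration.integral_nonneg abs_ge_zero all_not_in_conv order_trans)
  have phi1c: "continuous_on UNIV \<phi>1" using d2 by (meson DERIV_continuous_on has_field_derivative_at_within)
  have phic: "continuous_on UNIV \<phi>" using d1 by (meson DERIV_continuous_on has_field_derivative_at_within)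
  have phi2c: "continuous_on UNIV \<phi>2" by (rule uniformly_continuous_imp_continuous[OF uc])
  have pm[measurable]: "\<phi> \<in> borel_measurable borel" "\<phi>1 \<in> borel_measurable borel" "\<phi>2 \<in> borel_measurable borel"
    using phi1c phic phi2c by (auto intro: borel_measurable_continuous_onI)
  have phib: "\<bar>\<phi> x\<bar> \<le> \<bar>\<phi> 0\<bar> + S" for x using S[of 0 x] S[of x 0] by linarith
  have C: "0 \<le> C" using bd(1)[of 0] by linarith
  have "\<exists>N t. grid a c N t \<and> (\<forall>j<N. t (Suc j) \<le> t j + 1 / real (Suc m)) \<and>
      (\<forall>j<N. p ` {..n} \<inter> {t j<..<t (Suc j)} = {})" for m
    by (rule aligned_grid_exists[of "p ` {..n}" a c "1 / real (Suc m)"]) (use ac in \<open>auto simp: grid_def\<close>)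
  then obtain N t where g: "\<And>m. grid a c (N m) (t m)"
    and mesh: "\<And>m j. j < N m \<Longrightarrow> t m (Suc j) \<le> t m j + 1 / real (Suc m)"
    and al: "\<And>m j. j < N m \<Longrightarrow> p ` {..n} \<inter> {t m j<..<t m (Suc j)} = {}" by metis
  have tr: "0 \<le> t m j" "a \<le> t m j" "t m j \<le> c" if "j \<le> N m" for m j
    using grid_range[OF g that] ac by auto
  have tl: "t m j < t m (Suc j)" if "j < N m" for m j using g[of m] that by (simp add: grid_def)
  have Zm: "Z s \<in> borel_measurable (F (ennreal s))" if "0 \<le> s" "s \<le> c" for s
    unfolding Z_def[abs_def] using \<beta>m[OF that] simple_integral_measurable[OF si that(1)] by auto
  have Zc: "continuous_on {0..c} (\<lambda>s. Z s \<omega>)" if w: "\<omega> \<in> space M" for \<omega>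
  proof -
    have "continuous_on {0..c} (\<lambda>s. LINT r:{0..s}|lborel. \<beta> r \<omega>)"
      using integrable_indefinite_continuous_on[OF bi[OF w], of c]
      by (rule continuous_on_cong[THEN iffD1, rotated 2]) (auto intro!: b_eq)
    moreover have "continuous_on {0..c} (\<lambda>s. simple_integral B n p \<xi> s \<omega>)"
      by (rule continuous_on_subset[OF simple_integral_continuous[OF si w]]) auto
    ultimately show ?thesis unfolding Z_def by (intro continuous_on_add)
  qed
  define D where "D m j \<omega> = (LINT s:{t m j<..t m (Suc j)}|lborel. b \<omega> s)" for m j \<omega>
  have D_eq: "D m j \<omega> = (LINT s:{0..t m (Suc j)}|lborel. \<beta> s \<omega>) - (LINT s:{0..t m j}|lborel. \<beta> s \<omega>)"
    if "\<omega> \<in> space M" "j < N m" for m j \<omega>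
    using indefinite_integral_increment[OF bi[OF that(1)], of "t m j" "t m (Suc j)"] tr[of j m] tr[of "Suc j" m] tl[OF that(2)] that(2)
    by (simp add: D_def b_eq)
  have Dm: "D m j \<in> borel_measurable M" if j: "j < N m" for m j
  proof (rule measurable_cong[THEN iffD2, OF D_eq])
    show "(\<lambda>\<omega>. (LINT s:{0..t m (Suc j)}|lborel. \<beta> s \<omega>) - (LINT s:{0..t m j}|lborel. \<beta> s \<omega>)) \<in> borel_measurable M"
      using measurable_filtration[OF \<beta>m[of "t m j"]] measurable_filtration[OF \<beta>m[of "t m (Suc j)"]] tr[of j m] tr[of "Suc j" m] j
      by auto
  qed (use j in auto)
  have Db: "\<bar>D m j \<omega>\<bar> \<le> V" if w: "\<omega> \<in> space M" and j: "j < N m" for m j \<omega>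
  proof -
    have "\<bar>D m j \<omega>\<bar> \<le> (\<integral>s. \<bar>indicator {t m j<..t m (Suc j)} s *\<^sub>R b \<omega> s\<bar> \<partial>lborel)"
      unfolding D_def set_lebesgue_integral_def by (rule integral_abs_bound)
    also have "\<dots> \<le> (\<integral>s. \<bar>b \<omega> s\<bar> \<partial>lborel)"
      using integrable_mult_indicator[OF _ bi[OF w], of "{t m j<..t m (Suc j)}"] bi[OF w]
      by (intro integral_mono) (auto split: split_indicator)
    finally show ?thesis using bV[OF w] by simp
  qed
  define R where "R m \<omega> = (\<Sum>j<N m. of_bool (\<omega> \<in> G (t m j)) *
      (\<phi>1 (Z (t m j) \<omega>) * D m j \<omega> + \<phi>2 (Z (t m j) \<omega>) * (e (t m (Suc j)) \<omega>)\<^sup>2 * (t m (Suc j) - t m j) / 2))" for m \<omega>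
  define Q where "Q m \<omega> = (\<Sum>j<N m. (D m j \<omega>)\<^sup>2)" for m \<omega>
  have I_eq: "I \<omega> = (LINT s:{a<..c}|lborel. of_bool (\<omega> \<in> G s) * (\<phi>1 (Z s \<omega>) * b \<omega> s + \<phi>2 (Z s \<omega>) * (e s \<omega>)\<^sup>2 / 2))" for \<omega>
    unfolding I_def set_lebesgue_integral_def e_def b_def
    by (intro Bochner_Integration.integral_cong) (use ac in \<open>auto split: split_indicator\<close>)
  have em: "(\<lambda>s. e s \<omega>) \<in> borel_measurable borel" for \<omega>
    unfolding e_def simple_process_def by measurable
  have lim: "(\<lambda>m. R m \<omega>) \<longlonglongrightarrow> I \<omega>" and Rb: "\<bar>R m \<omega>\<bar> \<le> C * V + C * E\<^sup>2 / 2 * (c - a)"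
    if w: "\<omega> \<in> space M" for \<omega> m
  proof -
    note rs = grid_riemann_sum_tendsto[OF ac g mesh bi[OF w] em[of \<omega>] E(2)[OF w] _ Zc[OF w], where G = "\<lambda>s. \<omega> \<in> G s", OF _ _ _ _ phi1c phi2c bd]
    have ec: "e s \<omega> = e (t m (Suc j)) \<omega>" if "j < N m" "t m j < s" "s \<le> t m (Suc j)" for m j s
      unfolding e_def by (rule simple_process_const_between[OF si that(2,3) al[OF that(1)]])
    show "(\<lambda>m. R m \<omega>) \<longlonglongrightarrow> I \<omega>"
      unfolding I_eq R_def D_def by (rule rs(1)) (use ec Gdec Gleft[OF w] in blast)+
    have "\<bar>R m \<omega>\<bar> \<le> C * (\<integral>s. \<bar>b \<omega> s\<bar> \<partial>lborel) + C * E\<^sup>2 / 2 * (c - a)"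
      unfolding R_def D_def by (rule rs(2)) (use ec Gdec Gleft[OF w] in blast)+
    also have "\<dots> \<le> C * V + C * E\<^sup>2 / 2 * (c - a)" using bV[OF w] C by (simp add: mult_left_mono)
    finally show "\<bar>R m \<omega>\<bar> \<le> C * V + C * E\<^sup>2 / 2 * (c - a)" .
  qed
  have Gm: "G (t m j) \<in> sets (F (ennreal (t m j)))" if "j \<le> N m" for m j using G tr that by blast
  have e_m: "e (t m (Suc j)) \<in> borel_measurable (F (ennreal (t m j)))" if "j < N m" for m j
    unfolding e_def[abs_def] using tr[of j m] tl[OF that] al[OF that] that
    by (intro simple_process_measurable_left[OF si]) auto
  have Rm[measurable]: "R m \<in> borel_measurable M" for m
    unfolding R_def[abs_def]
  proof (intro borel_measurable_sum)
    fix j assume "j \<in> {..<N m}"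
    then have j: "j < N m" by simp
    have [measurable]: "G (t m j) \<in> sets M" using Gm[of j m] j sets_filtration_subset by auto
    have [measurable]: "Z (t m j) \<in> borel_measurable M" "e (t m (Suc j)) \<in> borel_measurable M" "D m j \<in> borel_measurable M"
      using Zm[of "t m j"] tr[of j m] j e_m[OF j] Dm[OF j] measurable_filtration by auto
    show "(\<lambda>\<omega>. of_bool (\<omega> \<in> G (t m j)) * (\<phi>1 (Z (t m j) \<omega>) * D m j \<omega> + \<phi>2 (Z (t m j) \<omega>) * (e (t m (Suc j)) \<omega>)\<^sup>2 * (t m (Suc j) - t m j) / 2)) \<in> borel_measurable M"
      by measurable
  qed
  show Im[measurable]: "I \<in> borel_measurable M"
    by (rule borel_measurable_LIMSEQ_real[OF lim Rm])
  have Qm[measurable]: "Q m \<in> borel_measurable M" for m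
    unfolding Q_def[abs_def] using Dm by (intro borel_measurable_sum) auto
  have Aev[measurable]: "A \<in> sets M" using A sets_filtration_subset by auto
  have Qlim: "(\<lambda>m. Q m \<omega>) \<longlonglongrightarrow> 0" "0 \<le> Q m \<omega>" "Q m \<omega> \<le> V\<^sup>2" if w: "\<omega> \<in> space M" for \<omega> m
  proof -
    note q = grid_sum_squares_tendsto_0[OF ac(1) g mesh bi[OF w]]
    show "(\<lambda>m. Q m \<omega>) \<longlonglongrightarrow> 0" "0 \<le> Q m \<omega>" using q(1,2) by (simp_all add: Q_def D_def)
    have "Q m \<omega> \<le> (\<integral>s. \<bar>b \<omega> s\<bar> \<partial>lborel)\<^sup>2" using q(3) by (simp add: Q_def D_def)
    also have "\<dots> \<le> V\<^sup>2" using bV[OF w] by (intro power_mono) auto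
    finally show "Q m \<omega> \<le> V\<^sup>2" .
  qed
  have EQ: "(\<lambda>m. \<integral>\<omega>. Q m \<omega> \<partial>M) \<longlonglongrightarrow> (\<integral>\<omega>. 0 \<partial>M)"
    by (rule integral_dominated_convergence[where w = "\<lambda>_. V\<^sup>2"]) (use Qlim in auto)
  have ER: "(\<lambda>m. \<integral>\<omega>. indicator A \<omega> * R m \<omega> \<partial>M) \<longlonglongrightarrow> (\<integral>\<omega>. indicator A \<omega> * I \<omega> \<partial>M)"
  proof (rule integral_dominated_convergence[where w = "\<lambda>_. C * V + C * E\<^sup>2 / 2 * (c - a)"])
    show "AE \<omega> in M. (\<lambda>m. indicator A \<omega> * R m \<omega>) \<longlonglongrightarrow> indicator A \<omega> * I \<omega>"
      using lim by (intro AE_I2 tendsto_mult_left) auto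
    show "AE \<omega> in M. norm (indicator A \<omega> * R m \<omega>) \<le> C * V + C * E\<^sup>2 / 2 * (c - a)" for m
      using Rb[of _ m] V C ac by (intro AE_I2) (auto split: split_indicator)
  qed auto
  define L where "L = (\<integral>\<omega>. indicator A \<omega> * I \<omega> \<partial>M)"
  \<comment> \<open>The error of the quadratic term is proportional to \<open>\<epsilon>\<close>; the other errors vanish as the
    partition is refined.\<close>
  have step: "L \<le> S * measure M A + \<epsilon> * (E\<^sup>2 * (c - a))" if \<epsilon>: "0 < \<epsilon>" for \<epsilon>
  proof -
    obtain K where K: "0 \<le> K" "\<And>x D y. \<bar>D\<bar> \<le> V \<Longrightarrow>
      \<phi> x + \<phi>1 x * (D + y) + \<phi>2 x * y\<^sup>2 / 2 - \<epsilon> * y\<^sup>2 - K * y ^ 4 - K * D\<^sup>2 \<le> \<phi> (x + (D + y))"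
      using Taylor_second_order_lower_bound[OF d1 d2 uc bd(2) \<epsilon> V] by blast
    have bound: "(\<integral>\<omega>. indicator A \<omega> * R m \<omega> \<partial>M) \<le> S * measure M A + \<epsilon> * (E\<^sup>2 * (c - a))
        + 3 * K * E ^ 4 * (c - a) * (1 / real (Suc m)) + K * (\<integral>\<omega>. Q m \<omega> \<partial>M)" for m
    proof -
      define w where "w j \<omega> = (indicator (A \<inter> G (t m j)) \<omega> :: real)" for j \<omega>
      define T where "T j \<omega> = w j \<omega> * (\<phi>1 (Z (t m j) \<omega>) * D m j \<omega> + \<phi>2 (Z (t m j) \<omega>) * (e (t m (Suc j)) \<omega>)\<^sup>2 * (t m (Suc j) - t m j) / 2)" for j \<omega>
      define H where "H j \<omega> = w j \<omega> * (\<phi> (Z (t m (Suc j)) \<omega>) - \<phi> (Z (t m j) \<omega>))" for j \<omega>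
      have AG: "A \<inter> G (t m j) \<in> sets (F (ennreal (t m j)))" if "j \<le> N m" for j
        using Gm[OF that] A sets_filtration_mono[of "ennreal a" "ennreal (t m j)"] tr[OF that] by (auto simp: ennreal_leI)
      have wm: "w j \<in> borel_measurable (F (ennreal (t m j)))" if "j \<le> N m" for j
        unfolding w_def[abs_def] using AG[OF that] by simp
      have single: "(\<integral>\<omega>. T j \<omega> \<partial>M) - \<epsilon> * E\<^sup>2 * (t m (Suc j) - t m j) - 3 * K * E ^ 4 * (t m (Suc j) - t m j)\<^sup>2 - K * (\<integral>\<omega>. (D m j \<omega>)\<^sup>2 \<partial>M)
          \<le> (\<integral>\<omega>. H j \<omega> \<partial>M)" if j: "j < N m" for j
        unfolding T_def H_def
      proof (rule taylor_step_expectation)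
        show "0 \<le> t m j" "t m j < t m (Suc j)" using tr tl j by auto
        show "e (t m (Suc j)) \<in> borel_measurable (F (ennreal (t m j)))" by (rule e_m[OF j])
        show "w j \<in> borel_measurable (F (ennreal (t m j)))" using wm j by simp
        show "Z (t m j) \<in> borel_measurable (F (ennreal (t m j)))" using Zm tr j by simp
        show "D m j \<in> borel_measurable M" by (rule Dm[OF j])
        show "\<bar>D m j \<omega>\<bar> \<le> V" if "\<omega> \<in> space M" for \<omega> using Db[OF that j] .
        show "Z (t m (Suc j)) \<omega> = Z (t m j) \<omega> + (D m j \<omega> + e (t m (Suc j)) \<omega> * (B (t m (Suc j)) \<omega> - B (t m j) \<omega>))"
          if "\<omega> \<in> space M" for \<omega>
          using simple_integral_increment[OF si tl[OF j] al[OF j], of \<omega>] D_eq[OF that j] by (simp add: Z_def e_def)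
      qed (use E pm phib bd K \<epsilon> in \<open>auto simp: w_def\<close>)
      have iH: "integrable M (H j)" and iT: "integrable M (T j)" and iD: "integrable M (\<lambda>\<omega>. (D m j \<omega>)\<^sup>2)" if j: "j < N m" for j
      proof -
        have [measurable]: "w j \<in> borel_measurable M" using wm[of j] j measurable_filtration by auto
        have [measurable]: "Z (t m j) \<in> borel_measurable M" "Z (t m (Suc j)) \<in> borel_measurable M"
            "e (t m (Suc j)) \<in> borel_measurable M" "D m j \<in> borel_measurable M"
          using Zm[of "t m j"] Zm[of "t m (Suc j)"] tr[of j m] tr[of "Suc j" m] j e_m[OF j] Dm[OF j] measurable_filtration by auto
        show "integrable M (H j)"
        proof (intro integrable_const_bound[where B = "1 * (2 * (\<bar>\<phi> 0\<bar> + S))"] AE_I2)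
          fix \<omega> assume "\<omega> \<in> space M"
          have "\<bar>\<phi> (Z (t m (Suc j)) \<omega>) - \<phi> (Z (t m j) \<omega>)\<bar> \<le> 2 * (\<bar>\<phi> 0\<bar> + S)"
            using phib[of "Z (t m (Suc j)) \<omega>"] phib[of "Z (t m j) \<omega>"] by (auto simp: abs_le_iff)
          then show "norm (H j \<omega>) \<le> 1 * (2 * (\<bar>\<phi> 0\<bar> + S))"
            unfolding H_def real_norm_def abs_mult by (intro mult_mono) (auto simp: w_def)
        qed (unfold H_def[abs_def], measurable)
        show "integrable M (T j)"
        proof (intro integrable_const_bound[where B = "1 * (C * V + C * E\<^sup>2 * (t m (Suc j) - t m j) / 2)"] AE_I2)
          fix \<omega> assume om: "\<omega> \<in> space M"
          have "\<bar>\<phi>1 (Z (t m j) \<omega>) * D m j \<omega>\<bar> \<le> C * V"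
            unfolding abs_mult by (intro mult_mono bd Db[OF om j] C) auto
          moreover have "\<bar>\<phi>2 (Z (t m j) \<omega>) * (e (t m (Suc j)) \<omega>)\<^sup>2 * (t m (Suc j) - t m j)\<bar> \<le> C * E\<^sup>2 * (t m (Suc j) - t m j)"
            unfolding abs_mult using E(2)[OF om, of "t m (Suc j)"] tl[OF j] C E(1)
            by (intro mult_mono bd) (auto simp: abs_le_square_iff[symmetric])
          ultimately have "\<bar>\<phi>1 (Z (t m j) \<omega>) * D m j \<omega> + \<phi>2 (Z (t m j) \<omega>) * (e (t m (Suc j)) \<omega>)\<^sup>2 * (t m (Suc j) - t m j) / 2\<bar>
              \<le> C * V + C * E\<^sup>2 * (t m (Suc j) - t m j) / 2" by linarith
          then show "norm (T j \<omega>) \<le> 1 * (C * V + C * E\<^sup>2 * (t m (Suc j) - t m j) / 2)"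
            unfolding T_def real_norm_def abs_mult[of "w j \<omega>"] by (intro mult_mono) (auto simp: w_def)
        qed (unfold T_def[abs_def], measurable)
        show "integrable M (\<lambda>\<omega>. (D m j \<omega>)\<^sup>2)"
        proof (intro integrable_const_bound[where B = "V\<^sup>2"] AE_I2)
          fix \<omega> assume om: "\<omega> \<in> space M"
          show "norm ((D m j \<omega>)\<^sup>2) \<le> V\<^sup>2" using Db[OF om j] by (simp add: abs_le_square_iff[symmetric])
        qed measurable
      qed
      have upper: "(\<integral>\<omega>. (\<Sum>j<N m. H j \<omega>) \<partial>M) \<le> S * measure M A"
      proof -
        have "(\<Sum>j<N m. H j \<omega>) \<le> S * indicator A \<omega>" for \<omega>
        proof (cases "\<omega> \<in> A")
          case True
          have "(\<Sum>j<N m. of_bool (\<omega> \<in> G (t m j)) * (\<phi> (Z (t m (Suc j)) \<omega>) - \<phi> (Z (t m j) \<omega>))) \<le> S"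
            by (rule antimono_weighted_telescope_le[where x = "\<lambda>j. \<phi> (Z (t m j) \<omega>)"])
               (use S subsetD[OF Gdec[OF less_imp_le[OF tl]]] in auto)
          then show ?thesis using True by (simp add: H_def w_def indicator_def of_bool_def if_distrib cong: if_cong)
        next
          case False
          then show ?thesis by (simp add: H_def w_def)
        qed
        then have "(\<integral>\<omega>. (\<Sum>j<N m. H j \<omega>) \<partial>M) \<le> (\<integral>\<omega>. S * indicator A \<omega> \<partial>M)"
          by (intro integral_mono) (auto intro!: Bochner_Integration.integrable_sum iH integrable_mult_right integrable_real_indicator simp: emeasure_eq_measure)
        then show ?thesis by simp
      qed
      have sq: "(t m (Suc j) - t m j)\<^sup>2 \<le> 1 / real (Suc m) * (t m (Suc j) - t m j)" if "j < N m" for j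
        unfolding power2_eq_square using mesh[OF that] tl[OF that] by (intro mult_right_mono) auto
      have "(\<integral>\<omega>. indicator A \<omega> * R m \<omega> \<partial>M) = (\<integral>\<omega>. (\<Sum>j<N m. T j \<omega>) \<partial>M)"
        by (intro Bochner_Integration.integral_cong refl)
           (auto simp: R_def T_def w_def sum_distrib_left indicator_def intro!: sum.cong)
      also have "\<dots> = (\<Sum>j<N m. \<integral>\<omega>. T j \<omega> \<partial>M)" using iT by (intro Bochner_Integration.integral_sum) auto
      also have "\<dots> \<le> (\<Sum>j<N m. (\<integral>\<omega>. H j \<omega> \<partial>M) + \<epsilon> * E\<^sup>2 * (t m (Suc j) - t m j)
          + 3 * K * E ^ 4 * (1 / real (Suc m) * (t m (Suc j) - t m j)) + K * (\<integral>\<omega>. (D m j \<omega>)\<^sup>2 \<partial>M))"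
      proof (rule sum_mono)
        fix j assume "j \<in> {..<N m}"
        then have j: "j < N m" by simp
        have "3 * K * E ^ 4 * (t m (Suc j) - t m j)\<^sup>2 \<le> 3 * K * E ^ 4 * (1 / real (Suc m) * (t m (Suc j) - t m j))"
          using sq[OF j] K(1) E(1) by (intro mult_left_mono) auto
        then show "(\<integral>\<omega>. T j \<omega> \<partial>M) \<le> (\<integral>\<omega>. H j \<omega> \<partial>M) + \<epsilon> * E\<^sup>2 * (t m (Suc j) - t m j)
          + 3 * K * E ^ 4 * (1 / real (Suc m) * (t m (Suc j) - t m j)) + K * (\<integral>\<omega>. (D m j \<omega>)\<^sup>2 \<partial>M)"
          using single[OF j] by linarith
      qed
      also have "\<dots> = (\<integral>\<omega>. (\<Sum>j<N m. H j \<omega>) \<partial>M) + \<epsilon> * E\<^sup>2 * (\<Sum>j<N m. t m (Suc j) - t m j)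
          + 3 * K * E ^ 4 * (1 / real (Suc m) * (\<Sum>j<N m. t m (Suc j) - t m j)) + K * (\<integral>\<omega>. Q m \<omega> \<partial>M)"
      proof -
        have "(\<integral>\<omega>. (\<Sum>j<N m. H j \<omega>) \<partial>M) = (\<Sum>j<N m. \<integral>\<omega>. H j \<omega> \<partial>M)"
          using iH by (intro Bochner_Integration.integral_sum) auto
        moreover have "(\<integral>\<omega>. Q m \<omega> \<partial>M) = (\<Sum>j<N m. \<integral>\<omega>. (D m j \<omega>)\<^sup>2 \<partial>M)"
          unfolding Q_def using iD by (intro Bochner_Integration.integral_sum) auto
        ultimately show ?thesis by (simp only: sum.distrib sum_distrib_left)
      qed
      also have "\<dots> \<le> S * measure M A + \<epsilon> * (E\<^sup>2 * (c - a))
        + 3 * K * E ^ 4 * (c - a) * (1 / real (Suc m)) + K * (\<integral>\<omega>. Q m \<omega> \<partial>M)"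
        using upper unfolding grid_sum_lengths[OF g] by (simp add: mult.assoc mult.commute)
      finally show ?thesis .
    qed
    have "(\<lambda>m. S * measure M A + \<epsilon> * (E\<^sup>2 * (c - a)) + 3 * K * E ^ 4 * (c - a) * (1 / real (Suc m)) + K * (\<integral>\<omega>. Q m \<omega> \<partial>M))
        \<longlonglongrightarrow> S * measure M A + \<epsilon> * (E\<^sup>2 * (c - a)) + 3 * K * E ^ 4 * (c - a) * 0 + K * (\<integral>\<omega>. 0 \<partial>M)"
      using LIMSEQ_inverse_real_of_nat by (intro tendsto_intros EQ) (auto simp: inverse_eq_divide)
    then have "L \<le> S * measure M A + \<epsilon> * (E\<^sup>2 * (c - a)) + 3 * K * E ^ 4 * (c - a) * 0 + K * (\<integral>\<omega>. 0 \<partial>M)"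
      unfolding L_def using bound by (intro LIMSEQ_le[OF ER]) auto
    then show ?thesis by simp
  qed
  have "L \<le> S * measure M A + \<delta>" if \<delta>: "0 < \<delta>" for \<delta>
  proof -
    have p: "0 < E\<^sup>2 * (c - a) + 1" using ac by (simp add: add_nonneg_pos)
    have "\<delta> / (E\<^sup>2 * (c - a) + 1) * (E\<^sup>2 * (c - a)) \<le> \<delta>"
      using p \<delta> by (simp add: field_simps)
    then show ?thesis using step[of "\<delta> / (E\<^sup>2 * (c - a) + 1)"] p \<delta> by simp
  qed
  then have "L \<le> S * measure M A" by (rule field_le_epsilon)
  then show "(\<integral>\<omega>. indicator A \<omega> * I \<omega> \<partial>M) \<le> S * measure M A" by (simp add: L_def)
qed

end

section \<open>Passing from simple integrands to the diffusion\<close>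

text \<open>For a fixed path, \<open>M\<close> stands for Lebesgue measure on the time interval. The squares \<open>(e k s)\<^sup>2\<close>
  have no integrable bound that is uniform in \<open>k\<close>, so dominated convergence applies only after
  replacing them by \<open>(H s)\<^sup>2\<close>; the difference is controlled by the convergence of \<open>e k\<close> to \<open>H\<close>
  in mean square.\<close>

lemma (in finite_measure) perturbed_integral_tendsto:
  fixes \<beta> H x :: "'a \<Rightarrow> real" and z e :: "nat \<Rightarrow> 'a \<Rightarrow> real" and \<phi>1 \<phi>2 :: "real \<Rightarrow> real"
  assumes \<beta>: "integrable M \<beta>"
    and P[measurable]: "Measurable.pred M P"
    and z[measurable]: "\<And>k. z k \<in> borel_measurable M"
    and e[measurable]: "\<And>k. e k \<in> borel_measurable M"
    and H[measurable]: "H \<in> borel_measurable M"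
    and c1: "continuous_on UNIV \<phi>1" and c2: "continuous_on UNIV \<phi>2"
    and b1: "\<And>u. \<bar>\<phi>1 u\<bar> \<le> C" and b2: "\<And>u. \<bar>\<phi>2 u\<bar> \<le> C"
    and HP: "AE s in M. P s \<longrightarrow> \<bar>H s\<bar> \<le> \<Sigma>"
    and one: "AE s in M. P s \<longrightarrow> \<phi>1 (x s) * \<beta> s + \<phi>2 (x s) * (H s)\<^sup>2 / 2 = 1"
    and zx: "AE s in M. P s \<longrightarrow> (\<lambda>k. z k s) \<longlonglongrightarrow> x s"
    and q: "(\<lambda>k. \<integral>\<^sup>+s. ennreal ((e k s - H s)\<^sup>2) \<partial>M) \<longlonglongrightarrow> 0"
    and Q: "\<forall>\<^sub>F k in sequentially. \<forall>s\<in>space M. Q k s"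
  shows "(\<lambda>k. \<integral>s. of_bool (P s \<and> Q k s) * (\<phi>1 (z k s) * \<beta> s + \<phi>2 (z k s) * (e k s)\<^sup>2 / 2) \<partial>M)
      \<longlonglongrightarrow> (\<integral>s. of_bool (P s) \<partial>M)"
proof -
  have [measurable]: "\<phi>1 \<in> borel_measurable borel" "\<phi>2 \<in> borel_measurable borel"
    using c1 c2 by (auto intro: borel_measurable_continuous_onI)
  have [measurable]: "\<beta> \<in> borel_measurable M" using \<beta> by simp
  have C: "0 \<le> C" using b1[of 0] by linarith
  define h where "h s = of_bool (P s) * H s" for s
  have [measurable]: "h \<in> borel_measurable M" unfolding h_def[abs_def] by measurable
  have hS: "AE s in M. (h s)\<^sup>2 \<le> \<Sigma>\<^sup>2"
    using HP
  proof eventually_elim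
    case (elim s)
    then show ?case using power_mono[of "\<bar>H s\<bar>" \<Sigma> 2] by (cases "P s") (auto simp: h_def)
  qed
  define qr where "qr k = enn2real (\<integral>\<^sup>+s. ennreal ((e k s - H s)\<^sup>2) \<partial>M)" for k
  have fin: "\<forall>\<^sub>F k in sequentially. (\<integral>\<^sup>+s. ennreal ((e k s - H s)\<^sup>2) \<partial>M) < \<infinity>"
    using order_tendstoD(2)[OF q, of 1] by (auto elim!: eventually_mono intro: order.strict_trans)
  have qr0: "qr \<longlonglongrightarrow> 0"
    using tendsto_enn2real[OF q[folded ennreal_0]] by (simp add: qr_def[abs_def])
  define p where "p k s = of_bool (P s) * (\<phi>1 (z k s) * \<beta> s + \<phi>2 (z k s) * (h s)\<^sup>2 / 2)" for k s
  define r where "r k s = of_bool (P s) * (\<phi>2 (z k s) * ((e k s)\<^sup>2 - (h s)\<^sup>2) / 2)" for k s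
  have [measurable]: "p k \<in> borel_measurable M" "r k \<in> borel_measurable M" for k
    unfolding p_def[abs_def] r_def[abs_def] by measurable
  define w where "w s = C * \<bar>\<beta> s\<bar> + C * \<Sigma>\<^sup>2 / 2" for s
  have wi: "integrable M w" unfolding w_def[abs_def] using \<beta> by auto
  have pw: "AE s in M. norm (p k s) \<le> w s" for k
    using hS
  proof eventually_elim
    case (elim s)
    have "\<bar>\<phi>1 (z k s) * \<beta> s\<bar> \<le> C * \<bar>\<beta> s\<bar>" unfolding abs_mult by (intro mult_right_mono b1) auto
    moreover have "\<bar>\<phi>2 (z k s) * (h s)\<^sup>2\<bar> \<le> C * \<Sigma>\<^sup>2"
      unfolding abs_mult using elim by (intro mult_mono b2 C) auto
    moreover have "0 \<le> w s" using C by (simp add: w_def)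
    ultimately show ?case unfolding p_def w_def by (cases "P s") auto
  qed
  have pl: "AE s in M. (\<lambda>k. p k s) \<longlonglongrightarrow> of_bool (P s)"
    using one zx
  proof eventually_elim
    case (elim s)
    show ?case
    proof (cases "P s")
      case True
      then have l: "(\<lambda>k. z k s) \<longlonglongrightarrow> x s" using elim by simp
      have "(\<lambda>k. \<phi>1 (z k s)) \<longlonglongrightarrow> \<phi>1 (x s)" "(\<lambda>k. \<phi>2 (z k s)) \<longlonglongrightarrow> \<phi>2 (x s)"
        using continuous_on_tendsto_compose[OF c1 l] continuous_on_tendsto_compose[OF c2 l] by auto
      then have "(\<lambda>k. \<phi>1 (z k s) * \<beta> s + \<phi>2 (z k s) * (H s)\<^sup>2 / 2) \<longlonglongrightarrow> \<phi>1 (x s) * \<beta> s + \<phi>2 (x s) * (H s)\<^sup>2 / 2"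
        by (intro tendsto_intros) auto
      then show ?thesis using True elim by (simp add: p_def h_def)
    qed (simp add: p_def)
  qed
  have pint: "integrable M (p k)" for k
    by (rule Bochner_Integration.integrable_bound[OF wi]) (use pw[of k] in \<open>auto elim!: eventually_mono\<close>)
  have plim: "(\<lambda>k. \<integral>s. p k s \<partial>M) \<longlonglongrightarrow> (\<integral>s. of_bool (P s) \<partial>M)"
    by (rule integral_dominated_convergence[OF _ _ wi pl pw]) auto
  \<comment> \<open>Young's inequality; the parameter \<open>\<eta>\<close> is sent to \<open>0\<close> after \<open>k\<close> has been sent to infinity.\<close>
  have sq: "\<bar>u\<^sup>2 - v\<^sup>2\<bar> \<le> (1 + 1 / \<eta>) * (u - v)\<^sup>2 + \<eta> * v\<^sup>2" if "0 < \<eta>" for u v \<eta> :: real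
  proof -
    have "0 \<le> (\<bar>u - v\<bar> / sqrt \<eta> - sqrt \<eta> * \<bar>v\<bar>)\<^sup>2" by simp
    also have "\<dots> = (u - v)\<^sup>2 / \<eta> + \<eta> * v\<^sup>2 - 2 * (\<bar>u - v\<bar> * \<bar>v\<bar>)"
      using that by (simp add: power2_diff power_divide power_mult_distrib)
    finally have 1: "2 * (\<bar>u - v\<bar> * \<bar>v\<bar>) \<le> (u - v)\<^sup>2 / \<eta> + \<eta> * v\<^sup>2" by simp
    have "u\<^sup>2 - v\<^sup>2 = (u - v)\<^sup>2 + 2 * ((u - v) * v)" by (simp add: power2_eq_square algebra_simps)
    then have "\<bar>u\<^sup>2 - v\<^sup>2\<bar> \<le> (u - v)\<^sup>2 + 2 * (\<bar>u - v\<bar> * \<bar>v\<bar>)"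
      using abs_triangle_ineq[of "(u - v)\<^sup>2" "2 * ((u - v) * v)"] by (simp add: abs_mult)
    then show ?thesis using 1 by (simp add: algebra_simps)
  qed
  have sqi: "integrable M (\<lambda>s. (e k s - H s)\<^sup>2)" if "(\<integral>\<^sup>+s. ennreal ((e k s - H s)\<^sup>2) \<partial>M) < \<infinity>" for k
    using that by (intro integrableI_bounded) auto
  have rb: "AE s in M. norm (r k s) \<le> C / 2 * ((1 + 1 / \<eta>) * (e k s - H s)\<^sup>2 + \<eta> * \<Sigma>\<^sup>2)" if \<eta>: "0 < \<eta>" for k \<eta>
    using hS
  proof eventually_elim
    case (elim s)
    show ?case
    proof (cases "P s")
      case True
      then have hH: "h s = H s" by (simp add: h_def)
      have "\<bar>(e k s)\<^sup>2 - (h s)\<^sup>2\<bar> \<le> (1 + 1 / \<eta>) * (e k s - H s)\<^sup>2 + \<eta> * \<Sigma>\<^sup>2"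
        using sq[OF \<eta>, of "e k s" "h s"] mult_left_mono[OF elim, of \<eta>] \<eta> unfolding hH by linarith
      then have "\<bar>\<phi>2 (z k s)\<bar> * \<bar>(e k s)\<^sup>2 - (h s)\<^sup>2\<bar> \<le> C * ((1 + 1 / \<eta>) * (e k s - H s)\<^sup>2 + \<eta> * \<Sigma>\<^sup>2)"
        by (intro mult_mono b2 C) auto
      then show ?thesis using True by (simp add: r_def abs_mult)
    qed (use C \<eta> in \<open>simp add: r_def\<close>)
  qed
  have ri: "integrable M (r k)" and rI: "\<And>\<eta>. 0 < \<eta> \<Longrightarrow> \<bar>\<integral>s. r k s \<partial>M\<bar> \<le> C / 2 * ((1 + 1 / \<eta>) * qr k + \<eta> * \<Sigma>\<^sup>2 * measure M (space M))"
    if f: "(\<integral>\<^sup>+s. ennreal ((e k s - H s)\<^sup>2) \<partial>M) < \<infinity>" for k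
  proof -
    have bi: "integrable M (\<lambda>s. C / 2 * ((1 + 1 / \<eta>) * (e k s - H s)\<^sup>2 + \<eta> * \<Sigma>\<^sup>2))" for \<eta>
      using sqi[OF f] by auto
    show "integrable M (r k)"
      by (rule Bochner_Integration.integrable_bound[OF bi[of 1]])
         (use rb[of 1 k] in \<open>auto elim!: eventually_mono intro: order_trans[OF _ abs_ge_self]\<close>)
    fix \<eta> :: real assume \<eta>: "0 < \<eta>"
    have "\<bar>\<integral>s. r k s \<partial>M\<bar> \<le> (\<integral>s. C / 2 * ((1 + 1 / \<eta>) * (e k s - H s)\<^sup>2 + \<eta> * \<Sigma>\<^sup>2) \<partial>M)"
      by (rule order_trans[OF integral_abs_bound integral_mono_AE[OF integrable_abs[OF \<open>integrable M (r k)\<close>] bi]])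
         (use rb[OF \<eta>, of k] in simp)
    also have "\<dots> = C / 2 * ((1 + 1 / \<eta>) * (\<integral>s. (e k s - H s)\<^sup>2 \<partial>M) + \<eta> * \<Sigma>\<^sup>2 * measure M (space M))"
      using sqi[OF f] by simp
    also have "(\<integral>s. (e k s - H s)\<^sup>2 \<partial>M) = qr k"
      unfolding qr_def by (rule integral_eq_nn_integral) auto
    finally show "\<bar>\<integral>s. r k s \<partial>M\<bar> \<le> C / 2 * ((1 + 1 / \<eta>) * qr k + \<eta> * \<Sigma>\<^sup>2 * measure M (space M))" .
  qed
  have rlim: "(\<lambda>k. \<integral>s. r k s \<partial>M) \<longlonglongrightarrow> 0"
  proof (rule tendstoI)
    fix \<epsilon> :: real assume \<epsilon>: "0 < \<epsilon>"
    define m where "m = C / 2 * (\<Sigma>\<^sup>2 * measure M (space M))"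
    have m: "0 \<le> m" using C by (simp add: m_def)
    define \<eta> where "\<eta> = \<epsilon> / 2 / (m + 1)"
    have \<eta>: "0 < \<eta>" using \<epsilon> m by (simp add: \<eta>_def)
    have "\<eta> * m \<le> \<eta> * (m + 1)" using \<eta> by simp
    also have "\<dots> = \<epsilon> / 2"
    proof -
      have "m + 1 \<noteq> 0" using m by linarith
      then show ?thesis unfolding \<eta>_def by (rule nonzero_eq_divide_eq[THEN iffD1, OF _ refl])
    qed
    finally have \<eta>m: "\<eta> * m \<le> \<epsilon> / 2" .
    have "(\<lambda>k. C / 2 * ((1 + 1 / \<eta>) * qr k)) \<longlonglongrightarrow> C / 2 * ((1 + 1 / \<eta>) * 0)"
      by (intro tendsto_intros qr0)
    then have "\<forall>\<^sub>F k in sequentially. C / 2 * ((1 + 1 / \<eta>) * qr k) < \<epsilon> / 2"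
      by (rule order_tendstoD(2)) (use \<epsilon> in auto)
    then show "\<forall>\<^sub>F k in sequentially. dist (\<integral>s. r k s \<partial>M) 0 < \<epsilon>"
      using fin
    proof eventually_elim
      case (elim k)
      show ?case using rI[OF elim(2) \<eta>] elim(1) \<eta>m by (simp add: m_def algebra_simps)
    qed
  qed
  have "(\<lambda>k. (\<integral>s. p k s \<partial>M) + (\<integral>s. r k s \<partial>M)) \<longlonglongrightarrow> (\<integral>s. of_bool (P s) \<partial>M) + 0"
    by (intro tendsto_add plim rlim)
  moreover have "\<forall>\<^sub>F k in sequentially. (\<integral>s. p k s \<partial>M) + (\<integral>s. r k s \<partial>M) =
      (\<integral>s. of_bool (P s \<and> Q k s) * (\<phi>1 (z k s) * \<beta> s + \<phi>2 (z k s) * (e k s)\<^sup>2 / 2) \<partial>M)"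
    using fin Q
  proof eventually_elim
    case (elim k)
    have "(\<integral>s. p k s \<partial>M) + (\<integral>s. r k s \<partial>M) = (\<integral>s. p k s + r k s \<partial>M)"
      by (rule Bochner_Integration.integral_add[OF pint ri[OF elim(1)], symmetric])
    also have "\<dots> = (\<integral>s. of_bool (P s \<and> Q k s) * (\<phi>1 (z k s) * \<beta> s + \<phi>2 (z k s) * (e k s)\<^sup>2 / 2) \<partial>M)"
      by (intro Bochner_Integration.integral_cong refl)
         (use elim(2) in \<open>auto simp: p_def r_def algebra_simps add_divide_distrib diff_divide_distrib\<close>)
    finally show ?case .
  qed
  ultimately show ?thesis by (simp add: Lim_transform_eventually)
qed

text \<open>The uniform bound that dominates the preceding integrals as random variables:
  \<open>e\<^sup>2 \<le> 2 (e - H)\<^sup>2 + 2 H\<^sup>2\<close>, and both parts are bounded where \<open>G\<close> holds.\<close>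

lemma (in finite_measure) perturbed_integral_bound:
  fixes \<beta> H :: "'a \<Rightarrow> real" and z e :: "'a \<Rightarrow> real" and \<phi>1 \<phi>2 :: "real \<Rightarrow> real"
  assumes \<beta>: "integrable M \<beta>" "(\<integral>s. \<bar>\<beta> s\<bar> \<partial>M) \<le> V"
    and G[measurable]: "Measurable.pred M G"
    and e[measurable]: "e \<in> borel_measurable M"
    and H[measurable]: "H \<in> borel_measurable M"
    and b1: "\<And>u. \<bar>\<phi>1 u\<bar> \<le> C" and b2: "\<And>u. \<bar>\<phi>2 u\<bar> \<le> C"
    and HG: "AE s in M. G s \<longrightarrow> \<bar>H s\<bar> \<le> \<Sigma>"
    and q: "(\<integral>\<^sup>+s. ennreal ((e s - H s)\<^sup>2) * indicator {s. G s} s \<partial>M) \<le> 1"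
  shows "\<bar>\<integral>s. of_bool (G s) * (\<phi>1 (z s) * \<beta> s + \<phi>2 (z s) * (e s)\<^sup>2 / 2) \<partial>M\<bar>
     \<le> C * V + C + C * \<Sigma>\<^sup>2 * measure M (space M)"
proof -
  let ?f = "\<lambda>s. of_bool (G s) * (\<phi>1 (z s) * \<beta> s + \<phi>2 (z s) * (e s)\<^sup>2 / 2)"
  have C: "0 \<le> C" using b1[of 0] by linarith
  have V: "0 \<le> V" using \<beta>(2) by (meson Bochner_Integration.integral_nonneg abs_ge_zero order_trans)
  have [measurable]: "\<beta> \<in> borel_measurable M" using \<beta> by simp
  have nonneg: "0 \<le> C * V + C + C * \<Sigma>\<^sup>2 * measure M (space M)" using C V by simp
  show ?thesis
  proof (cases "integrable M ?f")
    case False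
    then show ?thesis using nonneg by (simp add: not_integrable_integral_eq)
  next
    case True
    have "ennreal \<bar>\<integral>s. ?f s \<partial>M\<bar> \<le> (\<integral>\<^sup>+s. norm (?f s) \<partial>M)"
      using integral_norm_bound_ennreal[OF True] by simp
    also have "\<dots> \<le> (\<integral>\<^sup>+s. ennreal (C * \<bar>\<beta> s\<bar>) + (ennreal C * (ennreal ((e s - H s)\<^sup>2) * indicator {s. G s} s) + ennreal (C * \<Sigma>\<^sup>2)) \<partial>M)"
    proof (rule nn_integral_mono_AE)
      show "AE s in M. ennreal (norm (?f s)) \<le> ennreal (C * \<bar>\<beta> s\<bar>) + (ennreal C * (ennreal ((e s - H s)\<^sup>2) * indicator {s. G s} s) + ennreal (C * \<Sigma>\<^sup>2))"
        using HG
      proof eventually_elim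
        case (elim s)
        show ?case
        proof (cases "G s")
          case True
          have 1: "\<bar>\<phi>1 (z s) * \<beta> s\<bar> \<le> C * \<bar>\<beta> s\<bar>" unfolding abs_mult by (intro mult_right_mono b1) auto
          have "(e s)\<^sup>2 \<le> 2 * (e s - H s)\<^sup>2 + 2 * (H s)\<^sup>2"
            using sum_squares_ge_zero[of "e s - 2 * H s" 0] by (simp add: power2_eq_square algebra_simps)
          moreover have "(H s)\<^sup>2 \<le> \<Sigma>\<^sup>2" using power_mono[of "\<bar>H s\<bar>" \<Sigma> 2] elim True by simp
          ultimately have "(e s)\<^sup>2 \<le> 2 * (e s - H s)\<^sup>2 + 2 * \<Sigma>\<^sup>2" by linarith
          then have "\<bar>\<phi>2 (z s)\<bar> * (e s)\<^sup>2 \<le> C * (2 * (e s - H s)\<^sup>2 + 2 * \<Sigma>\<^sup>2)"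
            by (intro mult_mono b2 C) auto
          then have 2: "\<bar>\<phi>2 (z s) * (e s)\<^sup>2 / 2\<bar> \<le> C * (e s - H s)\<^sup>2 + C * \<Sigma>\<^sup>2"
            by (simp add: abs_mult algebra_simps)
          have "norm (?f s) \<le> C * \<bar>\<beta> s\<bar> + (C * (e s - H s)\<^sup>2 + C * \<Sigma>\<^sup>2)"
            using 1 2 True abs_triangle_ineq[of "\<phi>1 (z s) * \<beta> s" "\<phi>2 (z s) * (e s)\<^sup>2 / 2"] by simp
          then have "ennreal (norm (?f s)) \<le> ennreal (C * \<bar>\<beta> s\<bar> + (C * (e s - H s)\<^sup>2 + C * \<Sigma>\<^sup>2))" by (rule ennreal_leI)
          then show ?thesis using True C by (simp add: ennreal_mult)
        qed simp
      qed
    qed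
    also have "\<dots> = (\<integral>\<^sup>+s. ennreal (C * \<bar>\<beta> s\<bar>) \<partial>M) + (ennreal C * (\<integral>\<^sup>+s. ennreal ((e s - H s)\<^sup>2) * indicator {s. G s} s \<partial>M) + ennreal (C * \<Sigma>\<^sup>2) * emeasure M (space M))"
      by (simp add: nn_integral_add nn_integral_cmult)
    also have "(\<integral>\<^sup>+s. ennreal (C * \<bar>\<beta> s\<bar>) \<partial>M) = ennreal (C * (\<integral>s. \<bar>\<beta> s\<bar> \<partial>M))"
      using \<beta>(1) C by (subst nn_integral_eq_integral) auto
    also have "ennreal (C * (\<integral>s. \<bar>\<beta> s\<bar> \<partial>M)) + (ennreal C * (\<integral>\<^sup>+s. ennreal ((e s - H s)\<^sup>2) * indicator {s. G s} s \<partial>M) + ennreal (C * \<Sigma>\<^sup>2) * emeasure M (space M))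
       \<le> ennreal (C * V) + (ennreal C * 1 + ennreal (C * \<Sigma>\<^sup>2) * emeasure M (space M))"
      using \<beta>(2) C q by (intro add_mono mult_left_mono ennreal_leI) auto
    also have "\<dots> = ennreal (C * V + C + C * \<Sigma>\<^sup>2 * measure M (space M))"
      using C V by (simp add: emeasure_eq_measure ennreal_mult ennreal_plus add.assoc)
    finally show ?thesis using nonneg by (simp add: ennreal_le_iff)
  qed
qed

lemma (in prob_space) tendsto_zero_in_prob_expectation:
  fixes Y :: "nat \<Rightarrow> 'a \<Rightarrow> ennreal"
  assumes Y[measurable]: "\<And>k. Y k \<in> borel_measurable M" and lim: "tendsto_zero_in_prob M Y"
  shows "(\<lambda>k. \<integral>\<omega>. enn2real (min 1 (Y k \<omega>)) \<partial>M) \<longlonglongrightarrow> 0"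
proof (rule tendstoI)
  fix \<epsilon> :: real assume \<epsilon>: "0 < \<epsilon>"
  define S where "S k = {\<omega> \<in> space M. ennreal (\<epsilon> / 2) < Y k \<omega>}" for k
  have [measurable]: "S k \<in> sets M" for k unfolding S_def by measurable
  have "(\<lambda>k. measure M (S k)) \<longlonglongrightarrow> 0" using lim \<epsilon> by (simp add: tendsto_zero_in_prob_def S_def)
  then have "\<forall>\<^sub>F k in sequentially. measure M (S k) < \<epsilon> / 2" using \<epsilon> by (intro order_tendstoD) auto
  then show "\<forall>\<^sub>F k in sequentially. dist (\<integral>\<omega>. enn2real (min 1 (Y k \<omega>)) \<partial>M) 0 < \<epsilon>"
  proof eventually_elim
    case (elim k)
    have "(\<integral>\<omega>. enn2real (min 1 (Y k \<omega>)) \<partial>M) \<le> (\<integral>\<omega>. \<epsilon> / 2 + indicator (S k) \<omega> \<partial>M)"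
    proof (rule integral_mono)
      have l1: "enn2real (min 1 y) \<le> 1" for y :: ennreal
        by (metis enn2real_1 enn2real_mono ennreal_one_less_top min.cobounded1)
      show "integrable M (\<lambda>\<omega>. enn2real (min 1 (Y k \<omega>)))"
        by (rule integrable_const_bound[where B = 1]) (use l1 in auto)
      show "integrable M (\<lambda>\<omega>. \<epsilon> / 2 + indicator (S k) \<omega>)"
        by (intro Bochner_Integration.integrable_add integrable_const integrable_real_indicator) (auto simp: emeasure_eq_measure)
      fix \<omega> assume w: "\<omega> \<in> space M"
      show "enn2real (min 1 (Y k \<omega>)) \<le> \<epsilon> / 2 + indicator (S k) \<omega>"
      proof (cases "\<omega> \<in> S k")
        case True then show ?thesis using l1[of "Y k \<omega>"] \<epsilon> by simp
      next
        case False
        then have "min 1 (Y k \<omega>) \<le> ennreal (\<epsilon> / 2)" using w by (auto simp: S_def not_less min_le_iff_disj)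
        then have "enn2real (min 1 (Y k \<omega>)) \<le> \<epsilon> / 2" using \<epsilon> by (intro enn2real_leI) auto
        then show ?thesis by (simp add: indicator_def)
      qed
    qed
    also have "\<dots> = \<epsilon> / 2 + measure M (S k)"
      by (subst Bochner_Integration.integral_add) (auto simp: emeasure_eq_measure prob_space intro!: integrable_real_indicator)
    also have "\<dots> < \<epsilon>" using elim by simp
    finally show ?case by simp
  qed
qed

text \<open>Reduces the supremum of a path to countably many times, which makes it measurable as a function
  of the path.\<close>

lemma SUP_abs_continuous_countable:
  fixes h :: "real \<Rightarrow> real"
  assumes c: "0 \<le> c" and h: "continuous_on {0..c} h"
  shows "(SUP s\<in>{0..c}. ennreal \<bar>h s\<bar>) = (SUP (i, j). ennreal \<bar>h (min c (real i / real (Suc j)))\<bar>)"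
proof (rule antisym)
  show "(SUP (i, j). ennreal \<bar>h (min c (real i / real (Suc j)))\<bar>) \<le> (SUP s\<in>{0..c}. ennreal \<bar>h s\<bar>)"
    using c by (intro SUP_least) (auto intro!: SUP_upper)
  show "(SUP s\<in>{0..c}. ennreal \<bar>h s\<bar>) \<le> (SUP (i, j). ennreal \<bar>h (min c (real i / real (Suc j)))\<bar>)"
  proof (rule SUP_least)
    fix s assume s: "s \<in> {0..c}"
    have d: "min c (real i / real (Suc j)) \<in> {0..c}" for i j :: nat using c by auto
    let ?d = "\<lambda>m. min c (real (nat \<lceil>s * real (Suc m)\<rceil>) / real (Suc m))"
    have "(\<lambda>m. h (?d m)) \<longlonglongrightarrow> h s"
      by (rule continuous_on_tendsto_compose[OF h fraction_approx_tendsto]) (use s d in \<open>blast intro: always_eventually | simp\<close>)+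
    then have "(\<lambda>m. ennreal \<bar>h (?d m)\<bar>) \<longlonglongrightarrow> ennreal \<bar>h s\<bar>" by (intro tendsto_intros)
    then show "ennreal \<bar>h s\<bar> \<le> (SUP (i, j). ennreal \<bar>h (min c (real i / real (Suc j)))\<bar>)"
    proof (rule LIMSEQ_le_const2)
      show "\<exists>N. \<forall>m\<ge>N. ennreal \<bar>h (?d m)\<bar> \<le> (SUP (i, j). ennreal \<bar>h (min c (real i / real (Suc j)))\<bar>)"
      proof (intro exI[of _ 0] allI impI)
        fix m
        show "ennreal \<bar>h (?d m)\<bar> \<le> (SUP (i, j). ennreal \<bar>h (min c (real i / real (Suc j)))\<bar>)"
          by (rule SUP_upper2[of "(nat \<lceil>s * real (Suc m)\<rceil>, m)"]) auto
      qed
    qed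
  qed
qed

context brownian_space
begin

lemma prog_measurable_simple_process:
  assumes si: "simple_integrand M F n p \<xi>"
  shows "prog_measurable F (simple_process n p \<xi>)"
  unfolding prog_measurable_def
proof (intro allI impI)
  fix t :: real assume t: "0 \<le> t"
  let ?N = "restrict_space borel {0..t} \<Otimes>\<^sub>M F (ennreal t)"
  have [measurable]: "(\<lambda>x. fst x) \<in> borel_measurable ?N"
    by (intro measurable_compose[OF measurable_fst]) (simp add: measurable_restrict_space1)
  have "(\<lambda>x. \<xi> i (snd x) * indicator {p i<..p (Suc i)} (fst x)) \<in> borel_measurable ?N" if i: "i < n" for i
  proof (cases "p i \<le> t")
    case True
    have "\<xi> i \<in> borel_measurable (F (ennreal (p i)))" using si i by (simp add: simple_integrand_def)
    then have "\<xi> i \<in> borel_measurable (F (ennreal t))"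
      by (rule measurable_filtration_mono) (use True in \<open>simp add: ennreal_leI\<close>)
    then have [measurable]: "(\<lambda>x. \<xi> i (snd x)) \<in> borel_measurable ?N"
      by (rule measurable_compose[OF measurable_snd])
    show ?thesis by measurable
  next
    case False
    have "(\<lambda>x. 0 :: real) \<in> borel_measurable ?N" by simp
    then show ?thesis
      by (rule measurable_cong[THEN iffD1, rotated])
         (use False in \<open>auto simp: space_pair_measure space_restrict_space split: split_indicator\<close>)
  qed
  then show "(\<lambda>(s, \<omega>). simple_process n p \<xi> s \<omega>) \<in> borel_measurable ?N"
    unfolding simple_process_def case_prod_beta' by (intro borel_measurable_sum) auto
qed

lemma continuous_adapted_progressive:
  assumes "adapted_process F X" "continuous_paths M X"
  shows "prog_measurable F X"
  by (rule prog_measurable_continuous_adapted[where \<Omega> = "space M"])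
     (use assms sets_filtration_mono space_filtration in \<open>auto simp: adapted_process_def continuous_paths_def\<close>)

lemma measurable_SUP_path:
  fixes Y :: "real \<Rightarrow> 'a \<Rightarrow> real" and c :: real
  assumes Y: "\<And>s. 0 \<le> s \<Longrightarrow> s \<le> c \<Longrightarrow> Y s \<in> borel_measurable M" and c: "0 \<le> c"
    and cont: "\<And>\<omega>. \<omega> \<in> space M \<Longrightarrow> continuous_on {0..c} (\<lambda>s. Y s \<omega>)"
  shows "(\<lambda>\<omega>. SUP s\<in>{0..c}. ennreal \<bar>Y s \<omega>\<bar>) \<in> borel_measurable M"
proof (rule measurable_cong[THEN iffD2])
  show "(SUP s\<in>{0..c}. ennreal \<bar>Y s \<omega>\<bar>) = (SUP (i, j). ennreal \<bar>Y (min c (real i / real (Suc j))) \<omega>\<bar>)"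
    if "\<omega> \<in> space M" for \<omega>
    by (rule SUP_abs_continuous_countable[OF c cont[OF that]])
  have "Y (min c (real i / real (Suc j))) \<in> borel_measurable M" for i j using c by (intro Y) auto
  then show "(\<lambda>\<omega>. SUP (i, j). ennreal \<bar>Y (min c (real i / real (Suc j))) \<omega>\<bar>) \<in> borel_measurable M"
    unfolding case_prod_beta' by measurable
qed

section \<open>How long the diffusion stays in an interval\<close>

text \<open>The weight in \<open>W\<close> is infinite outside \<open>[-K, K]\<close>, so on \<open>{W s \<le> n}\<close> the path lies in \<open>[-K, K]\<close>
  for almost all times before \<open>s\<close> and its drift has variation at most \<open>n\<close>. There the generator
  applied to \<open>\<phi>\<close> is that applied to \<open>f\<close>, namely \<open>1\<close>, and the inequality for simple integrands
  becomes \<open>E (1_A |{s \<in> (a, c]. W s \<le> n}|) \<le> S P(A)\<close>.\<close>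

lemma exit_inequality_truncated:
  fixes f b \<sigma> :: "real \<Rightarrow> real" and X :: "real \<Rightarrow> 'a \<Rightarrow> real"
  assumes b[measurable]: "b \<in> borel_measurable borel"
    and \<sigma>_lb: "\<And>K. compact K \<Longrightarrow> bounded (\<sigma> ` K)"
    and sde: "sde_solution M F B b \<sigma> 0 X"
    and f_C2: "C2 f" and f_gen: "\<And>x. generator b \<sigma> f x = 1"
    and K: "0 < K" and S: "\<And>x y. \<bar>x\<bar> \<le> 2 * K \<Longrightarrow> \<bar>y\<bar> \<le> 2 * K \<Longrightarrow> f y - f x \<le> S"
    and ac: "0 \<le> a" "a < c" and A: "A \<in> sets (F (ennreal a))" and n: "0 \<le> n"
  defines "W t \<omega> \<equiv> (\<integral>\<^sup>+s\<in>{0..t}. (ennreal \<bar>b (X s \<omega>)\<bar> + (if K < \<bar>X s \<omega>\<bar> then \<infinity> else 0)) \<partial>lborel)"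
  shows "(c - a) * measure M (A \<inter> {\<omega> \<in> space M. W c \<omega> \<le> ennreal n}) \<le> S * measure M A"
    and "W c \<in> borel_measurable M"
proof -
  have c0: "0 \<le> c" using ac by simp
  obtain I where I: "ito_integral M F B (\<lambda>s \<omega>. \<sigma> (X s \<omega>)) I"
    and XI: "AE \<omega> in M. \<forall>t\<ge>0. X t \<omega> = 0 + (LINT s:{0..t}|lborel. b (X s \<omega>)) + I t \<omega>"
    using sde by (auto simp: sde_solution_def)
  have Xad: "adapted_process F X" "continuous_paths M X" using sde by (auto simp: sde_solution_def)
  have Xp: "prog_measurable F X" by (rule continuous_adapted_progressive[OF Xad])
  have Iad: "adapted_process F I" "continuous_paths M I"
    and Hp: "prog_measurable F (\<lambda>s \<omega>. \<sigma> (X s \<omega>))"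
    using I by (auto simp: ito_integral_def progressive_process_iff)
  obtain N p \<xi> where si: "\<And>k. simple_integrand M F (N k) (p k) (\<xi> k)"
    and appr: "\<And>t. 0 \<le> t \<Longrightarrow>
           tendsto_zero_in_prob M (\<lambda>k \<omega>.
             \<integral>\<^sup>+s\<in>{0..t}. ennreal ((simple_process (N k) (p k) (\<xi> k) s \<omega> - \<sigma> (X s \<omega>))\<^sup>2) \<partial>lborel)"
      "\<And>t. 0 \<le> t \<Longrightarrow> tendsto_zero_in_prob M (\<lambda>k \<omega>.
             SUP s\<in>{0..t}. ennreal \<bar>simple_integral B (N k) (p k) (\<xi> k) s \<omega> - I s \<omega>\<bar>)"
    using I unfolding ito_integral_def by blast
  define e where "e k s \<omega> = simple_process (N k) (p k) (\<xi> k) s \<omega>" for k s \<omega>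
  define J where "J k s \<omega> = simple_integral B (N k) (p k) (\<xi> k) s \<omega>" for k s \<omega>
  define H where "H s \<omega> = \<sigma> (X s \<omega>)" for s \<omega>
  define w where "w s \<omega> = ennreal \<bar>b (X s \<omega>)\<bar> + (if K < \<bar>X s \<omega>\<bar> then \<infinity> else 0)" for s \<omega>
  have W_eq: "W t \<omega> = (\<integral>\<^sup>+s\<in>{0..t}. w s \<omega> \<partial>lborel)" for t \<omega> unfolding W_def w_def ..
  define q where "q k s \<omega> = ennreal ((e k s \<omega> - H s \<omega>)\<^sup>2)" for k s \<omega>
  define Q where "Q k t \<omega> = (\<integral>\<^sup>+s\<in>{0..t}. q k s \<omega> \<partial>lborel)" for k t \<omega>
  have ep: "prog_measurable F (e k)" for k
    unfolding e_def[abs_def] by (rule prog_measurable_simple_process[OF si])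
  have Hp': "prog_measurable F H" using Hp by (simp add: H_def[abs_def])
  have wp: "prog_measurable F w"
    unfolding w_def[abs_def]
    by (rule prog_measurable_compose[OF Xp, of "\<lambda>x. ennreal \<bar>b x\<bar> + (if K < \<bar>x\<bar> then \<infinity> else 0)"]) measurable
  have qp: "prog_measurable F (q k)" for k
    unfolding prog_measurable_def
  proof (intro allI impI)
    fix t :: real assume t: "0 \<le> t"
    note [measurable] = prog_measurableD[OF ep t, of k] prog_measurableD[OF Hp' t]
    show "(\<lambda>(s, \<omega>). q k s \<omega>) \<in> borel_measurable (restrict_space borel {0..t} \<Otimes>\<^sub>M F (ennreal t))"
      unfolding q_def by measurable
  qed
  have Wp: "prog_measurable F W"
    using prog_measurable_nn_integral[OF wp] by (simp add: W_eq[abs_def])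
  have Qp: "prog_measurable F (Q k)" for k
    using prog_measurable_nn_integral[OF qp] by (simp add: Q_def[abs_def])
  show Wcm[measurable]: "W c \<in> borel_measurable M"
    by (rule measurable_filtration[OF prog_measurable_at[OF Wp c0]])
  have Qcm[measurable]: "Q k c \<in> borel_measurable M" for k
    by (rule measurable_filtration[OF prog_measurable_at[OF Qp c0]])
  \<comment> \<open>Switching the drift off once \<open>W\<close> exceeds \<open>n\<close> bounds its variation by \<open>n\<close> on every path. Up
    to that time nothing changes.\<close>
  define \<beta> where "\<beta> s \<omega> = b (X s \<omega>) * of_bool (W s \<omega> \<le> ennreal n)" for s \<omega>
  have \<beta>p: "prog_measurable F \<beta>"
    unfolding prog_measurable_def
  proof (intro allI impI)
    fix t :: real assume t: "0 \<le> t"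
    note [measurable] = prog_measurableD[OF Xp t] prog_measurableD[OF Wp t]
    show "(\<lambda>(s, \<omega>). \<beta> s \<omega>) \<in> borel_measurable (restrict_space borel {0..t} \<Otimes>\<^sub>M F (ennreal t))"
      unfolding \<beta>_def by measurable
  qed
  have sec: "(\<lambda>s. h s \<omega>) \<in> borel_measurable (restrict_space borel {0..c})"
    if "prog_measurable F h" "\<omega> \<in> space M" for h :: "real \<Rightarrow> 'a \<Rightarrow> 'z::topological_space" and \<omega>
    using prog_measurable_section[OF that(1) c0] that(2) by (simp add: space_filtration)
  have stopw: "(\<integral>\<^sup>+s\<in>{0..c}. w s \<omega> * indicator {s. W s \<omega> \<le> ennreal n} s \<partial>lborel) \<le> ennreal n" if "\<omega> \<in> space M" for \<omega>
    using nn_integral_stopped_le[OF sec[OF wp that] c0, of "ennreal n"] by (simp add: W_eq)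
  have stopq: "(\<integral>\<^sup>+s\<in>{0..c}. q k s \<omega> * indicator {s. Q k s \<omega> \<le> 1} s \<partial>lborel) \<le> 1" if "\<omega> \<in> space M" for \<omega> k
    using nn_integral_stopped_le[where C = 1, OF sec[OF qp[of k] that] c0] by (simp add: Q_def)
  have \<beta>n: "(\<integral>\<^sup>+s\<in>{0..c}. ennreal \<bar>\<beta> s \<omega>\<bar> \<partial>lborel) \<le> ennreal n" if "\<omega> \<in> space M" for \<omega>
    by (rule order_trans[OF nn_integral_mono stopw[OF that]])
       (auto simp: \<beta>_def w_def split: split_indicator intro: add_increasing2)
  have \<beta>m0: "(\<lambda>s. indicator {0..c} s * \<beta> s \<omega>) \<in> borel_measurable lborel" if "\<omega> \<in> space M" for \<omega>
    using sec[OF \<beta>p that] by (subst (asm) borel_measurable_restrict_space_iff) auto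
  have abs_ind: "ennreal (norm (indicator {0..c} s * \<beta> s \<omega>)) = ennreal \<bar>\<beta> s \<omega>\<bar> * indicator {0..c} s" for s \<omega>
    by (auto split: split_indicator)
  have \<beta>i: "set_integrable lborel {0..c} (\<lambda>s. \<beta> s \<omega>)" if "\<omega> \<in> space M" for \<omega>
  proof -
    have "integrable lborel (\<lambda>s. indicator {0..c} s * \<beta> s \<omega>)"
      using \<beta>n[OF that] \<beta>m0[OF that] by (intro integrableI_bounded) (auto simp: abs_ind simp del: real_norm_def intro: le_less_trans)
    then show ?thesis by (simp add: set_integrable_def)
  qed
  have \<beta>b: "(LINT s:{0..c}|lborel. \<bar>\<beta> s \<omega>\<bar>) \<le> n" if om: "\<omega> \<in> space M" for \<omega>
  proof -
    have "(LINT s:{0..c}|lborel. \<bar>\<beta> s \<omega>\<bar>) = (\<integral>s. norm (indicator {0..c} s * \<beta> s \<omega>) \<partial>lborel)"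
      by (simp add: set_lebesgue_integral_def abs_mult)
    also have "\<dots> = enn2real (\<integral>\<^sup>+s\<in>{0..c}. ennreal \<bar>\<beta> s \<omega>\<bar> \<partial>lborel)"
      using \<beta>m0[OF om] by (subst integral_eq_nn_integral) (auto simp: abs_ind simp del: real_norm_def)
    also have "\<dots> \<le> n" using \<beta>n[OF om] n by (intro enn2real_leI) auto
    finally show ?thesis .
  qed
  have \<beta>m: "(\<lambda>\<omega>. LINT s:{0..t}|lborel. \<beta> s \<omega>) \<in> borel_measurable (F (ennreal t))" if t: "0 \<le> t" "t \<le> c" for t
  proof -
    have "(\<lambda>\<omega>. enn2real (\<integral>\<^sup>+s\<in>{0..t}. ennreal (\<beta> s \<omega>) \<partial>lborel) - enn2real (\<integral>\<^sup>+s\<in>{0..t}. ennreal (- \<beta> s \<omega>) \<partial>lborel))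
        \<in> borel_measurable (F (ennreal t))"
      using prog_measurable_at[OF prog_measurable_nn_integral[OF prog_measurable_compose[OF \<beta>p, of ennreal]] t(1)]
        prog_measurable_at[OF prog_measurable_nn_integral[OF prog_measurable_compose[OF \<beta>p, of "\<lambda>x. ennreal (- x)"]] t(1)]
      by auto
    then show ?thesis
    proof (rule measurable_cong[THEN iffD1, rotated])
      fix \<omega> assume "\<omega> \<in> space (F (ennreal t))"
      then have om: "\<omega> \<in> space M" by (simp add: space_filtration)
      have "set_integrable lborel {0..t} (\<lambda>s. \<beta> s \<omega>)"
        by (rule set_integrable_subset[OF \<beta>i[OF om]]) (use t in auto)
      then have "integrable lborel (\<lambda>s. indicator {0..t} s * \<beta> s \<omega>)" by (simp add: set_integrable_def)
      from real_lebesgue_integral_def[OF this]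
      have "(LINT s:{0..t}|lborel. \<beta> s \<omega>) = enn2real (\<integral>\<^sup>+s. ennreal (indicator {0..t} s * \<beta> s \<omega>) \<partial>lborel)
          - enn2real (\<integral>\<^sup>+s. ennreal (- (indicator {0..t} s * \<beta> s \<omega>)) \<partial>lborel)"
        by (simp add: set_lebesgue_integral_def)
      also have "(\<integral>\<^sup>+s. ennreal (indicator {0..t} s * \<beta> s \<omega>) \<partial>lborel) = (\<integral>\<^sup>+s\<in>{0..t}. ennreal (\<beta> s \<omega>) \<partial>lborel)"
        by (intro nn_integral_cong) (auto split: split_indicator)
      also have "(\<integral>\<^sup>+s. ennreal (- (indicator {0..t} s * \<beta> s \<omega>)) \<partial>lborel) = (\<integral>\<^sup>+s\<in>{0..t}. ennreal (- \<beta> s \<omega>) \<partial>lborel)"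
        by (intro nn_integral_cong) (auto split: split_indicator)
      finally show "enn2real (\<integral>\<^sup>+s\<in>{0..t}. ennreal (\<beta> s \<omega>) \<partial>lborel) - enn2real (\<integral>\<^sup>+s\<in>{0..t}. ennreal (- \<beta> s \<omega>) \<partial>lborel)
          = (LINT s:{0..t}|lborel. \<beta> s \<omega>)" by simp
    qed
  qed
  \<comment> \<open>The condition on \<open>Q\<close> keeps the quadratic variation of the \<open>k\<close>-th approximating integral
    bounded; it holds for large \<open>k\<close> along almost every path of the subsequence chosen below.\<close>
  define G where "G k s = {\<omega> \<in> space M. W s \<omega> \<le> ennreal n \<and> Q k s \<omega> \<le> 1}" for k s
  have Gm: "G k t \<in> sets (F (ennreal t))" if t: "0 \<le> t" "t \<le> c" for k t
  proof -
    note [measurable] = prog_measurable_at[OF Wp t(1)] prog_measurable_at[OF Qp t(1), of k]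
    have "{\<omega> \<in> space (F (ennreal t)). W t \<omega> \<le> ennreal n \<and> Q k t \<omega> \<le> 1} \<in> sets (F (ennreal t))" by measurable
    then show ?thesis by (simp add: G_def space_filtration)
  qed
  have Wmono: "W r \<omega> \<le> W s \<omega>" and Qmono: "Q k r \<omega> \<le> Q k s \<omega>" if "r \<le> s" for r s \<omega> k
    using that by (auto simp: W_eq Q_def intro: nn_integral_atLeastAtMost_mono)
  have Gdec: "G k s \<subseteq> G k r" if "r \<le> s" for k r s
    using Wmono[OF that] Qmono[OF that] by (auto simp: G_def intro: order_trans)
  have Gleft: "\<omega> \<in> G k s" if om: "\<omega> \<in> space M" and s: "0 < s" "s \<le> c" and r: "\<And>r. 0 \<le> r \<Longrightarrow> r < s \<Longrightarrow> \<omega> \<in> G k r" for k s \<omega>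
  proof -
    have "W s \<omega> \<le> ennreal n" unfolding W_eq
      by (rule nn_integral_atLeastAtMost_left_limit_le[OF sec[OF wp om] s]) (use r in \<open>auto simp: G_def W_eq\<close>)
    moreover have "Q k s \<omega> \<le> 1" unfolding Q_def
      by (rule nn_integral_atLeastAtMost_left_limit_le[OF sec[OF qp om] s]) (use r in \<open>auto simp: G_def Q_def\<close>)
    ultimately show ?thesis using om by (simp add: G_def)
  qed
  obtain \<phi> \<phi>1 \<phi>2 C where
    d1: "\<And>x. (\<phi> has_real_derivative \<phi>1 x) (at x)" and d2: "\<And>x. (\<phi>1 has_real_derivative \<phi>2 x) (at x)"
    and uc: "uniformly_continuous_on UNIV \<phi>2" and bd: "\<And>x. \<bar>\<phi>1 x\<bar> \<le> C" "\<And>x. \<bar>\<phi>2 x\<bar> \<le> C"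
    and rng: "\<And>x. \<exists>u. \<bar>u\<bar> \<le> 2 * K \<and> \<phi> x = f u"
    and agree: "\<And>x. \<bar>x\<bar> \<le> K \<Longrightarrow> \<phi>1 x = deriv f x \<and> \<phi>2 x = deriv (deriv f) x"
    using C2_bounded_extension[OF f_C2 K] by metis
  have Sphi: "\<phi> y - \<phi> x \<le> S" for x y using rng[of x] rng[of y] S by metis
  have c1: "continuous_on UNIV \<phi>1" using d2 by (meson DERIV_continuous_on has_field_derivative_at_within)
  have c2: "continuous_on UNIV \<phi>2" by (rule uniformly_continuous_imp_continuous[OF uc])
  have "bounded (\<sigma> ` {-K..K})" by (rule \<sigma>_lb) simp
  then obtain \<Sigma> where "\<forall>y\<in>\<sigma> ` {-K..K}. norm y \<le> \<Sigma>" by (auto simp: bounded_iff)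
  then have \<Sigma>: "\<bar>\<sigma> x\<bar> \<le> \<Sigma>" if "\<bar>x\<bar> \<le> K" for x
  proof -
    have "x \<in> {-K..K}" using that by auto
    then show ?thesis using \<open>\<forall>y\<in>\<sigma> ` {-K..K}. norm y \<le> \<Sigma>\<close> by (metis image_eqI real_norm_def)
  qed
  define Z where "Z k s \<omega> = (LINT r:{0..s}|lborel. \<beta> r \<omega>) + J k s \<omega>" for k s \<omega>
  define U where "U k \<omega> = (LINT s:{a<..c}|lborel. indicator (G k s) \<omega> *
      (\<phi>1 (Z k s \<omega>) * \<beta> s \<omega> + \<phi>2 (Z k s \<omega>) * (e k s \<omega>)\<^sup>2 / 2))" for k \<omega>
  have Um[measurable]: "U k \<in> borel_measurable M" and US: "(\<integral>\<omega>. indicator A \<omega> * U k \<omega> \<partial>M) \<le> S * measure M A" for k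
  proof -
    note ito = ito_inequality_simple[where G = "G k", OF si[of k] ac A \<beta>i \<beta>b \<beta>m Gm Gdec Gleft d1 d2 uc bd Sphi]
    show "U k \<in> borel_measurable M"
      unfolding U_def[abs_def] Z_def J_def e_def by (rule ito(1))
    show "(\<integral>\<omega>. indicator A \<omega> * U k \<omega> \<partial>M) \<le> S * measure M A"
      unfolding U_def[abs_def] Z_def J_def e_def by (rule ito(2))
  qed
  define R where "R = restrict_space lborel {a<..c}"
  have spR: "space R = {a<..c}" by (simp add: R_def space_restrict_space)
  have emR: "emeasure R (space R) = ennreal (c - a)"
    unfolding spR R_def using ac by (subst emeasure_restrict_space) auto
  interpret R: finite_measure R by (rule finite_measureI) (simp add: emR)
  have mR: "measure R (space R) = c - a" using emR ac by (simp add: measure_def)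
  have intR: "(\<integral>s. h s \<partial>R) = (\<integral>s. indicator {a<..c} s * h s \<partial>lborel)" for h :: "real \<Rightarrow> real"
    unfolding R_def by (subst integral_restrict_space) auto
  have nnR: "(\<integral>\<^sup>+s. h s \<partial>R) = (\<integral>\<^sup>+s. h s * indicator {a<..c} s \<partial>lborel)" for h
    unfolding R_def by (subst nn_integral_restrict_space) auto
  have idR: "(\<lambda>s. s) \<in> R \<rightarrow>\<^sub>M restrict_space borel {0..c}"
    unfolding R_def by (rule measurable_restrict_space2) (use ac in \<open>auto simp: space_restrict_space intro!: measurable_restrict_space1\<close>)
  have secR: "(\<lambda>s. h s \<omega>) \<in> borel_measurable R"
    if "prog_measurable F h" "\<omega> \<in> space M" for h :: "real \<Rightarrow> 'a \<Rightarrow> 'z::topological_space" and \<omega>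
    by (rule measurable_compose[OF idR sec[OF that]])
  have AE_R: "AE s in R. W s \<omega> \<le> ennreal n \<longrightarrow> \<bar>X s \<omega>\<bar> \<le> K" if om: "\<omega> \<in> space M" for \<omega>
  proof -
    have wm: "(\<lambda>s. w s \<omega> * indicator {0..c} s) \<in> borel_measurable lborel"
      using sec[OF wp om] by (subst (asm) borel_measurable_restrict_space_iff_ennreal) auto
    have "(\<lambda>s. W s \<omega> * indicator {0..c} s) \<in> borel_measurable lborel"
      using sec[OF Wp om] by (subst (asm) borel_measurable_restrict_space_iff_ennreal) auto
    from this[THEN borel_measurable_le, of "\<lambda>_. ennreal n"]
    have im: "{s \<in> space lborel. W s \<omega> * indicator {0..c} s \<le> ennreal n} \<in> sets lborel" by simp
    have "(\<integral>\<^sup>+s. w s \<omega> * indicator {0..c} s * indicator {s \<in> space lborel. W s \<omega> * indicator {0..c} s \<le> ennreal n} s \<partial>lborel)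
        = (\<integral>\<^sup>+s\<in>{0..c}. w s \<omega> * indicator {s. W s \<omega> \<le> ennreal n} s \<partial>lborel)"
      by (intro nn_integral_cong) (auto split: split_indicator)
    also have "\<dots> < \<infinity>" using stopw[OF om] by (rule le_less_trans) simp
    finally have fin: "(\<integral>\<^sup>+s. w s \<omega> * indicator {0..c} s * indicator {s \<in> space lborel. W s \<omega> * indicator {0..c} s \<le> ennreal n} s \<partial>lborel) \<noteq> \<infinity>" by simp
    have "AE s in lborel. w s \<omega> * indicator {0..c} s * indicator {s \<in> space lborel. W s \<omega> * indicator {0..c} s \<le> ennreal n} s \<noteq> \<infinity>"
      by (rule nn_integral_noteq_infinite[OF _ fin]) (use wm im in simp)
    then have "AE s in lborel. s \<in> {a<..c} \<longrightarrow> (W s \<omega> \<le> ennreal n \<longrightarrow> \<bar>X s \<omega>\<bar> \<le> K)"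
    proof eventually_elim
      case (elim s)
      then show ?case using ac by (auto simp: w_def not_less split: split_indicator_asm if_splits)
    qed
    then show ?thesis unfolding R_def by (subst AE_restrict_space_iff) auto
  qed
  have HR: "AE s in R. W s \<omega> \<le> ennreal n \<longrightarrow> \<bar>H s \<omega>\<bar> \<le> \<Sigma>" if om: "\<omega> \<in> space M" for \<omega>
    using AE_R[OF om] by eventually_elim (auto simp: H_def intro: \<Sigma>)
  have oneR: "AE s in R. W s \<omega> \<le> ennreal n \<longrightarrow> \<phi>1 (X s \<omega>) * \<beta> s \<omega> + \<phi>2 (X s \<omega>) * (H s \<omega>)\<^sup>2 / 2 = 1"
    if om: "\<omega> \<in> space M" for \<omega>
    using AE_R[OF om]
  proof eventually_elim
    case (elim s)
    show ?case
      using agree[of "X s \<omega>"] elim f_gen[of "X s \<omega>"] by (auto simp: H_def \<beta>_def generator_def mult.commute)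
  qed
  have \<beta>R: "integrable R (\<lambda>s. \<beta> s \<omega>)" and \<beta>Rb: "(\<integral>s. \<bar>\<beta> s \<omega>\<bar> \<partial>R) \<le> n" if om: "\<omega> \<in> space M" for \<omega>
  proof -
    have "set_integrable lborel {a<..c} (\<lambda>s. \<beta> s \<omega>)"
      by (rule set_integrable_subset[OF \<beta>i[OF om]]) (use ac in auto)
    then show i: "integrable R (\<lambda>s. \<beta> s \<omega>)"
      unfolding R_def set_integrable_def by (subst integrable_restrict_space) auto
    have "(\<integral>s. \<bar>\<beta> s \<omega>\<bar> \<partial>R) \<le> (LINT s:{0..c}|lborel. \<bar>\<beta> s \<omega>\<bar>)"
      unfolding intR set_lebesgue_integral_def
    proof (rule integral_mono)
      have "set_integrable lborel T (\<lambda>s. \<bar>\<beta> s \<omega>\<bar>)" if "T \<subseteq> {0..c}" "T \<in> sets borel" for T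
        using set_integrable_abs[OF set_integrable_subset[OF \<beta>i[OF om], of T]] that by auto
      moreover have "{a<..c} \<subseteq> {0..c}" using ac by auto
      ultimately show "integrable lborel (\<lambda>s. indicator {a<..c} s * \<bar>\<beta> s \<omega>\<bar>)" "integrable lborel (\<lambda>s. indicator {0..c} s *\<^sub>R \<bar>\<beta> s \<omega>\<bar>)"
        by (auto simp: set_integrable_def)
    qed (use ac in \<open>auto split: split_indicator\<close>)
    then show "(\<integral>s. \<bar>\<beta> s \<omega>\<bar> \<partial>R) \<le> n" using \<beta>b[OF om] by simp
  qed
  have UR: "U k \<omega> = (\<integral>s. of_bool (W s \<omega> \<le> ennreal n \<and> Q k s \<omega> \<le> 1) * (\<phi>1 (Z k s \<omega>) * \<beta> s \<omega> + \<phi>2 (Z k s \<omega>) * (e k s \<omega>)\<^sup>2 / 2) \<partial>R)"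
    if om: "\<omega> \<in> space M" for k \<omega>
    unfolding U_def intR set_lebesgue_integral_def
    by (intro Bochner_Integration.integral_cong refl) (use om in \<open>auto simp: G_def split: split_indicator\<close>)
  define D0 where "D0 = C * n + C + C * \<Sigma>\<^sup>2 * (c - a)"
  have Ub: "\<bar>U k \<omega>\<bar> \<le> D0" if om: "\<omega> \<in> space M" for k \<omega>
  proof -
    note [measurable] = secR[OF Wp om] secR[OF Qp om, of k]
    have "Measurable.pred R (\<lambda>s. W s \<omega> \<le> ennreal n \<and> Q k s \<omega> \<le> 1)" by measurable
    moreover have "AE s in R. W s \<omega> \<le> ennreal n \<and> Q k s \<omega> \<le> 1 \<longrightarrow> \<bar>H s \<omega>\<bar> \<le> \<Sigma>"
      using HR[OF om] by eventually_elim auto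
    moreover have "(\<integral>\<^sup>+s. ennreal ((e k s \<omega> - H s \<omega>)\<^sup>2) * indicator {s. W s \<omega> \<le> ennreal n \<and> Q k s \<omega> \<le> 1} s \<partial>R) \<le> 1"
      unfolding nnR
      by (rule order_trans[OF nn_integral_mono stopq[OF om, of k]]) (use ac in \<open>auto simp: q_def split: split_indicator\<close>)
    ultimately show ?thesis
      unfolding UR[OF om] D0_def mR[symmetric]
      by (intro R.perturbed_integral_bound[where H = "\<lambda>s. H s \<omega>"] \<beta>R[OF om] \<beta>Rb[OF om] secR[OF ep om] secR[OF Hp' om] bd)
  qed
  define Y where "Y k \<omega> = (SUP s\<in>{0..c}. ennreal \<bar>J k s \<omega> - I s \<omega>\<bar>)" for k \<omega>
  have Jc: "continuous_on {0..c} (\<lambda>s. J k s \<omega>)" if om: "\<omega> \<in> space M" for k \<omega>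
    unfolding J_def by (rule continuous_on_subset[OF simple_integral_continuous[OF si om]]) auto
  have Ym[measurable]: "Y k \<in> borel_measurable M" for k
    unfolding Y_def[abs_def]
  proof (rule measurable_SUP_path[OF _ c0])
    show "(\<lambda>\<omega>. J k s \<omega> - I s \<omega>) \<in> borel_measurable M" if "0 \<le> s" for s
    proof -
      have "I s \<in> borel_measurable (F (ennreal s))" using Iad(1) that by (simp add: adapted_process_def)
      then show ?thesis
        unfolding J_def
        by (intro borel_measurable_diff measurable_filtration[OF simple_integral_measurable[OF si that]] measurable_filtration)
    qed
    show "continuous_on {0..c} (\<lambda>s. J k s \<omega> - I s \<omega>)" if om: "\<omega> \<in> space M" for \<omega>
      using Iad(2) om by (intro continuous_on_diff Jc) (auto simp: continuous_paths_def intro: continuous_on_subset)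
  qed
  define u where "u k \<omega> = enn2real (min 1 (Q k c \<omega>)) + enn2real (min 1 (Y k \<omega>))" for k \<omega>
  have l1: "enn2real (min 1 y) \<le> 1" for y :: ennreal
    by (metis enn2real_1 enn2real_mono ennreal_one_less_top min.cobounded1)
  have ui: "integrable M (\<lambda>\<omega>. enn2real (min 1 (Q k c \<omega>)))" "integrable M (\<lambda>\<omega>. enn2real (min 1 (Y k \<omega>)))" for k
    by (auto intro!: integrable_const_bound[where B = 1] l1)
  have "(\<lambda>k. \<integral>\<omega>. norm (u k \<omega>) \<partial>M) \<longlonglongrightarrow> 0 + 0"
  proof -
    have "(\<lambda>k. \<integral>\<omega>. enn2real (min 1 (Q k c \<omega>)) \<partial>M) \<longlonglongrightarrow> 0"
      by (rule tendsto_zero_in_prob_expectation[OF Qcm])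
         (use appr(1)[OF c0] in \<open>simp add: Q_def[abs_def] q_def e_def H_def\<close>)
    moreover have "(\<lambda>k. \<integral>\<omega>. enn2real (min 1 (Y k \<omega>)) \<partial>M) \<longlonglongrightarrow> 0"
      by (rule tendsto_zero_in_prob_expectation[OF Ym])
         (use appr(2)[OF c0] in \<open>simp add: Y_def[abs_def] J_def\<close>)
    ultimately have "(\<lambda>k. (\<integral>\<omega>. enn2real (min 1 (Q k c \<omega>)) \<partial>M) + (\<integral>\<omega>. enn2real (min 1 (Y k \<omega>)) \<partial>M)) \<longlonglongrightarrow> 0 + 0"
      by (rule tendsto_add)
    then show ?thesis by (simp add: u_def ui)
  qed
  \<comment> \<open>Along a subsequence the convergence in probability is almost sure, so that single paths can
    be treated.\<close>
  then have "\<exists>r. strict_mono r \<and> (AE \<omega> in M. (\<lambda>k. u (r k) \<omega>) \<longlonglongrightarrow> 0)"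
    by (intro tendsto_L1_AE_subseq) (auto simp: u_def[abs_def] ui)
  then obtain r where r: "AE \<omega> in M. (\<lambda>k. u (r k) \<omega>) \<longlonglongrightarrow> 0" by blast
  have from_min: "y \<longlonglongrightarrow> 0" if "(\<lambda>k. enn2real (min 1 (y k))) \<longlonglongrightarrow> 0" for y :: "nat \<Rightarrow> ennreal"
  proof -
    have eq: "ennreal (enn2real (min 1 (y k))) = min 1 (y k)" for k
      by (rule ennreal_enn2real) (simp add: min_less_iff_disj)
    have "(\<lambda>k. ennreal (enn2real (min 1 (y k)))) \<longlonglongrightarrow> ennreal 0" by (rule tendsto_ennrealI[OF that])
    then have l: "(\<lambda>k. min 1 (y k)) \<longlonglongrightarrow> 0" by (simp add: eq)
    have "\<forall>\<^sub>F k in sequentially. min 1 (y k) < 1" using order_tendstoD(2)[OF l, of 1] by simp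
    then have "\<forall>\<^sub>F k in sequentially. min 1 (y k) = y k" by eventually_elim (auto simp: min_def split: if_splits)
    with l show ?thesis by (rule Lim_transform_eventually)
  qed
  \<comment> \<open>If \<open>W c \<le> n\<close> then \<open>W s \<le> n\<close> for all \<open>s \<le> c\<close>, and the limit of \<open>U\<close> is \<open>c - a\<close>. Passing to the
    minimum with \<open>g\<close> gives a limit that is visibly measurable.\<close>
  define g where "g \<omega> = (c - a) * indicator {\<omega> \<in> space M. W c \<omega> \<le> ennreal n} \<omega>" for \<omega>
  have gm[measurable]: "g \<in> borel_measurable M" unfolding g_def[abs_def] by measurable
  have gb: "0 \<le> g \<omega>" "g \<omega> \<le> c - a" for \<omega> using ac by (auto simp: g_def split: split_indicator)
  have AEU: "AE \<omega> in M. (\<lambda>k. indicator A \<omega> * min (U (r k) \<omega>) (g \<omega>)) \<longlonglongrightarrow> indicator A \<omega> * g \<omega>"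
    using r XI AE_space
  proof eventually_elim
    case (elim \<omega>)
    note om = elim(3)
    have "(\<lambda>k. enn2real (min 1 (Q (r k) c \<omega>))) \<longlonglongrightarrow> 0" "(\<lambda>k. enn2real (min 1 (Y (r k) \<omega>))) \<longlonglongrightarrow> 0"
      by (rule Lim_null_comparison[OF _ elim(1)]; simp add: u_def)+
    then have Q0: "(\<lambda>k. Q (r k) c \<omega>) \<longlonglongrightarrow> 0" and Y0: "(\<lambda>k. Y (r k) \<omega>) \<longlonglongrightarrow> 0"
      by (auto intro: from_min)
    have zx: "(\<lambda>k. Z (r k) s \<omega>) \<longlonglongrightarrow> X s \<omega>" if s: "s \<in> {0..c}" and Ws: "W s \<omega> \<le> ennreal n" for s
    proof -
      have "(LINT t:{0..s}|lborel. b (X t \<omega>)) = (LINT t:{0..s}|lborel. \<beta> t \<omega>)"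
      proof (rule set_lebesgue_integral_cong)
        show "\<forall>t. t \<in> {0..s} \<longrightarrow> b (X t \<omega>) = \<beta> t \<omega>"
          using Wmono[of _ s \<omega>] Ws by (auto simp: \<beta>_def dest: order_trans)
      qed simp
      then have "X s \<omega> = (LINT t:{0..s}|lborel. \<beta> t \<omega>) + I s \<omega>" using elim(2) s by auto
      then have diff: "Z k s \<omega> - X s \<omega> = J k s \<omega> - I s \<omega>" for k by (simp add: Z_def)
      have "ennreal \<bar>Z k s \<omega> - X s \<omega>\<bar> \<le> Y k \<omega>" for k
        unfolding diff Y_def using s by (intro SUP_upper)
      then have "(\<lambda>k. ennreal \<bar>Z (r k) s \<omega> - X s \<omega>\<bar>) \<longlonglongrightarrow> 0"
        by (intro tendsto_sandwich[OF _ _ tendsto_const Y0]) auto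
      then have "(\<lambda>k. enn2real (ennreal \<bar>Z (r k) s \<omega> - X s \<omega>\<bar>)) \<longlonglongrightarrow> enn2real 0"
        by (intro tendsto_enn2real) auto
      then have "(\<lambda>k. \<bar>Z (r k) s \<omega> - X s \<omega>\<bar>) \<longlonglongrightarrow> 0" by simp
      then show ?thesis by (simp add: tendsto_rabs_zero_iff LIM_zero_iff)
    qed
    have Zc: "continuous_on {0..c} (\<lambda>s. Z k s \<omega>)" for k
    proof -
      have bi: "integrable lborel (\<lambda>s. indicator {0..c} s * \<beta> s \<omega>)" using \<beta>i[OF om] by (simp add: set_integrable_def)
      have "continuous_on {0..c} (\<lambda>s. LINT t:{0..s}|lborel. \<beta> t \<omega>)"
        using integrable_indefinite_continuous_on[OF bi, of c]
        by (rule continuous_on_cong[THEN iffD1, rotated 2])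
           (auto simp: set_lebesgue_integral_def intro!: Bochner_Integration.integral_cong split: split_indicator)
      then show ?thesis unfolding Z_def by (intro continuous_on_add Jc[OF om])
    qed
    have lim: "(\<lambda>k. U (r k) \<omega>) \<longlonglongrightarrow> (\<integral>s. of_bool (W s \<omega> \<le> ennreal n) \<partial>R)"
      unfolding UR[OF om]
    proof (rule R.perturbed_integral_tendsto[where x = "\<lambda>s. X s \<omega>" and H = "\<lambda>s. H s \<omega>" and \<Sigma> = \<Sigma>])
      show "integrable R (\<lambda>s. \<beta> s \<omega>)" by (rule \<beta>R[OF om])
      note [measurable] = secR[OF Wp om]
      show "Measurable.pred R (\<lambda>s. W s \<omega> \<le> ennreal n)" by measurable
      show "(\<lambda>s. Z (r k) s \<omega>) \<in> borel_measurable R" for k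
        by (rule measurable_compose[OF idR borel_measurable_continuous_on_restrict[OF Zc]])
      show "(\<lambda>s. e (r k) s \<omega>) \<in> borel_measurable R" for k by (rule secR[OF ep om])
      show "(\<lambda>s. H s \<omega>) \<in> borel_measurable R" by (rule secR[OF Hp' om])
      show "AE s in R. W s \<omega> \<le> ennreal n \<longrightarrow> (\<lambda>k. Z (r k) s \<omega>) \<longlonglongrightarrow> X s \<omega>"
        by (rule AE_I2) (use zx ac in \<open>auto simp: spR\<close>)
      have "(\<integral>\<^sup>+s. ennreal ((e (r k) s \<omega> - H s \<omega>)\<^sup>2) \<partial>R) \<le> Q (r k) c \<omega>" for k
        unfolding nnR Q_def q_def by (intro nn_integral_mono) (use ac in \<open>auto split: split_indicator\<close>)
      then show "(\<lambda>k. \<integral>\<^sup>+s. ennreal ((e (r k) s \<omega> - H s \<omega>)\<^sup>2) \<partial>R) \<longlonglongrightarrow> 0"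
        by (intro tendsto_sandwich[OF _ _ tendsto_const Q0]) auto
      have "\<forall>\<^sub>F k in sequentially. Q (r k) c \<omega> < 1" by (rule order_tendstoD(2)[OF Q0]) simp
      then show "\<forall>\<^sub>F k in sequentially. \<forall>s\<in>space R. Q (r k) s \<omega> \<le> 1"
      proof eventually_elim
        case (elim k)
        have "Q (r k) s \<omega> \<le> 1" if "s \<le> c" for s
          using order_trans[OF Qmono[OF that, of "r k" \<omega>] less_imp_le[OF elim]] .
        then show ?case by (simp add: spR)
      qed
    qed (use c1 c2 bd HR[OF om] oneR[OF om] in auto)
    have "g \<omega> \<le> (\<integral>s. of_bool (W s \<omega> \<le> ennreal n) \<partial>R)"
    proof (cases "W c \<omega> \<le> ennreal n")
      case True
      have "(\<integral>s. of_bool (W s \<omega> \<le> ennreal n) \<partial>R) = (\<integral>s. (1 :: real) \<partial>R)"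
        by (intro Bochner_Integration.integral_cong refl)
           (use True Wmono[of _ c \<omega>] in \<open>auto simp: spR intro: order_trans\<close>)
      then show ?thesis using mR ac by (simp add: g_def split: split_indicator)
    next
      case False
      then show ?thesis by (simp add: g_def)
    qed
    then have "(\<lambda>k. min (U (r k) \<omega>) (g \<omega>)) \<longlonglongrightarrow> g \<omega>"
      using tendsto_min[OF lim tendsto_const[of "g \<omega>"]] by (simp add: min_absorb2)
    then show ?case by (intro tendsto_mult_left)
  qed
  have [measurable]: "A \<in> sets M" using A sets_filtration_subset by auto
  have ib: "\<bar>indicator A \<omega> * min (U k \<omega>) (g \<omega>)\<bar> \<le> D0 + (c - a)" if om: "\<omega> \<in> space M" for k \<omega>
    using Ub[OF om, of k] gb[of \<omega>] ac by (auto simp: abs_le_iff min_def split: split_indicator)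
  have "(\<lambda>k. \<integral>\<omega>. indicator A \<omega> * min (U (r k) \<omega>) (g \<omega>) \<partial>M) \<longlonglongrightarrow> (\<integral>\<omega>. indicator A \<omega> * g \<omega> \<partial>M)"
    by (rule integral_dominated_convergence[where w = "\<lambda>_. D0 + (c - a)"])
       (use AEU ib in \<open>auto intro!: AE_I2 simp del: abs_mult\<close>)
  moreover have "(\<integral>\<omega>. indicator A \<omega> * min (U (r k) \<omega>) (g \<omega>) \<partial>M) \<le> S * measure M A" for k
  proof (rule order_trans[OF integral_mono US[of "r k"]])
    show "integrable M (\<lambda>\<omega>. indicator A \<omega> * min (U (r k) \<omega>) (g \<omega>))"
      by (rule integrable_const_bound[where B = "D0 + (c - a)"]) (use ib in \<open>auto intro!: AE_I2 simp del: abs_mult\<close>)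
    show "integrable M (\<lambda>\<omega>. indicator A \<omega> * U (r k) \<omega>)"
    proof (rule integrable_const_bound[where B = D0])
      show "AE \<omega> in M. norm (indicator A \<omega> * U (r k) \<omega>) \<le> D0"
        using Ub by (intro AE_I2) (force split: split_indicator)
    qed measurable
  qed (auto split: split_indicator)
  ultimately have "(\<integral>\<omega>. indicator A \<omega> * g \<omega> \<partial>M) \<le> S * measure M A"
    by (intro LIMSEQ_le_const2) auto
  moreover have "(\<integral>\<omega>. indicator A \<omega> * g \<omega> \<partial>M) = (\<integral>\<omega>. (c - a) * indicator (A \<inter> {\<omega> \<in> space M. W c \<omega> \<le> ennreal n}) \<omega> \<partial>M)"
    by (intro Bochner_Integration.integral_cong refl) (auto simp: g_def split: split_indicator)
  ultimately show "(c - a) * measure M (A \<inter> {\<omega> \<in> space M. W c \<omega> \<le> ennreal n}) \<le> S * measure M A"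
    by (simp add: Int_absorb1 sets.Int_space_eq2)
qed

text \<open>On \<open>E\<close> the weight \<open>W\<close> at time \<open>c\<close> reduces to \<open>\<integral> |b(X)|\<close>, which is almost surely finite, so the
  truncation at \<open>n\<close> disappears as \<open>n\<close> tends to infinity.\<close>

lemma exit_inequality:
  fixes f b \<sigma> :: "real \<Rightarrow> real" and X :: "real \<Rightarrow> 'a \<Rightarrow> real"
  assumes b[measurable]: "b \<in> borel_measurable borel"
    and \<sigma>_lb: "\<And>K. compact K \<Longrightarrow> bounded (\<sigma> ` K)"
    and sde: "sde_solution M F B b \<sigma> 0 X"
    and f_C2: "C2 f" and f_gen: "\<And>x. generator b \<sigma> f x = 1"
    and K: "0 < K" and S: "\<And>x y. \<bar>x\<bar> \<le> 2 * K \<Longrightarrow> \<bar>y\<bar> \<le> 2 * K \<Longrightarrow> f y - f x \<le> S"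
    and ac: "0 \<le> a" "a < c" and A: "A \<in> sets (F (ennreal a))"
    and E[measurable]: "E \<in> sets M" and EA: "E \<subseteq> A"
    and EK: "\<And>\<omega> s. \<omega> \<in> E \<Longrightarrow> 0 \<le> s \<Longrightarrow> s \<le> c \<Longrightarrow> \<bar>X s \<omega>\<bar> \<le> K"
  shows "(c - a) * measure M E \<le> S * measure M A"
proof -
  define W where "W \<omega> = (\<integral>\<^sup>+s\<in>{0..c}. (ennreal \<bar>b (X s \<omega>)\<bar> + (if K < \<bar>X s \<omega>\<bar> then \<infinity> else 0)) \<partial>lborel)" for \<omega>
  note tr = exit_inequality_truncated[OF b \<sigma>_lb sde f_C2 f_gen K S ac A]
  have Wm[measurable]: "W \<in> borel_measurable M" using tr(2)[of 0] by (simp add: W_def[abs_def])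
  have [measurable]: "A \<in> sets M" using A sets_filtration_subset by auto
  define E' where "E' n = E \<inter> {\<omega> \<in> space M. W \<omega> \<le> ennreal (real n)}" for n :: nat
  have E'm[measurable]: "E' n \<in> sets M" for n unfolding E'_def by measurable
  have bound: "(c - a) * measure M (E' n) \<le> S * measure M A" for n
  proof -
    have "measure M (E' n) \<le> measure M (A \<inter> {\<omega> \<in> space M. W \<omega> \<le> ennreal (real n)})"
      by (rule finite_measure_mono) (use EA in \<open>auto simp: E'_def\<close>)
    then have "(c - a) * measure M (E' n) \<le> (c - a) * measure M (A \<inter> {\<omega> \<in> space M. W \<omega> \<le> ennreal (real n)})"
      using ac by (intro mult_left_mono) auto
    also have "\<dots> \<le> S * measure M A" using tr(1)[of "real n"] by (simp add: W_def)
    finally show ?thesis .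
  qed
  have "incseq E'"
    by (intro incseq_SucI) (auto simp: E'_def elim!: order_trans intro!: ennreal_leI)
  then have "(\<lambda>n. measure M (E' n)) \<longlonglongrightarrow> measure M (\<Union>n. E' n)"
    by (intro finite_Lim_measure_incseq) auto
  then have "(\<lambda>n. (c - a) * measure M (E' n)) \<longlonglongrightarrow> (c - a) * measure M (\<Union>n. E' n)"
    by (rule tendsto_mult_left)
  then have "(c - a) * measure M (\<Union>n. E' n) \<le> S * measure M A"
    by (rule LIMSEQ_le_const2) (use bound in auto)
  moreover have "measure M E = measure M (\<Union>n. E' n)"
  proof (rule finite_measure_eq_AE)
    have "AE \<omega> in M. \<forall>t\<ge>0. set_integrable lborel {0..t} (\<lambda>s. b (X s \<omega>))"
      using sde by (simp add: sde_solution_def)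
    then show "AE \<omega> in M. \<omega> \<in> E \<longleftrightarrow> \<omega> \<in> (\<Union>n. E' n)"
      using AE_space
    proof eventually_elim
      case (elim \<omega>)
      have "\<exists>n. W \<omega> \<le> ennreal (real n)" if "\<omega> \<in> E"
      proof -
        have "integrable lborel (\<lambda>s. indicator {0..c} s * b (X s \<omega>))"
          using elim(1) ac by (simp add: set_integrable_def)
        then have fin: "(\<integral>\<^sup>+s. ennreal (norm (indicator {0..c} s * b (X s \<omega>))) \<partial>lborel) < \<infinity>"
          by (simp add: integrable_iff_bounded)
        have "W \<omega> = (\<integral>\<^sup>+s. ennreal (norm (indicator {0..c} s * b (X s \<omega>))) \<partial>lborel)"
          unfolding W_def by (intro nn_integral_cong) (use EK[OF that] in \<open>auto simp: not_less[symmetric] split: split_indicator\<close>)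
        then have "W \<omega> < \<infinity>" using fin by simp
        then obtain y where y: "W \<omega> = ennreal y" "0 \<le> y" by (cases "W \<omega>") auto
        obtain n :: nat where "y \<le> real n" using real_arch_simple by blast
        then show ?thesis using y by (auto intro!: exI[of _ n] ennreal_leI)
      qed
      then show ?case using elim(2) by (auto simp: E'_def)
    qed
  qed auto
  ultimately show ?thesis by simp
qed

end

section \<open>Moderate functions and the good-lambda argument\<close>

lemma moderateD:
  assumes "moderate F"
  shows "0 \<le> x \<Longrightarrow> 0 \<le> F x" and "0 \<le> x \<Longrightarrow> x \<le> y \<Longrightarrow> F x \<le> F y"
    and "F 0 = 0" and "continuous_on {0..} F"
proof -
  have F: "F \<in> {0..} \<rightarrow> {0..}" "continuous_on {0..} F" "mono_on {0..} F" "F 0 = 0"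
    using assms unfolding moderate_def by blast+
  show "0 \<le> x \<Longrightarrow> 0 \<le> F x" using F(1) by auto
  show "0 \<le> x \<Longrightarrow> x \<le> y \<Longrightarrow> F x \<le> F y" using mono_onD[OF F(3), of x y] by simp
  show "F 0 = 0" "continuous_on {0..} F" by (fact F)+
qed

text \<open>Iterate the defining inequality until the power of the dilation factor exceeds \<open>K\<close>.\<close>

lemma moderate_dilation_bound:
  assumes F: "moderate F" and K: "0 \<le> K"
  shows "\<exists>C\<ge>1. \<forall>x\<ge>0. F (K * x) \<le> C * F x"
proof -
  have Fn: "0 \<le> F x" if "0 \<le> x" for x using moderateD(1)[OF F] that by simp
  have Fm: "F x \<le> F y" if "0 \<le> x" "x \<le> y" for x y
    using moderateD(2)[OF F] that by simp
  have F0: "F 0 = 0" using moderateD(3)[OF F] .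
  obtain B where B: "1 < B" and fin: "(SUP x\<in>{0<..}. moderate_ratio (F (B * x)) (F x)) < \<infinity>"
    using F unfolding moderate_def by blast
  obtain D where D: "(SUP x\<in>{0<..}. moderate_ratio (F (B * x)) (F x)) = ennreal D" "0 \<le> D"
    using fin by (cases "SUP x\<in>{0<..}. moderate_ratio (F (B * x)) (F x)") auto
  define E where "E = max 1 D"
  have one: "F (B * x) \<le> E * F x" if x: "0 \<le> x" for x
  proof (cases "x = 0")
    case False
    then have "moderate_ratio (F (B * x)) (F x) \<le> ennreal D"
      unfolding D(1)[symmetric] using x by (intro SUP_upper) auto
    moreover have "0 \<le> F x" "0 \<le> F (B * x)" using Fn x B by auto
    ultimately have "F (B * x) \<le> D * F x"
      using D(2) by (auto simp: moderate_ratio_def top_unique field_simps split: if_splits)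
    also have "\<dots> \<le> E * F x" using Fn[OF x] by (intro mult_right_mono) (auto simp: E_def)
    finally show ?thesis .
  qed (simp add: F0)
  have pow: "F (B ^ n * x) \<le> E ^ n * F x" if x: "0 \<le> x" for n x
  proof (induction n)
    case (Suc n)
    have "F (B ^ Suc n * x) \<le> E * F (B ^ n * x)" using one[of "B ^ n * x"] x B by (simp add: mult.assoc)
    also have "\<dots> \<le> E * (E ^ n * F x)" using Suc by (intro mult_left_mono) (auto simp: E_def)
    finally show ?case by (simp add: mult.assoc)
  qed simp
  obtain n where n: "max K 0 < B ^ n" using real_arch_pow[OF B] by blast
  show ?thesis
  proof (intro exI[of _ "E ^ n"] conjI allI impI)
    show "1 \<le> E ^ n" by (simp add: E_def)
    fix x :: real assume x: "0 \<le> x"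
    show "F (K * x) \<le> E ^ n * F x"
    proof -
      have "F (K * x) \<le> F (B ^ n * x)" using x n K by (intro Fm mult_right_mono) auto
      then show ?thesis using pow[OF x, of n] by linarith
    qed
  qed
qed

lemma moderate_clamped_continuous:
  assumes F: "moderate F"
  shows "continuous_on UNIV (\<lambda>x. F (max 0 x))"
  by (rule continuous_on_compose2[OF moderateD(4)[OF F]]) (auto intro!: continuous_intros)

lemma extend_infty_measurable:
  assumes F: "moderate F"
  shows "extend_infty F \<in> borel_measurable borel"
proof -
  have [measurable]: "(\<lambda>x. F (max 0 x)) \<in> borel_measurable borel"
    by (rule borel_measurable_continuous_onI[OF moderate_clamped_continuous[OF F]])
  have "extend_infty F = (\<lambda>t. if t = \<infinity> then extend_infty F \<infinity> else ennreal (F (max 0 (enn2real t))))"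
    by (auto simp: extend_infty_def fun_eq_iff max_def)
  also have "\<dots> \<in> borel_measurable borel" by measurable
  finally show ?thesis .
qed

text \<open>The Stieltjes measure \<open>dF\<close>. It represents \<open>F(x)\<close> as a mixture over levels \<open>l\<close> of the indicators
  of \<open>l \<le> x\<close>, which turns expectations of \<open>F\<close> into integrals of tail probabilities.\<close>

lemma moderate_level_measure:
  assumes F: "moderate F"
  defines "\<mu> \<equiv> interval_measure (\<lambda>x. F (max 0 x))"
  shows "sigma_finite_measure \<mu>" and "sets \<mu> = sets borel"
    and "0 \<le> x \<Longrightarrow> emeasure \<mu> {0<..x} = ennreal (F x)"
    and "emeasure \<mu> {0<..} \<le> extend_infty F \<infinity>"
proof -
  note Fc = moderate_clamped_continuous[OF F]
  have Fm: "F (max 0 x) \<le> F (max 0 y)" if "x \<le> y" for x y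
    using that by (intro moderateD(2)[OF F]) auto
  have rc: "continuous (at_right a) (\<lambda>x. F (max 0 x))" for a
    by (rule continuous_at_imp_continuous_within) (use Fc in \<open>simp add: continuous_on_eq_continuous_at\<close>)
  show "sigma_finite_measure \<mu>" unfolding \<mu>_def by (rule sigma_finite_interval_measure[OF Fm rc])
  show "sets \<mu> = sets borel" by (simp add: \<mu>_def)
  show Ioc: "emeasure \<mu> {0<..x} = ennreal (F x)" if "0 \<le> x" for x
    unfolding \<mu>_def using emeasure_interval_measure_Ioc[OF that Fm rc] moderateD(3)[OF F] that by (simp add: max_def)
  have "{0::real<..} = (\<Union>n. {0<..real n})" by (auto intro: real_arch_simple)
  then have "emeasure \<mu> {0<..} = (SUP n. emeasure \<mu> {0<..real n})"
    by (simp only:) (rule SUP_emeasure_incseq[symmetric], auto simp: \<mu>_def incseq_def)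
  also have "\<dots> \<le> extend_infty F \<infinity>"
    by (intro SUP_least) (auto simp: Ioc extend_infty_def intro!: SUP_upper)
  finally show "emeasure \<mu> {0<..} \<le> extend_infty F \<infinity>" .
qed

text \<open>Integrate the good-lambda inequality over the levels \<open>l\<close> against \<open>dF\<close>. With \<open>a = E F(V / \<beta>)\<close>
  this gives \<open>a \<le> E F(V) / (2 D1) + E F(U / \<delta>)\<close>, and \<open>E F(V) \<le> D1 a\<close>; hence
  \<open>a \<le> a / 2 + E F(U / \<delta>)\<close>. The bound on \<open>V\<close> makes \<open>a\<close> finite, so that \<open>a / 2\<close> can be
  subtracted.\<close>

lemma (in prob_space) good_lambda_moderate:
  fixes U :: "'a \<Rightarrow> ennreal" and V :: "'a \<Rightarrow> real"
  assumes F: "moderate F"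
    and U[measurable]: "U \<in> borel_measurable M" and V[measurable]: "V \<in> borel_measurable M"
    and Vb: "\<And>\<omega>. 0 \<le> V \<omega>" "\<And>\<omega>. V \<omega> \<le> Vmax"
    and \<beta>: "0 < \<beta>" and \<delta>: "0 < \<delta>"
    and D1: "1 \<le> D1" "\<And>x. 0 \<le> x \<Longrightarrow> F (\<beta> * x) \<le> D1 * F x"
    and D2: "1 \<le> D2" "\<And>x. 0 \<le> x \<Longrightarrow> F (1 / \<delta> * x) \<le> D2 * F x"
    and gl: "\<And>l. 0 < l \<Longrightarrow> measure M {\<omega> \<in> space M. \<beta> * l \<le> V \<omega> \<and> U \<omega> < ennreal (\<delta> * l)}
        \<le> 1 / (2 * D1) * measure M {\<omega> \<in> space M. l \<le> V \<omega>}"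
  shows "(\<integral>\<^sup>+\<omega>. ennreal (F (V \<omega>)) \<partial>M) \<le> ennreal (2 * D1 * D2) * (\<integral>\<^sup>+\<omega>. extend_infty F (U \<omega>) \<partial>M)"
proof -
  define \<mu> where "\<mu> = interval_measure (\<lambda>x. F (max 0 x))"
  note mu = moderate_level_measure[OF F, folded \<mu>_def]
  interpret \<mu>: sigma_finite_measure \<mu> by (rule mu(1))
  interpret P: pair_sigma_finite M \<mu> by (intro pair_sigma_finite.intro sigma_finite_measure_axioms mu(1))
  have Fn: "0 \<le> F x" if "0 \<le> x" for x using moderateD(1)[OF F] that by simp
  have Fm: "F x \<le> F y" if "0 \<le> x" "x \<le> y" for x y
    using moderateD(2)[OF F] that by simp
  note [measurable_cong] = mu(2)
  have layer: "(\<integral>\<^sup>+\<omega>. emeasure \<mu> {l. 0 < l \<and> p l \<omega>} \<partial>M) = (\<integral>\<^sup>+l. indicator {0<..} l * emeasure M {\<omega> \<in> space M. p l \<omega>} \<partial>\<mu>)"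
    if [measurable]: "Measurable.pred (M \<Otimes>\<^sub>M \<mu>) (\<lambda>(\<omega>, l). p l \<omega>)" for p :: "real \<Rightarrow> 'a \<Rightarrow> bool"
  proof -
    define h where "h = (\<lambda>(\<omega>, l). indicator {0<..} l * (indicator {x. case x of (\<omega>, l) \<Rightarrow> p l \<omega>} (\<omega>, l)) :: ennreal)"
    have hm: "h \<in> borel_measurable (M \<Otimes>\<^sub>M \<mu>)"
    proof -
      have "Measurable.pred (M \<Otimes>\<^sub>M \<mu>) (\<lambda>x. 0 < snd x \<and> (case x of (\<omega>, l) \<Rightarrow> p l \<omega>))" by measurable
      then have "(\<lambda>x. indicator {x \<in> space (M \<Otimes>\<^sub>M \<mu>). 0 < snd x \<and> (case x of (\<omega>, l) \<Rightarrow> p l \<omega>)} x :: ennreal) \<in> borel_measurable (M \<Otimes>\<^sub>M \<mu>)"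
        by (intro borel_measurable_indicator) (simp add: pred_def)
      then show ?thesis
        by (rule measurable_cong[THEN iffD1, rotated]) (auto simp: h_def indicator_def)
    qed
    have "(\<integral>\<^sup>+\<omega>. emeasure \<mu> {l. 0 < l \<and> p l \<omega>} \<partial>M) = (\<integral>\<^sup>+\<omega>. (\<integral>\<^sup>+l. h (\<omega>, l) \<partial>\<mu>) \<partial>M)"
    proof (rule nn_integral_cong)
      fix \<omega> assume om: "\<omega> \<in> space M"
      have "(\<lambda>l. p l \<omega>) = (\<lambda>l. (\<lambda>(\<omega>, l). p l \<omega>) (\<omega>, l))" by simp
      then have "Measurable.pred \<mu> (\<lambda>l. p l \<omega>)" using measurable_compose[OF measurable_Pair1'[OF om] that] by simp
      then have "{l \<in> space \<mu>. 0 < l \<and> p l \<omega>} \<in> sets \<mu>" by measurable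
      then have "{l. 0 < l \<and> p l \<omega>} \<in> sets \<mu>" by (simp add: \<mu>_def)
      from nn_integral_indicator[OF this]
      have "emeasure \<mu> {l. 0 < l \<and> p l \<omega>} = (\<integral>\<^sup>+l. indicator {l. 0 < l \<and> p l \<omega>} l \<partial>\<mu>)" by simp
      also have "\<dots> = (\<integral>\<^sup>+l. h (\<omega>, l) \<partial>\<mu>)" by (intro nn_integral_cong) (auto simp: h_def indicator_def)
      finally show "emeasure \<mu> {l. 0 < l \<and> p l \<omega>} = (\<integral>\<^sup>+l. h (\<omega>, l) \<partial>\<mu>)" .
    qed
    also have "\<dots> = (\<integral>\<^sup>+l. (\<integral>\<^sup>+\<omega>. h (\<omega>, l) \<partial>M) \<partial>\<mu>)" by (rule P.Fubini'[symmetric]) (use hm in simp)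
    also have "\<dots> = (\<integral>\<^sup>+l. indicator {0<..} l * emeasure M {\<omega> \<in> space M. p l \<omega>} \<partial>\<mu>)"
    proof (rule nn_integral_cong)
      fix l assume l: "l \<in> space \<mu>"
      have "Measurable.pred M (p l)" using measurable_compose[OF measurable_Pair2'[OF l] that] by simp
      then have S: "{\<omega> \<in> space M. p l \<omega>} \<in> sets M" by measurable
      have "(\<integral>\<^sup>+\<omega>. h (\<omega>, l) \<partial>M) = (\<integral>\<^sup>+\<omega>. indicator {0<..} l * indicator {\<omega> \<in> space M. p l \<omega>} \<omega> \<partial>M)"
        by (intro nn_integral_cong) (auto simp: h_def indicator_def)
      also have "\<dots> = indicator {0<..} l * emeasure M {\<omega> \<in> space M. p l \<omega>}"
        using S by (simp add: nn_integral_cmult)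
      finally show "(\<integral>\<^sup>+\<omega>. h (\<omega>, l) \<partial>M) = indicator {0<..} l * emeasure M {\<omega> \<in> space M. p l \<omega>}" .
    qed
    finally show ?thesis .
  qed
  define a where "a = (\<integral>\<^sup>+\<omega>. ennreal (F (V \<omega> / \<beta>)) \<partial>M)"
  define b where "b = (\<integral>\<^sup>+\<omega>. extend_infty F (U \<omega>) \<partial>M)"
  have Va: "emeasure \<mu> {l. 0 < l \<and> \<beta> * l \<le> V \<omega>} = ennreal (F (V \<omega> / \<beta>))" for \<omega>
  proof -
    have "{l. 0 < l \<and> \<beta> * l \<le> V \<omega>} = {0<..V \<omega> / \<beta>}" using \<beta> by (auto simp: field_simps)
    then show ?thesis using mu(3)[of "V \<omega> / \<beta>"] Vb(1)[of \<omega>] \<beta> by simp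
  qed
  have V1: "emeasure \<mu> {l. 0 < l \<and> l \<le> V \<omega>} = ennreal (F (V \<omega>))" for \<omega>
    using mu(3)[of "V \<omega>"] Vb(1)[of \<omega>] by (simp add: greaterThanAtMost_def greaterThan_def atMost_def Collect_conj_eq)
  have UC: "emeasure \<mu> {l. 0 < l \<and> ennreal (\<delta> * l) \<le> U \<omega>} \<le> ennreal D2 * extend_infty F (U \<omega>)" for \<omega>
  proof (cases "U \<omega>")
    case (real u)
    have "{l. 0 < l \<and> ennreal (\<delta> * l) \<le> U \<omega>} = {0<..1 / \<delta> * u}" using real \<delta> by (auto simp: field_simps ennreal_le_iff)
    then have "emeasure \<mu> {l. 0 < l \<and> ennreal (\<delta> * l) \<le> U \<omega>} = ennreal (F (1 / \<delta> * u))"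
      using mu(3)[of "1 / \<delta> * u"] real \<delta> by simp
    also have "\<dots> \<le> ennreal (D2 * F u)" using D2(2) real by (intro ennreal_leI) auto
    also have "\<dots> = ennreal D2 * extend_infty F (U \<omega>)"
      using real D2 Fn by (simp add: extend_infty_def ennreal_mult)
    finally show ?thesis .
  next
    case top
    have "1 * emeasure \<mu> {0<..} \<le> ennreal D2 * extend_infty F \<infinity>"
      using D2(1) mu(4) by (intro mult_mono) (auto simp: ennreal_1[symmetric] simp del: ennreal_1 intro!: ennreal_leI)
    then show ?thesis using top by (simp add: greaterThan_def)
  qed
  have "a = (\<integral>\<^sup>+l. indicator {0<..} l * emeasure M {\<omega> \<in> space M. \<beta> * l \<le> V \<omega>} \<partial>\<mu>)"
    unfolding a_def Va[symmetric] by (rule layer) measurable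
  also have "\<dots> \<le> (\<integral>\<^sup>+l. ennreal (1 / (2 * D1)) * (indicator {0<..} l * emeasure M {\<omega> \<in> space M. l \<le> V \<omega>})
      + indicator {0<..} l * emeasure M {\<omega> \<in> space M. ennreal (\<delta> * l) \<le> U \<omega>} \<partial>\<mu>)"
  proof (rule nn_integral_mono)
    fix l
    show "indicator {0<..} l * emeasure M {\<omega> \<in> space M. \<beta> * l \<le> V \<omega>} \<le> ennreal (1 / (2 * D1)) * (indicator {0<..} l * emeasure M {\<omega> \<in> space M. l \<le> V \<omega>})
      + indicator {0<..} l * emeasure M {\<omega> \<in> space M. ennreal (\<delta> * l) \<le> U \<omega>}"
    proof (cases "0 < l")
      case True
      have "measure M {\<omega> \<in> space M. \<beta> * l \<le> V \<omega>} \<le> measure M ({\<omega> \<in> space M. \<beta> * l \<le> V \<omega> \<and> U \<omega> < ennreal (\<delta> * l)} \<union> {\<omega> \<in> space M. ennreal (\<delta> * l) \<le> U \<omega>})"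
        by (rule finite_measure_mono) auto
      also have "\<dots> \<le> measure M {\<omega> \<in> space M. \<beta> * l \<le> V \<omega> \<and> U \<omega> < ennreal (\<delta> * l)} + measure M {\<omega> \<in> space M. ennreal (\<delta> * l) \<le> U \<omega>}"
        by (rule measure_Un_le) auto
      also have "\<dots> \<le> 1 / (2 * D1) * measure M {\<omega> \<in> space M. l \<le> V \<omega>} + measure M {\<omega> \<in> space M. ennreal (\<delta> * l) \<le> U \<omega>}"
        using gl[OF True] by simp
      finally have "ennreal (measure M {\<omega> \<in> space M. \<beta> * l \<le> V \<omega>}) \<le> ennreal (1 / (2 * D1) * measure M {\<omega> \<in> space M. l \<le> V \<omega>} + measure M {\<omega> \<in> space M. ennreal (\<delta> * l) \<le> U \<omega>})"
        by (rule ennreal_leI)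
      then show ?thesis using True D1(1)
        by (simp add: emeasure_eq_measure ennreal_mult[symmetric] ennreal_plus[symmetric] del: ennreal_plus)
    qed simp
  qed
  also have "\<dots> = ennreal (1 / (2 * D1)) * (\<integral>\<^sup>+l. indicator {0<..} l * emeasure M {\<omega> \<in> space M. l \<le> V \<omega>} \<partial>\<mu>)
      + (\<integral>\<^sup>+l. indicator {0<..} l * emeasure M {\<omega> \<in> space M. ennreal (\<delta> * l) \<le> U \<omega>} \<partial>\<mu>)"
    by (subst nn_integral_add) (auto simp: nn_integral_cmult)
  also have "(\<integral>\<^sup>+l. indicator {0<..} l * emeasure M {\<omega> \<in> space M. l \<le> V \<omega>} \<partial>\<mu>) = (\<integral>\<^sup>+\<omega>. ennreal (F (V \<omega>)) \<partial>M)"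
    unfolding V1[symmetric] by (rule layer[symmetric]) measurable
  also have "(\<integral>\<^sup>+l. indicator {0<..} l * emeasure M {\<omega> \<in> space M. ennreal (\<delta> * l) \<le> U \<omega>} \<partial>\<mu>) = (\<integral>\<^sup>+\<omega>. emeasure \<mu> {l. 0 < l \<and> ennreal (\<delta> * l) \<le> U \<omega>} \<partial>M)"
    by (rule layer[symmetric]) measurable
  also have "(\<integral>\<^sup>+\<omega>. emeasure \<mu> {l. 0 < l \<and> ennreal (\<delta> * l) \<le> U \<omega>} \<partial>M) \<le> ennreal D2 * b"
  proof -
    note [measurable] = extend_infty_measurable[OF F]
    have "(\<integral>\<^sup>+\<omega>. emeasure \<mu> {l. 0 < l \<and> ennreal (\<delta> * l) \<le> U \<omega>} \<partial>M) \<le> (\<integral>\<^sup>+\<omega>. ennreal D2 * extend_infty F (U \<omega>) \<partial>M)"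
      by (intro nn_integral_mono UC)
    then show ?thesis by (simp add: nn_integral_cmult b_def)
  qed
  finally have ab: "a \<le> ennreal (1 / (2 * D1)) * (\<integral>\<^sup>+\<omega>. ennreal (F (V \<omega>)) \<partial>M) + ennreal D2 * b"
    by (simp add: add_left_mono)
  have FV: "(\<integral>\<^sup>+\<omega>. ennreal (F (V \<omega>)) \<partial>M) \<le> ennreal D1 * a"
  proof -
    have [measurable]: "(\<lambda>x. F (max 0 x)) \<in> borel_measurable borel"
      by (rule borel_measurable_continuous_onI[OF moderate_clamped_continuous[OF F]])
    have "(\<lambda>\<omega>. ennreal (F (max 0 (V \<omega> / \<beta>)))) \<in> borel_measurable M" by measurable
    then have [measurable]: "(\<lambda>\<omega>. ennreal (F (V \<omega> / \<beta>))) \<in> borel_measurable M"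
      using Vb(1) \<beta> by (simp add: max_def)
    have "(\<integral>\<^sup>+\<omega>. ennreal (F (V \<omega>)) \<partial>M) \<le> (\<integral>\<^sup>+\<omega>. ennreal D1 * ennreal (F (V \<omega> / \<beta>)) \<partial>M)"
    proof (rule nn_integral_mono)
      fix \<omega>
      have "F (\<beta> * (V \<omega> / \<beta>)) \<le> D1 * F (V \<omega> / \<beta>)" using D1(2)[of "V \<omega> / \<beta>"] Vb(1)[of \<omega>] \<beta> by simp
      then have "ennreal (F (V \<omega>)) \<le> ennreal (D1 * F (V \<omega> / \<beta>))" using \<beta> by (intro ennreal_leI) simp
      then show "ennreal (F (V \<omega>)) \<le> ennreal D1 * ennreal (F (V \<omega> / \<beta>))"
        using D1(1) Fn[of "V \<omega> / \<beta>"] Vb(1)[of \<omega>] \<beta> by (simp add: ennreal_mult)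
    qed
    also have "\<dots> = ennreal D1 * a" unfolding a_def by (rule nn_integral_cmult) measurable
    finally show ?thesis .
  qed
  have afin: "a < \<infinity>"
  proof -
    have "a \<le> (\<integral>\<^sup>+\<omega>. ennreal (F (Vmax / \<beta>)) \<partial>M)"
      unfolding a_def using Vb \<beta> by (intro nn_integral_mono ennreal_leI Fm divide_right_mono) auto
    also have "\<dots> < \<infinity>" by (simp add: emeasure_space_1)
    finally show ?thesis .
  qed
  have "a \<le> ennreal (2 * D2) * b"
  proof (cases b)
    case (real br)
    obtain ar where ar: "a = ennreal ar" "0 \<le> ar" using afin by (cases a) auto
    have "ennreal (1 / (2 * D1)) * (\<integral>\<^sup>+\<omega>. ennreal (F (V \<omega>)) \<partial>M) \<le> ennreal (1 / (2 * D1)) * (ennreal D1 * a)"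
      by (rule mult_left_mono[OF FV]) simp
    also have "\<dots> = ennreal (ar / 2)" using D1 ar by (simp add: ennreal_mult[symmetric])
    finally have "ennreal ar \<le> ennreal (ar / 2) + ennreal D2 * ennreal br"
      using ab unfolding ar(1) real(2) by (meson add_right_mono order_trans)
    also have "\<dots> = ennreal (ar / 2 + D2 * br)" using ar real D2 by (simp add: ennreal_mult ennreal_plus)
    finally have "ar \<le> ar / 2 + D2 * br" using ar real D2 by (subst (asm) ennreal_le_iff) auto
    then have "ar \<le> 2 * D2 * br" by simp
    then show ?thesis using ar real D2 by (simp add: ennreal_mult[symmetric] ennreal_leI)
  next
    case top
    then show ?thesis using D2 by (simp add: ennreal_mult_top)
  qed
  then have "ennreal D1 * a \<le> ennreal D1 * (ennreal (2 * D2) * b)" by (rule mult_left_mono) simp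
  also have "\<dots> = ennreal (2 * D1 * D2) * b" using D1 D2 by (simp add: ennreal_mult ac_simps)
  finally show ?thesis using FV unfolding b_def by (rule order_trans[rotated])
qed

section \<open>The running maximum and the inequality\<close>

text \<open>Fractions approach a time \<open>s < t\<close> from above without leaving \<open>[0, t]\<close>. The end point \<open>s = t\<close> is
  approached by such times from below, except for \<open>t = 0\<close>, which is itself a fraction.\<close>

lemma running_max_countable:
  fixes X :: "real \<Rightarrow> 'a \<Rightarrow> real"
  assumes cont: "continuous_on {0..} (\<lambda>t. X t \<omega>)"
  shows "running_max X t \<omega> = (SUP (i, j). if ennreal (real i / real (Suc j)) \<le> t then ennreal \<bar>X (real i / real (Suc j)) \<omega>\<bar> else 0)"
    (is "_ = ?R")
proof (rule antisym)
  show "?R \<le> running_max X t \<omega>"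
    unfolding running_max_def by (intro SUP_least) (auto intro!: SUP_upper)
  have lim_le: "ennreal \<bar>X s \<omega>\<bar> \<le> ?R"
    if s: "0 \<le> s" and d: "d \<longlonglongrightarrow> s" "\<And>m. 0 \<le> d m" and ev: "\<forall>\<^sub>F m in sequentially. ennreal \<bar>X (d m) \<omega>\<bar> \<le> ?R" for s d
  proof (rule tendsto_upperbound[OF _ ev])
    have "(\<lambda>m. X (d m) \<omega>) \<longlonglongrightarrow> X s \<omega>"
      by (rule continuous_on_tendsto_compose[OF cont d(1)]) (use s d(2) in auto)
    then show "(\<lambda>m. ennreal \<bar>X (d m) \<omega>\<bar>) \<longlonglongrightarrow> ennreal \<bar>X s \<omega>\<bar>" by (intro tendsto_ennrealI tendsto_rabs)
  qed simp
  have below: "ennreal \<bar>X s \<omega>\<bar> \<le> ?R" if s: "0 \<le> s" "ennreal s < t" for s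
  proof -
    let ?d = "\<lambda>m. min (s + 1) (real (nat \<lceil>s * real (Suc m)\<rceil>) / real (Suc m))"
    have l: "?d \<longlonglongrightarrow> s" by (rule fraction_approx_tendsto) (use s in auto)
    have "\<forall>\<^sub>F m in sequentially. ennreal (?d m) < t"
      by (rule order_tendstoD(2)[OF tendsto_ennrealI[OF l] s(2)])
    moreover have "\<forall>\<^sub>F m in sequentially. ?d m < s + 1" by (rule order_tendstoD(2)[OF l]) simp
    ultimately have ev: "\<forall>\<^sub>F m in sequentially. ennreal \<bar>X (?d m) \<omega>\<bar> \<le> ?R"
    proof eventually_elim
      case (elim m)
      then have eq: "?d m = real (nat \<lceil>s * real (Suc m)\<rceil>) / real (Suc m)" by (simp add: min_def split: if_splits)
      show ?case
        using elim(1) unfolding eq by (intro SUP_upper2[of "(nat \<lceil>s * real (Suc m)\<rceil>, m)"]) auto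
    qed
    have "0 \<le> min (s + 1) (real i / real (Suc m))" for i m :: nat using s by simp
    then show ?thesis using lim_le[OF s(1) l _ ev] by blast
  qed
  show "running_max X t \<omega> \<le> ?R"
    unfolding running_max_def
  proof (rule SUP_least)
    fix s assume "s \<in> {s. 0 \<le> s \<and> ennreal s \<le> t}"
    then have s: "0 \<le> s" "ennreal s \<le> t" by auto
    show "ennreal \<bar>X s \<omega>\<bar> \<le> ?R"
    proof (cases "s = 0")
      case True
      then show ?thesis using s(2) by (intro SUP_upper2[of "(0, 0)"]) auto
    next
      case False
      let ?d = "\<lambda>m. s - s * (1 / real (Suc m))"
      have l0: "(\<lambda>m. 1 / real (Suc m)) \<longlonglongrightarrow> 0"
        using LIMSEQ_inverse_real_of_nat by (simp add: inverse_eq_divide)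
      have l: "?d \<longlonglongrightarrow> s" using tendsto_diff[OF tendsto_const tendsto_mult_left[OF l0], of s s] by simp
      have d: "0 \<le> ?d m" "?d m < s" for m using s False by (auto simp: field_simps)
      have "ennreal (?d m) < t" for m
        using d[of m] s by (intro less_le_trans[OF ennreal_lessI s(2)]) auto
      then have "\<forall>\<^sub>F m in sequentially. ennreal \<bar>X (?d m) \<omega>\<bar> \<le> ?R"
        using below[OF d(1)] by (intro always_eventually) blast
      then show ?thesis by (rule lim_le[OF s(1) l d(1)])
    qed
  qed
qed

lemma (in filtered_prob_space) running_max_measurable:
  fixes X :: "real \<Rightarrow> 'a \<Rightarrow> real"
  assumes X: "adapted_process F X" "continuous_paths M X" and T[measurable]: "T \<in> borel_measurable M"
  shows "(\<lambda>\<omega>. running_max X (T \<omega>) \<omega>) \<in> borel_measurable M"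
proof (rule measurable_cong[THEN iffD2])
  show "running_max X (T \<omega>) \<omega> = (SUP (i, j). if ennreal (real i / real (Suc j)) \<le> T \<omega> then ennreal \<bar>X (real i / real (Suc j)) \<omega>\<bar> else 0)"
    if "\<omega> \<in> space M" for \<omega>
    using X(2) that by (intro running_max_countable) (simp add: continuous_paths_def)
  have [measurable]: "X (real i / real (Suc j)) \<in> borel_measurable M" for i j
  proof (rule measurable_filtration)
    show "X (real i / real (Suc j)) \<in> borel_measurable (F (ennreal (real i / real (Suc j))))"
      using X(1) by (simp add: adapted_process_def)
  qed
  show "(\<lambda>\<omega>. SUP (i, j). if ennreal (real i / real (Suc j)) \<le> T \<omega> then ennreal \<bar>X (real i / real (Suc j)) \<omega>\<bar> else 0) \<in> borel_measurable M"
    unfolding case_prod_beta' by measurable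
qed

text \<open>Allows \<open>\<tau>\<close> to be replaced by \<open>min \<tau> n\<close>; at \<open>t = \<infinity>\<close> it uses that \<open>g\<close> is unbounded.\<close>

lemma extend_infty_compose_le_SUP:
  fixes F g :: "real \<Rightarrow> real"
  assumes F: "moderate F" and g_mono: "strict_mono_on {0..} g" and g_onto: "g ` {0..} = {0..}"
  shows "extend_infty F (extend_infty g t) \<le> (SUP n::nat. ennreal (F (g (enn2real (min t (ennreal (real n)))))))"
    (is "_ \<le> ?R")
proof (cases "t = \<infinity>")
  case True
  have "extend_infty g t = \<infinity>"
  proof (rule ccontr)
    assume "extend_infty g t \<noteq> \<infinity>"
    then obtain r where r: "extend_infty g t = ennreal r" "0 \<le> r" by (cases "extend_infty g t") auto
    obtain y where y: "0 \<le> y" "g y = r + 1" using g_onto r(2) by (metis add_increasing2 atLeast_iff imageE zero_le_one)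
    have "ennreal (g y) \<le> extend_infty g t" using True y(1) by (auto simp: extend_infty_def intro!: SUP_upper)
    then show False using r y by (simp add: ennreal_le_iff)
  qed
  then have "extend_infty F (extend_infty g t) = (SUP s\<in>{0..}. ennreal (F s))" by (simp add: extend_infty_def)
  also have "\<dots> \<le> ?R"
  proof (rule SUP_least)
    fix s :: real assume s: "s \<in> {0..}"
    then obtain y where y: "0 \<le> y" "g y = s" using g_onto by (metis atLeast_iff imageE)
    obtain n :: nat where n: "y \<le> real n" using real_arch_simple by blast
    have "F s \<le> F (g (real n))"
      using s y n strict_mono_on_leD[OF g_mono, of y "real n"] by (intro moderateD(2)[OF F]) auto
    then show "ennreal (F s) \<le> ?R" using True by (intro SUP_upper2[of n]) (auto intro: ennreal_leI)
  qed
  finally show ?thesis .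
next
  case False
  then obtain y where y: "t = ennreal y" "0 \<le> y" by (cases t) auto
  obtain n :: nat where n: "y \<le> real n" using real_arch_simple by blast
  have gy: "0 \<le> g y" using g_onto y(2) by (metis atLeast_iff imageI)
  have "min t (ennreal (real n)) = ennreal y" using y n by (simp add: min_def ennreal_leI)
  then show ?thesis using y gy by (intro SUP_upper2[of n]) (auto simp: extend_infty_def)
qed

theorem theorem2p4:
  fixes M :: "'a measure" and \<F> :: "ennreal \<Rightarrow> 'a measure"
    and B X :: "real \<Rightarrow> 'a \<Rightarrow> real"
    and N :: "real \<Rightarrow> 'w measure" and \<G> :: "real \<Rightarrow> ennreal \<Rightarrow> 'w measure"
    and W Y :: "real \<Rightarrow> real \<Rightarrow> 'w \<Rightarrow> real"
    and P :: "real \<Rightarrow> real \<Rightarrow> real measure"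
    and b \<sigma> f g :: "real \<Rightarrow> real"
  assumes b: "b \<in> borel_measurable borel"
    and \<sigma>_nonneg: "\<And>x. 0 \<le> \<sigma> x"
    and \<sigma>_locally_bounded: "\<And>K. compact K \<Longrightarrow> bounded (\<sigma> ` K)"
    and P: "transition_semigroup P"
    and X: "diffusion M \<F> B b \<sigma> P 0 X"
    and Y: "\<And>x. diffusion (N x) (\<G> x) (W x) b \<sigma> P x (Y x)"
    and g_mono: "strict_mono_on {0..} g"
    and g_cont: "continuous_on {0..} g"
    and g_0: "g 0 = 0"
    and g_onto: "g ` {0..} = {0..}"
    and f_C2: "C2 f"
    and f_gen: "\<And>x. generator b \<sigma> f x = 1"
    and f_0: "f 0 = 0"
    and lim: "\<exists>\<beta>>1. ((\<lambda>\<delta>. SUP (l, x, y)\<in>{(l, x, y). 0 < l \<and> \<bar>x\<bar> < \<delta> * l \<and> \<bar>y\<bar> < \<delta> * l}.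
        ereal ((f y - f x) / (the_inv_into {0..} g (\<beta> * l) - the_inv_into {0..} g l)))
        \<longlongrightarrow> 0) (at_right 0)"
  shows "\<forall>F. moderate F \<longrightarrow> (\<exists>c>0. \<forall>\<tau>. stopping_time \<F> \<tau> \<longrightarrow>
           (\<integral>\<^sup>+\<omega>. extend_infty F (running_max X (\<tau> \<omega>) \<omega>) \<partial>M)
             \<ge> ennreal c * (\<integral>\<^sup>+\<omega>. extend_infty F (extend_infty g (\<tau> \<omega>)) \<partial>M))"
proof (intro allI impI)
  fix F assume F: "moderate F"
  interpret brownian_space M \<F> B
    by standard (use X in \<open>auto simp: diffusion_def\<close>)
  have sde: "sde_solution M \<F> B b \<sigma> 0 X" using X by (simp add: diffusion_def)
  then have Xad: "adapted_process \<F> X" "continuous_paths M X" by (auto simp: sde_solution_def)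
  obtain \<beta> where \<beta>: "1 < \<beta>" and lim\<beta>: "((\<lambda>\<delta>. SUP (l, x, y)\<in>{(l, x, y). 0 < l \<and> \<bar>x\<bar> < \<delta> * l \<and> \<bar>y\<bar> < \<delta> * l}.
        ereal ((f y - f x) / (the_inv_into {0..} g (\<beta> * l) - the_inv_into {0..} g l))) \<longlongrightarrow> 0) (at_right 0)"
    using lim by blast
  define gi where "gi = the_inv_into {0..} g"
  have inj: "inj_on g {0..}" by (rule strict_mono_on_imp_inj_on[OF g_mono])
  have gi: "g (gi l) = l" "0 \<le> gi l" if "0 \<le> l" for l
    using f_the_inv_into_f[OF inj, of l] the_inv_into_into[OF inj, of l "{0..}"] that by (auto simp: gi_def g_onto)
  have g_le: "g x \<le> g y \<longleftrightarrow> x \<le> y" if "0 \<le> x" "0 \<le> y" for x y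
    using strict_mono_on_less_eq[OF g_mono] that by auto
  have g_nn: "0 \<le> g x" if "0 \<le> x" for x using g_onto that by (metis atLeast_iff imageI)
  have gi_less: "gi l < gi (\<beta> * l)" if "0 < l" for l
  proof -
    have "\<not> g (gi (\<beta> * l)) \<le> g (gi l)" using gi(1)[of l] gi(1)[of "\<beta> * l"] that \<beta> by simp
    then show ?thesis using g_le[of "gi (\<beta> * l)" "gi l"] gi(2)[of l] gi(2)[of "\<beta> * l"] that \<beta> by simp
  qed
  obtain D1 where D1: "1 \<le> D1" "\<And>x. 0 \<le> x \<Longrightarrow> F (\<beta> * x) \<le> D1 * F x"
    using moderate_dilation_bound[OF F, of \<beta>] \<beta> by auto
  \<comment> \<open>The factor that the good-lambda argument can absorb.\<close>
  define \<eta> where "\<eta> = 1 / (2 * D1)"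
  have \<eta>: "0 < \<eta>" using D1 by (simp add: \<eta>_def)
  have "\<forall>\<^sub>F \<delta> in at_right (0::real). (SUP (l, x, y)\<in>{(l, x, y). 0 < l \<and> \<bar>x\<bar> < \<delta> * l \<and> \<bar>y\<bar> < \<delta> * l}.
        ereal ((f y - f x) / (gi (\<beta> * l) - gi l))) < ereal \<eta>"
    unfolding gi_def by (rule order_tendstoD(2)[OF lim\<beta>]) (use \<eta> in simp)
  then have "\<forall>\<^sub>F \<delta> in at_right (0::real). 0 < \<delta> \<and> (SUP (l, x, y)\<in>{(l, x, y). 0 < l \<and> \<bar>x\<bar> < \<delta> * l \<and> \<bar>y\<bar> < \<delta> * l}.
        ereal ((f y - f x) / (gi (\<beta> * l) - gi l))) < ereal \<eta>"
    by (intro eventually_conj eventually_at_right_less)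
  then obtain \<delta>0 :: real where \<delta>0: "0 < \<delta>0" and sup: "(SUP (l, x, y)\<in>{(l, x, y). 0 < l \<and> \<bar>x\<bar> < \<delta>0 * l \<and> \<bar>y\<bar> < \<delta>0 * l}.
        ereal ((f y - f x) / (gi (\<beta> * l) - gi l))) < ereal \<eta>"
    using eventually_happens'[OF trivial_limit_at_right_real] by blast
  have osc: "f y - f x \<le> \<eta> * (gi (\<beta> * l) - gi l)" if l: "0 < l" and xy: "\<bar>x\<bar> < \<delta>0 * l" "\<bar>y\<bar> < \<delta>0 * l" for l x y
  proof -
    have "ereal ((f y - f x) / (gi (\<beta> * l) - gi l)) \<le> (SUP (l, x, y)\<in>{(l, x, y). 0 < l \<and> \<bar>x\<bar> < \<delta>0 * l \<and> \<bar>y\<bar> < \<delta>0 * l}.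
        ereal ((f y - f x) / (gi (\<beta> * l) - gi l)))"
      by (rule SUP_upper2[of "(l, x, y)"]) (use l xy in auto)
    then have "ereal ((f y - f x) / (gi (\<beta> * l) - gi l)) < ereal \<eta>" using sup by (rule le_less_trans)
    then show ?thesis using gi_less[OF l] by (simp add: pos_divide_less_eq)
  qed
  \<comment> \<open>The exit inequality compares values of \<open>f\<close> on \<open>[-2K, 2K]\<close> with \<open>K = \<delta> l\<close>, and \<open>2 \<delta> < \<delta>0\<close>.\<close>
  define \<delta> where "\<delta> = \<delta>0 / 3"
  have \<delta>: "0 < \<delta>" using \<delta>0 by (simp add: \<delta>_def)
  obtain D2 where D2: "1 \<le> D2" "\<And>x. 0 \<le> x \<Longrightarrow> F (1 / \<delta> * x) \<le> D2 * F x"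
    using moderate_dilation_bound[OF F, of "1 / \<delta>"] \<delta> by auto
  show "\<exists>c>0. \<forall>\<tau>. stopping_time \<F> \<tau> \<longrightarrow>
           (\<integral>\<^sup>+\<omega>. extend_infty F (running_max X (\<tau> \<omega>) \<omega>) \<partial>M)
             \<ge> ennreal c * (\<integral>\<^sup>+\<omega>. extend_infty F (extend_infty g (\<tau> \<omega>)) \<partial>M)"
  proof (intro exI[of _ "1 / (2 * D1 * D2)"] conjI allI impI)
    show "0 < 1 / (2 * D1 * D2)" using D1 D2 by simp
    fix \<tau> assume \<tau>: "stopping_time \<F> \<tau>"
    have \<tau>m[measurable]: "\<tau> \<in> borel_measurable M"
      by (rule measurable_stopping_time[OF \<tau> sets_filtration_subset space_filtration])
    \<comment> \<open>Cutting \<open>\<tau>\<close> off at \<open>n\<close> makes the expectation of \<open>F(g(\<tau>))\<close> finite.\<close>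
    define V where "V n \<omega> = g (enn2real (min (\<tau> \<omega>) (ennreal (real n))))" for n :: nat and \<omega>
    define U where "U \<omega> = running_max X (\<tau> \<omega>) \<omega>" for \<omega>
    have Um[measurable]: "U \<in> borel_measurable M"
      unfolding U_def[abs_def] by (rule running_max_measurable[OF Xad \<tau>m])
    have tfin: "min (\<tau> \<omega>) (ennreal (real n)) < \<infinity>" for n \<omega> by (simp add: min_less_iff_disj)
    have Vm[measurable]: "V n \<in> borel_measurable M" for n
    proof -
      have "continuous_on UNIV (\<lambda>x. g (max 0 x))"
        by (rule continuous_on_compose2[OF g_cont]) (auto intro!: continuous_intros)
      then have [measurable]: "(\<lambda>x. g (max 0 x)) \<in> borel_measurable borel" by (rule borel_measurable_continuous_onI)
      have "(\<lambda>\<omega>. g (max 0 (enn2real (min (\<tau> \<omega>) (ennreal (real n)))))) \<in> borel_measurable M" by measurable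
      then show ?thesis by (simp add: V_def[abs_def] max_def)
    qed
    have Vnn: "0 \<le> V n \<omega>" for n \<omega> unfolding V_def by (rule g_nn) simp
    have Vb: "V n \<omega> \<le> g (real n)" for n \<omega>
    proof -
      have "enn2real (min (\<tau> \<omega>) (ennreal (real n))) \<le> real n" by (intro enn2real_leI) auto
      then show ?thesis unfolding V_def by (simp add: g_le)
    qed
    have V_ge: "l \<le> V n \<omega> \<longleftrightarrow> gi l \<le> real n \<and> ennreal (gi l) \<le> \<tau> \<omega>" if l: "0 \<le> l" for l n \<omega>
    proof -
      have "l \<le> V n \<omega> \<longleftrightarrow> gi l \<le> enn2real (min (\<tau> \<omega>) (ennreal (real n)))"
        using g_le[OF gi(2)[OF l], of "enn2real (min (\<tau> \<omega>) (ennreal (real n)))"] gi(1)[OF l] by (simp add: V_def)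
      also have "\<dots> \<longleftrightarrow> ennreal (gi l) \<le> min (\<tau> \<omega>) (ennreal (real n))"
        using tfin[of \<omega> n] gi(2)[OF l] by (metis enn2real_nonneg ennreal_enn2real ennreal_le_iff infinity_ennreal_def)
      also have "\<dots> \<longleftrightarrow> gi l \<le> real n \<and> ennreal (gi l) \<le> \<tau> \<omega>" by (auto simp: ennreal_le_iff)
      finally show ?thesis .
    qed
    have gl: "measure M {\<omega> \<in> space M. \<beta> * l \<le> V n \<omega> \<and> U \<omega> < ennreal (\<delta> * l)}
        \<le> 1 / (2 * D1) * measure M {\<omega> \<in> space M. l \<le> V n \<omega>}" if l: "0 < l" for n l
    proof (cases "gi (\<beta> * l) \<le> real n")
      case False
      have "0 \<le> \<beta> * l" using l \<beta> by simp
      then have "{\<omega> \<in> space M. \<beta> * l \<le> V n \<omega> \<and> U \<omega> < ennreal (\<delta> * l)} = {}" using V_ge False by auto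
      then have "measure M {\<omega> \<in> space M. \<beta> * l \<le> V n \<omega> \<and> U \<omega> < ennreal (\<delta> * l)} = 0" by (simp only: measure_empty)
      then show ?thesis using D1(1) by simp
    next
      case True
      define a c where "a = gi l" and "c = gi (\<beta> * l)"
      have ac: "0 \<le> a" "a < c" using gi(2)[of l] gi_less[OF l] l by (auto simp: a_def c_def)
      define A where "A = {\<omega> \<in> space M. ennreal a < \<tau> \<omega>}"
      define E where "E = {\<omega> \<in> space M. \<beta> * l \<le> V n \<omega> \<and> U \<omega> < ennreal (\<delta> * l)}"
      have A: "A \<in> sets (\<F> (ennreal a))"
        using stopping_timeD2[OF \<tau>, of "ennreal a"] by (simp add: A_def pred_def space_filtration)
      have Em: "E \<in> sets M" unfolding E_def by measurable
      have Ec: "ennreal c \<le> \<tau> \<omega>" if "\<omega> \<in> E" for \<omega>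
        using that V_ge[of "\<beta> * l" n \<omega>] l \<beta> by (simp add: E_def c_def)
      have EA: "E \<subseteq> A"
      proof
        fix \<omega> assume om: "\<omega> \<in> E"
        have "ennreal a < ennreal c" using ac by (simp add: ennreal_less_iff)
        also note Ec[OF om]
        finally show "\<omega> \<in> A" using om by (simp add: A_def E_def)
      qed
      have EK: "\<bar>X s \<omega>\<bar> \<le> \<delta> * l" if "\<omega> \<in> E" "0 \<le> s" "s \<le> c" for \<omega> s
      proof -
        have "ennreal s \<le> \<tau> \<omega>" using Ec[OF that(1)] ennreal_leI[OF that(3)] by (rule order_trans[rotated])
        then have "ennreal \<bar>X s \<omega>\<bar> \<le> U \<omega>" unfolding U_def running_max_def using that(2) by (intro SUP_upper) auto
        also have "U \<omega> < ennreal (\<delta> * l)" using that(1) by (simp add: E_def)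
        finally show ?thesis using \<delta> l by (simp add: ennreal_less_iff)
      qed
      have "(c - a) * measure M E \<le> (\<eta> * (c - a)) * measure M A"
      proof (rule exit_inequality[OF b \<sigma>_locally_bounded sde f_C2 f_gen _ _ ac A Em EA EK])
        show "0 < \<delta> * l" using \<delta> l by simp
        show "f y - f x \<le> \<eta> * (c - a)" if "\<bar>x\<bar> \<le> 2 * (\<delta> * l)" "\<bar>y\<bar> \<le> 2 * (\<delta> * l)" for x y
          unfolding a_def c_def
        proof (rule osc[OF l])
          have "2 * (\<delta> * l) < \<delta>0 * l" using \<delta>0 l by (simp add: \<delta>_def)
          then show "\<bar>x\<bar> < \<delta>0 * l" "\<bar>y\<bar> < \<delta>0 * l" using that by linarith+
        qed
      qed
      then have "(c - a) * measure M E \<le> (c - a) * (\<eta> * measure M A)" by (simp add: ac_simps)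
      then have "measure M E \<le> \<eta> * measure M A" using ac by simp
      also have "\<dots> \<le> \<eta> * measure M {\<omega> \<in> space M. l \<le> V n \<omega>}"
      proof (rule mult_left_mono[OF finite_measure_mono])
        show "A \<subseteq> {\<omega> \<in> space M. l \<le> V n \<omega>}"
        proof
          fix \<omega> assume "\<omega> \<in> A"
          then have "\<omega> \<in> space M" "ennreal a \<le> \<tau> \<omega>" by (auto simp: A_def)
          moreover have "a \<le> real n" using True ac(2) by (simp add: c_def)
          ultimately show "\<omega> \<in> {\<omega> \<in> space M. l \<le> V n \<omega>}" using V_ge[of l n \<omega>] l by (simp add: a_def)
        qed
        show "{\<omega> \<in> space M. l \<le> V n \<omega>} \<in> sets M" by measurable
        show "0 \<le> \<eta>" using \<eta> by simp
      qed
      finally show ?thesis by (simp add: E_def \<eta>_def)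
    qed
    have Vle: "(\<integral>\<^sup>+\<omega>. ennreal (F (V n \<omega>)) \<partial>M) \<le> ennreal (2 * D1 * D2) * (\<integral>\<^sup>+\<omega>. extend_infty F (U \<omega>) \<partial>M)" for n
      by (rule good_lambda_moderate[OF F Um Vm Vnn Vb _ \<delta> D1 D2 gl]) (use \<beta> in auto)
    have [measurable]: "(\<lambda>\<omega>. ennreal (F (V n \<omega>))) \<in> borel_measurable M" for n
    proof -
      have [measurable]: "(\<lambda>x. F (max 0 x)) \<in> borel_measurable borel"
        by (rule borel_measurable_continuous_onI[OF moderate_clamped_continuous[OF F]])
      have "(\<lambda>\<omega>. ennreal (F (max 0 (V n \<omega>)))) \<in> borel_measurable M" by measurable
      then show ?thesis using Vnn by (simp add: max_def)
    qed
    have "(\<integral>\<^sup>+\<omega>. extend_infty F (extend_infty g (\<tau> \<omega>)) \<partial>M) \<le> (\<integral>\<^sup>+\<omega>. (SUP n. ennreal (F (V n \<omega>))) \<partial>M)"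
      unfolding V_def by (intro nn_integral_mono extend_infty_compose_le_SUP[OF F g_mono g_onto])
    also have "\<dots> = (SUP n. \<integral>\<^sup>+\<omega>. ennreal (F (V n \<omega>)) \<partial>M)"
    proof (rule nn_integral_monotone_convergence_SUP)
      show "incseq (\<lambda>n \<omega>. ennreal (F (V n \<omega>)))"
      proof (intro incseq_SucI le_funI ennreal_leI moderateD(2)[OF F] Vnn)
        fix n \<omega>
        have "enn2real (min (\<tau> \<omega>) (ennreal (real n))) \<le> enn2real (min (\<tau> \<omega>) (ennreal (real (Suc n))))"
          using tfin[of \<omega> "Suc n"] by (intro enn2real_mono min.mono ennreal_leI) auto
        then show "V n \<omega> \<le> V (Suc n) \<omega>" unfolding V_def by (subst g_le) auto
      qed
    qed measurable
    also have "\<dots> \<le> ennreal (2 * D1 * D2) * (\<integral>\<^sup>+\<omega>. extend_infty F (U \<omega>) \<partial>M)"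
      by (intro SUP_least Vle)
    finally have "ennreal (1 / (2 * D1 * D2)) * (\<integral>\<^sup>+\<omega>. extend_infty F (extend_infty g (\<tau> \<omega>)) \<partial>M)
        \<le> ennreal (1 / (2 * D1 * D2)) * (ennreal (2 * D1 * D2) * (\<integral>\<^sup>+\<omega>. extend_infty F (U \<omega>) \<partial>M))"
      by (rule mult_left_mono) simp
    also have "\<dots> = (\<integral>\<^sup>+\<omega>. extend_infty F (U \<omega>) \<partial>M)"
    proof -
      have "1 / (2 * D1 * D2) * (2 * D1 * D2) = 1" using D1 D2 by simp
      then have "ennreal (1 / (2 * D1 * D2)) * ennreal (2 * D1 * D2) = 1"
        using D1 D2 by (subst ennreal_mult[symmetric]) auto
      then show ?thesis by (simp add: mult.assoc[symmetric])
    qed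
    finally show "ennreal (1 / (2 * D1 * D2)) * (\<integral>\<^sup>+\<omega>. extend_infty F (extend_infty g (\<tau> \<omega>)) \<partial>M)
        \<le> (\<integral>\<^sup>+\<omega>. extend_infty F (running_max X (\<tau> \<omega>) \<omega>) \<partial>M)" by (simp add: U_def)
  qed
qed

end
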